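(* If the IFS is of finite type, the self-similar set is $K=[0,1]$ and the associated self-similar measure $\mu$ is comparable, then the set of local dimensions of $\mu$ at the points in the essential class is a closed interval.
   Context: Let $S_j(x)=r_jx+d_j:\mathbb R\to\mathbb R$, $j=0,\dots,k$, with $k\ge 1$ and $0<|r_j|<1$ ($r_j$ may be negative), be an iterated function system (IFS). Let $K$ be its self-similar set, i.e. the unique non-empty compact set with $K=\bigcup_{j=0}^kS_j(K)$; it is assumed throughout that the convex hull of $K$ is $[0,1]$. Given probabilities $p_j>0$ with $\sum_{j=0}^kp_j=1$, the associated self-similar measure $\mu$ is the unique Borel probability measure with $\mu=\sum_{j=0}^kp_j\,\mu\circ S_j^{-1}$; its support is $K$. $\dim_{loc}\mu(x)=\lim_{r\to0^+}\frac{\log\mu([x-r,x+r])}{\log r}$ when the limit exists; the set of local dimensions at a set of points is the set of values $\dim_{loc}\mu(x)$ at those points $x$ of the set where the limit exists. $\Sigma$ is the set of finite words on $\{0,\dots,k\}$. For $\sigma=(\sigma_1,\dots,\sigma_j)$ put $\sigma^-=(\sigma_1,\dots,\sigma_{j-1})$, $S_\sigma=S_{\sigma_1}\circ\cdots\circ S_{\sigma_j}$, $r_\sigma=\prod_i r_{\sigma_i}$, $p_\sigma=\prod_ip_{\sigma_i}$ (for the empty word, $S_\sigma=\mathrm{id}$, $r_\sigma=p_\sigma=1$). Put $r_{\min}=\min_j|r_j|$, $\Lambda_n=\{\sigma\in\Sigma: |r_\sigma|\le r_{\min}^n \text{ and } |r_{\sigma^-}|>r_{\min}^n\}$ for $n\ge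 1$, and $\Lambda_0=\{\text{empty word}\}$. Finite type: $\sigma,\tau\in\Lambda_n$ are neighbours if $S_\sigma(0,1)\cap S_\tau(0,1)\ne\emptyset$; $\mathcal N(\sigma)$ is the set of all neighbours of $\sigma$. Words $\sigma\in\Lambda_n$ and $\tau\in\Lambda_m$ have the same neighbourhood type if there is a map $f(x)=\pm r_{\min}^{m-n}x+c$ with $\{f\circ S_\eta:\eta\in\mathcal N(\sigma)\}=\{S_\nu:\nu\in\mathcal N(\tau)\}$ and $f\circ S_\sigma=S_\tau$. The IFS is of finite type if there are only finitely many neighbourhood types. Net intervals: for $n\ge1$ let $h_1<\dots<h_{s_n}$ be the elements of $\{S_\sigma(0),S_\sigma(1):\sigma\in\Lambda_n\}$ in increasing order, and $\mathcal F_n=\{[h_j,h_{j+1}]: 1\le j\le s_n-1,\ (h_j,h_{j+1})\cap K\ne\emptyset\}$; $\mathcal F_0=\{[0,1]\}$. Elements of $\mathcal F_n$ are net intervals of generation $n$. For $n\ge 1$ each $\Delta\in\mathcal F_n$ is contained in a unique $\widehat\Delta\in\mathcal F_{n-1}$, its parent; $\Delta$ is a child of $\widehat\Delta$. Two net intervals of the same generation are adjacent if they share an endpoint. For $\Delta=[a,b]\in\mathcal F_n$: the normalized length is $\ell_n(\Delta)=r_{\min}^{-n}(b-a)$. The neighbour set $V_n(\Delta)=((a_1,L_1),\dots,(a_j,L_j))$ is the tuple of all distinct pairs $(a_i,L_i)=(r_{\min}^{-n}(a-S_\sigma(0)),\,r_{\min}^{-n}r_\sigma)$ with $\sigma\in\Lambda_n$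 and $S_\sigma[0,1]\supseteq\Delta$, ordered so that $a_i\le a_{i+1}$ and, if $a_i=a_{i+1}$, $L_i<L_{i+1}$. For $n\ge1$, if $\Delta_1,\dots,\Delta_t,\dots$ are, from left to right, the children of $\widehat\Delta$ having the same normalized length and neighbour set as $\Delta$, then $t_n(\Delta)$ is the index $t$ with $\Delta_t=\Delta$. The characteristic vector of $\Delta$ is $\mathcal C_n(\Delta)=(\ell_n(\Delta),V_n(\Delta),t_n(\Delta))$; that of $[0,1]$ is $(1,((0,1)),1)$. $\Omega$ is the set of all characteristic vectors (finite for a finite type IFS). The characteristic vectors of the children of $\Delta$ depend only on the characteristic vector of $\Delta$, so one may speak of $\beta\in\Omega$ being a child of $\gamma\in\Omega$. Put $P_n(\Delta)=\sum_{\sigma\in\Lambda_n,\,S_\sigma[0,1]\supseteq\Delta}p_\sigma$. A symbolic representation of a point $x$ is a sequence $[x]=(\mathcal C_0(\Delta_0),\mathcal C_1(\Delta_1),\dots)$ with $\Delta_0=[0,1]$, $x\in\Delta_n\in\mathcal F_n$ for all $n$ and $\Delta_{j-1}$ the parent of $\Delta_j$. Comparable: a self-similar measure associated with a finite type IFS is comparable if for each $q>1$ there is a constant $c=c(q)>0$ such that for all positive integers $n$ and all adjacent net intervals $\Delta_1,\Delta_2$ of generation $n$, $\frac1cq^{-n}P_n(\Delta_2)\le P_n(\Delta_1)\le cq^nP_n(\Delta_2)$. Essential class: an admissible path is a sequence $(\gamma_1,\dots,\gamma_J)$ in $\Omega$ with each $\gamma_j$ a child of $\gamma_{j-1}$.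 A non-empty set $\Omega'\subseteq\Omega$ is a loop class if whenever $\alpha,\beta\in\Omega'$ there is an admissible path $(\gamma_1,\dots,\gamma_J)$ with all $\gamma_i\in\Omega'$, $\gamma_1=\alpha$, $\gamma_J=\beta$. It is an essential class if, in addition, whenever $\alpha\in\Omega'$ and $\beta\in\Omega$ is a child of $\alpha$, then $\beta\in\Omega'$. For a finite type IFS there is exactly one essential class. A point $x\in K$ is in the essential class $\Omega'$ if it has a symbolic representation $(\gamma_0,\gamma_1,\dots)$ with $\gamma_j\in\Omega'$ for all sufficiently large $j$. *)

theory Defs
  imports "HOL-Probability.Probability"
begin

section \<open>Iterated function systems and finite type\<close>

locale ifs =
  fixes k :: nat and r d :: "nat \<Rightarrow> real"
  assumes k_ge_1: "1 \<le> k"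
    and contraction: "j \<le> k \<Longrightarrow> 0 < \<bar>r j\<bar> \<and> \<bar>r j\<bar> < 1"
begin

definition S :: "nat \<Rightarrow> real \<Rightarrow> real"
  where "S j x = r j * x + d j"

definition words :: "nat list set"
  where "words = lists {..k}"

definition S_word :: "nat list \<Rightarrow> real \<Rightarrow> real"
  where "S_word \<sigma> = foldr (\<lambda>j f. S j \<circ> f) \<sigma> id"

definition r_word :: "nat list \<Rightarrow> real"
  where "r_word \<sigma> = prod_list (map r \<sigma>)"

definition r_min :: real
  where "r_min = Min ((\<lambda>j. \<bar>r j\<bar>) ` {..k})"

text \<open>For positive \<open>n\<close> the empty word satisfies \<open>r_min ^ n < 1 = \<bar>r_word []\<bar>\<close>, so the value
  of \<open>butlast []\<close> plays no role.\<close>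

definition \<Lambda> :: "nat \<Rightarrow> nat list set"
  where "\<Lambda> n = (if n = 0 then {[]}
    else {\<sigma> \<in> words. \<bar>r_word \<sigma>\<bar> \<le> r_min ^ n \<and> \<bar>r_word (butlast \<sigma>)\<bar> > r_min ^ n})"

definition neighbours :: "nat \<Rightarrow> nat list \<Rightarrow> nat list set"
  where "neighbours n \<sigma> = {\<tau> \<in> \<Lambda> n. S_word \<sigma> ` {0<..<1} \<inter> S_word \<tau> ` {0<..<1} \<noteq> {}}"

definition same_neighbourhood_type :: "nat \<times> nat list \<Rightarrow> nat \<times> nat list \<Rightarrow> bool"
  where "same_neighbourhood_type = (\<lambda>(n, \<sigma>) (m, \<tau>).
    \<exists>\<epsilon> c. \<epsilon> \<in> {1, -1} \<and>
      (let f = (\<lambda>x. \<epsilon> * r_min powi (int m - int n) * x + c)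
       in (\<lambda>\<eta>. f \<circ> S_word \<eta>) ` neighbours n \<sigma> = S_word ` neighbours m \<tau> \<and>
          f \<circ> S_word \<sigma> = S_word \<tau>))"

definition finite_type :: bool
  where "finite_type \<longleftrightarrow>
    finite ((SIGMA n:UNIV. \<Lambda> n) // {(x, y). x \<in> (SIGMA n:UNIV. \<Lambda> n) \<and> y \<in> (SIGMA n:UNIV. \<Lambda> n) \<and>
      same_neighbourhood_type x y})"

end


section \<open>Net intervals and characteristic vectors\<close>

text \<open>A net interval \<open>[a, b]\<close> is represented by the pair \<open>(a, b)\<close> of its endpoints.\<close>

abbreviation cint :: "real \<times> real \<Rightarrow> real set"
  where "cint \<Delta> \<equiv> {fst \<Delta>..snd \<Delta>}"

definition adjacent :: "real \<times> real \<Rightarrow> real \<times> real \<Rightarrow> bool"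
  where "adjacent \<Delta>\<^sub>1 \<Delta>\<^sub>2 \<longleftrightarrow> snd \<Delta>\<^sub>1 = fst \<Delta>\<^sub>2 \<or> snd \<Delta>\<^sub>2 = fst \<Delta>\<^sub>1"

text \<open>The elements of a finite set of pairs in increasing lexicographic order.\<close>

definition lex_list :: "(real \<times> real) set \<Rightarrow> (real \<times> real) list"
  where "lex_list A =
    concat (map (\<lambda>a. map (Pair a) (sorted_list_of_set {L. (a, L) \<in> A})) (sorted_list_of_set (fst ` A)))"

text \<open>Normalized length, neighbour set, and the index among the like siblings.\<close>

type_synonym char_vector = "real \<times> (real \<times> real) list \<times> nat"

locale self_similar_set = ifs k r d for k :: nat and r d :: "nat \<Rightarrow> real" +
  fixes K :: "real set"
  assumes K_compact: "compact K"
    and K_nonempty: "K \<noteq> {}"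
    and K_self_similar: "K = (\<Union>j\<le>k. S j ` K)"
    and K_hull: "convex hull K = {0..1}"
begin

definition endpoints :: "nat \<Rightarrow> real set"
  where "endpoints n = (\<Union>\<sigma>\<in>\<Lambda> n. {S_word \<sigma> 0, S_word \<sigma> 1})"

definition net_intervals :: "nat \<Rightarrow> (real \<times> real) set"
  where "net_intervals n = (if n = 0 then {(0, 1)}
    else {(a, b). a \<in> endpoints n \<and> b \<in> endpoints n \<and> a < b \<and>
      {a<..<b} \<inter> endpoints n = {} \<and> {a<..<b} \<inter> K \<noteq> {}})"

definition parent :: "nat \<Rightarrow> real \<times> real \<Rightarrow> real \<times> real"
  where "parent n \<Delta> = (THE \<Delta>'. \<Delta>' \<in> net_intervals (n - 1) \<and> cint \<Delta> \<subseteq> cint \<Delta>')"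

definition norm_length :: "nat \<Rightarrow> real \<times> real \<Rightarrow> real"
  where "norm_length n \<Delta> = (snd \<Delta> - fst \<Delta>) / r_min ^ n"

definition covering_words :: "nat \<Rightarrow> real \<times> real \<Rightarrow> nat list set"
  where "covering_words n \<Delta> = {\<sigma> \<in> \<Lambda> n. cint \<Delta> \<subseteq> S_word \<sigma> ` {0..1}}"

definition neighbour_set :: "nat \<Rightarrow> real \<times> real \<Rightarrow> (real \<times> real) list"
  where "neighbour_set n \<Delta> =
    lex_list ((\<lambda>\<sigma>. ((fst \<Delta> - S_word \<sigma> 0) / r_min ^ n, r_word \<sigma> / r_min ^ n)) ` covering_words n \<Delta>)"

text \<open>The position of \<open>\<Delta>\<close>, from left to right, among the children of its parent with the same
  normalized length and neighbour set.\<close>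

definition sibling_index :: "nat \<Rightarrow> real \<times> real \<Rightarrow> nat"
  where "sibling_index n \<Delta> = (if n = 0 then 1
    else card {\<Delta>' \<in> net_intervals n. parent n \<Delta>' = parent n \<Delta> \<and>
      norm_length n \<Delta>' = norm_length n \<Delta> \<and> neighbour_set n \<Delta>' = neighbour_set n \<Delta> \<and>
      fst \<Delta>' \<le> fst \<Delta>})"

definition char_vec :: "nat \<Rightarrow> real \<times> real \<Rightarrow> char_vector"
  where "char_vec n \<Delta> = (norm_length n \<Delta>, neighbour_set n \<Delta>, sibling_index n \<Delta>)"

definition \<Omega> :: "char_vector set"
  where "\<Omega> = {char_vec n \<Delta> | n \<Delta>. \<Delta> \<in> net_intervals n}"

definition is_child :: "char_vector \<Rightarrow> char_vector \<Rightarrow> bool"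
  where "is_child \<beta> \<gamma> \<longleftrightarrow> (\<exists>n \<Delta>. \<Delta> \<in> net_intervals (Suc n) \<and>
    \<beta> = char_vec (Suc n) \<Delta> \<and> \<gamma> = char_vec n (parent (Suc n) \<Delta>))"


subsection \<open>The essential class\<close>

definition admissible_path :: "char_vector list \<Rightarrow> bool"
  where "admissible_path \<gamma>s \<longleftrightarrow>
    \<gamma>s \<noteq> [] \<and> set \<gamma>s \<subseteq> \<Omega> \<and> successively (\<lambda>\<gamma> \<beta>. is_child \<beta> \<gamma>) \<gamma>s"

definition loop_class :: "char_vector set \<Rightarrow> bool"
  where "loop_class \<Omega>' \<longleftrightarrow> \<Omega>' \<noteq> {} \<and> \<Omega>' \<subseteq> \<Omega> \<and>
    (\<forall>\<alpha>\<in>\<Omega>'. \<forall>\<beta>\<in>\<Omega>'. \<exists>\<gamma>s. admissible_path \<gamma>s \<and> set \<gamma>s \<subseteq> \<Omega>' \<and> hd \<gamma>s = \<alpha> \<and> last \<gamma>s = \<beta>)"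

definition is_essential_class :: "char_vector set \<Rightarrow> bool"
  where "is_essential_class \<Omega>' \<longleftrightarrow>
    loop_class \<Omega>' \<and> (\<forall>\<alpha>\<in>\<Omega>'. \<forall>\<beta>\<in>\<Omega>. is_child \<beta> \<alpha> \<longrightarrow> \<beta> \<in> \<Omega>')"

text \<open>An iterated function system of finite type has exactly one essential class.\<close>

definition essential_class :: "char_vector set"
  where "essential_class = (THE \<Omega>'. is_essential_class \<Omega>')"

definition symbolic_representation :: "real \<Rightarrow> (nat \<Rightarrow> char_vector) \<Rightarrow> bool"
  where "symbolic_representation x \<gamma> \<longleftrightarrow> (\<exists>\<Delta>.
    \<Delta> 0 = (0, 1) \<and> (\<forall>n. \<Delta> n \<in> net_intervals n \<and> x \<in> cint (\<Delta> n) \<and>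
      \<Delta> n = parent (Suc n) (\<Delta> (Suc n)) \<and> \<gamma> n = char_vec n (\<Delta> n)))"

definition essential_points :: "real set"
  where "essential_points = {x \<in> K. \<exists>\<gamma>. symbolic_representation x \<gamma> \<and>
    (\<forall>\<^sub>F j in sequentially. \<gamma> j \<in> essential_class)}"

end


section \<open>Self-similar measures and local dimensions\<close>

locale self_similar_measure = self_similar_set k r d K + prob_space \<mu>
  for k :: nat and r d :: "nat \<Rightarrow> real" and K :: "real set" and \<mu> :: "real measure" +
  fixes p :: "nat \<Rightarrow> real"
  assumes sets_\<mu>: "sets \<mu> = sets borel"
    and p_pos: "j \<le> k \<Longrightarrow> 0 < p j"
    and p_sum: "(\<Sum>j\<le>k. p j) = 1"
    and \<mu>_self_similar: "A \<in> sets borel \<Longrightarrow>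
      measure \<mu> A = (\<Sum>j\<le>k. p j * measure (distr \<mu> borel (S j)) A)"
begin

definition p_word :: "nat list \<Rightarrow> real"
  where "p_word \<sigma> = prod_list (map p \<sigma>)"

definition P :: "nat \<Rightarrow> real \<times> real \<Rightarrow> real"
  where "P n \<Delta> = (\<Sum>\<sigma>\<in>covering_words n \<Delta>. p_word \<sigma>)"

definition comparable :: bool
  where "comparable \<longleftrightarrow> (\<forall>q>1. \<exists>c>0. \<forall>n\<ge>1. \<forall>\<Delta>\<^sub>1\<in>net_intervals n. \<forall>\<Delta>\<^sub>2\<in>net_intervals n.
    adjacent \<Delta>\<^sub>1 \<Delta>\<^sub>2 \<longrightarrow>
      1 / c * (1 / q ^ n) * P n \<Delta>\<^sub>2 \<le> P n \<Delta>\<^sub>1 \<and> P n \<Delta>\<^sub>1 \<le> c * q ^ n * P n \<Delta>\<^sub>2)"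

end

definition has_local_dim :: "real measure \<Rightarrow> real \<Rightarrow> real \<Rightarrow> bool"
  where "has_local_dim \<mu> x D \<longleftrightarrow>
    ((\<lambda>\<rho>. ln (measure \<mu> {x - \<rho>..x + \<rho>}) / ln \<rho>) \<longlongrightarrow> D) (at_right 0)"

definition local_dims :: "real measure \<Rightarrow> real set \<Rightarrow> real set"
  where "local_dims \<mu> X = {D. \<exists>x\<in>X. has_local_dim \<mu> x D}"

end

theory Submission
  imports Defs
begin

text \<open>
Write \<open>\<rho> = r_min\<close>. The proof turns local dimensions at essential points into growth rates of a
single function on words and then shows that these growth rates fill an interval.

\<^emph>\<open>From balls to net intervals.\<close> Let \<open>\<Delta>\<^sub>n\<close> be a net interval of generation \<open>n\<close> containing \<open>x\<close>. Finite type
bounds the length of \<open>\<Delta>\<^sub>n\<close> below by a multiple of \<open>\<rho>\<^sup>n\<close>, so a ball of radius about \<open>\<rho>\<^sup>n\<close> around \<open>x\<close>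
contains \<open>\<Delta>\<^sub>n\<close>, and a ball smaller by a constant factor meets only \<open>\<Delta>\<^sub>n\<close> and its two neighbours. Comparability
makes the neighbours harmless, and the local dimension at \<open>x\<close> exists and equals \<open>D\<close> precisely when
\<open>ln (P n \<Delta>\<^sub>n) / n\<close> tends to \<open>D * ln \<rho>\<close> (\<open>has_local_dim_iff\<close>).

\<^emph>\<open>Copies of one net interval.\<close> Finite type also bounds the number of distinct maps \<open>S_word \<sigma>\<close>
with \<open>\<sigma>\<close> covering a net interval. Fix a net interval \<open>Ds\<close> of some generation \<open>m\<close> for which this number
is largest. If \<open>r_word \<tau> = \<rho>\<^sup>l\<close>, then \<open>S_word \<tau>\<close> carries the words of \<open>\<Lambda> m\<close> into \<open>\<Lambda> (l + m)\<close>, so every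
net interval inside \<open>S_word \<tau> ` Ds\<close> inherits all the covering maps of \<open>Ds\<close>; by maximality it has no
others. Hence \<open>S_word \<tau> ` Ds\<close> is itself a net interval, of generation \<open>l + m\<close>, and looks exactly
like \<open>Ds\<close> (\<open>copy_net_interval\<close>, \<open>copy_similar\<close>). Finite type forces each ratio to be commensurable with
\<open>\<rho>\<close>, so such copies are found a bounded number of generations below every net interval
(\<open>exact_descent\<close>). It follows that the characteristic vectors of the proper descendants of \<open>Ds\<close> form the
essential class (\<open>essential_class_eq\<close>).

\<^emph>\<open>Gluing.\<close> For words \<open>\<tau>\<close> with \<open>r_word \<tau> = \<rho>\<^sup>l\<close> and \<open>S_word \<tau> ` {0..1}\<close> inside \<open>Ds\<close>, the
function \<open>\<tau> \<mapsto> ln (P (l + m) (copy \<tau>))\<close> is additive up to a bounded error: after a connecting word of bounded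
length, any such word can be followed by any other. The lower bound (\<open>P_gluing\<close>) starts the connecting
word with the covering map that carries the largest share of \<open>P\<close>; the upper bound (\<open>P_transport\<close>) holds
because descendants of similar net intervals are covered by the same continuations of words.

\<^emph>\<open>The interval.\<close> The growth rates at essential points all lie between the lower and the upper limit of
weight over length for long words. Conversely, given \<open>s\<close> between these limits, one glues words of rate
at most about \<open>s\<close> when the accumulated weight is above \<open>s\<close> times the accumulated length, and words of rate at
least about \<open>s\<close> otherwise (\<open>greedy_gluing\<close>). The nested copies so obtained shrink to an essential point of
rate \<open>s\<close>.
\<close>

section \<open>Stopping words\<close>

context ifs begin

lemma r_word_Nil [simp]: "r_word [] = 1"
  and r_word_Cons [simp]: "r_word (j # \<sigma>) = r j * r_word \<sigma>"
  and r_word_append [simp]: "r_word (\<sigma> @ \<tau>) = r_word \<sigma> * r_word \<tau>"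
  by (auto simp: r_word_def)

lemma S_word_Nil [simp]: "S_word [] x = x"
  and S_word_Cons [simp]: "S_word (j # \<sigma>) x = S j (S_word \<sigma> x)"
  by (auto simp: S_word_def)

lemma S_word_append [simp]: "S_word (\<sigma> @ \<tau>) x = S_word \<sigma> (S_word \<tau> x)"
  by (induction \<sigma>) auto

lemma words_Nil [simp]: "[] \<in> words"
  and words_Cons [simp]: "j # \<sigma> \<in> words \<longleftrightarrow> j \<le> k \<and> \<sigma> \<in> words"
  and words_append [simp]: "\<sigma> @ \<tau> \<in> words \<longleftrightarrow> \<sigma> \<in> words \<and> \<tau> \<in> words"
  by (auto simp: words_def)

lemma S_word_affine: "S_word \<sigma> x = r_word \<sigma> * x + S_word \<sigma> 0"
proof (induction \<sigma> arbitrary: x)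
  case (Cons j \<sigma>)
  show ?case
    unfolding S_word_Cons S_def r_word_Cons using Cons[of x] by (simp add: algebra_simps)
qed simp

lemma r_word_pos: "\<sigma> \<in> words \<Longrightarrow> 0 < \<bar>r_word \<sigma>\<bar>"
proof (induction \<sigma>)
  case (Cons j \<sigma>)
  with contraction[of j] show ?case by (auto simp: abs_mult)
qed auto

lemma r_word_le_1: "\<sigma> \<in> words \<Longrightarrow> \<bar>r_word \<sigma>\<bar> \<le> 1"
proof (induction \<sigma>)
  case (Cons j \<sigma>)
  with contraction[of j] show ?case by (auto simp: abs_mult intro!: mult_le_one)
qed auto

lemma r_min_le: "j \<le> k \<Longrightarrow> r_min \<le> \<bar>r j\<bar>"
  unfolding r_min_def by (intro Min_le) auto

lemma r_min_attained: obtains j where "j \<le> k" "r_min = \<bar>r j\<bar>"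
proof -
  have "r_min \<in> (\<lambda>j. \<bar>r j\<bar>) ` {..k}"
    unfolding r_min_def by (intro Min_in) auto
  then show ?thesis using that by auto
qed

lemma r_min_bounds: "0 < r_min" "r_min < 1"
proof -
  obtain j where "j \<le> k" "r_min = \<bar>r j\<bar>" by (rule r_min_attained)
  with contraction[of j] show "0 < r_min" "r_min < 1" by auto
qed

lemma r_min_nonzero [simp]: "r_min \<noteq> 0"
  using r_min_bounds by simp

lemma r_min_power_bounds [simp]: "0 < r_min ^ n" "r_min ^ n \<noteq> 0" "r_min ^ n \<le> 1" "0 \<le> r_min ^ n"
  using r_min_bounds by (auto intro: power_le_one)

lemma r_min_power_less_iff: "r_min ^ n < r_min ^ m \<longleftrightarrow> m < n"
  using r_min_bounds by (simp add: power_strict_decreasing_iff)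

lemma r_min_power_le_iff: "r_min ^ n \<le> r_min ^ m \<longleftrightarrow> m \<le> n"
  using r_min_bounds by (simp add: power_decreasing_iff)

lemma r_max_exists: obtains R where "0 < R" "R < 1" "\<And>j. j \<le> k \<Longrightarrow> \<bar>r j\<bar> \<le> R"
proof
  let ?R = "Max ((\<lambda>j. \<bar>r j\<bar>) ` {..k})"
  have "?R \<in> (\<lambda>j. \<bar>r j\<bar>) ` {..k}" by (intro Max_in) auto
  then obtain j where "j \<le> k" "?R = \<bar>r j\<bar>" by (elim imageE) auto
  with contraction[of j] show "0 < ?R" "?R < 1" by auto
  show "\<bar>r j\<bar> \<le> ?R" if "j \<le> k" for j using that by (intro Max_ge) auto
qed

text \<open>The words of \<open>\<Lambda> n\<close> are the case \<open>t = r_min ^ n\<close>. Real thresholds are needed because the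
continuations of a word \<open>\<sigma>\<close> of \<open>\<Lambda> n\<close> to words of \<open>\<Lambda> m\<close> form the cut at \<open>r_min ^ m / \<bar>r_word \<sigma>\<bar>\<close>. The
alternative \<open>\<eta> = []\<close> makes the cut at a threshold of at least \<open>1\<close> consist of the empty word.\<close>

definition cut :: "real \<Rightarrow> nat list set"
  where "cut t = {\<eta> \<in> words. \<bar>r_word \<eta>\<bar> \<le> t \<and> (\<eta> = [] \<or> t < \<bar>r_word (butlast \<eta>)\<bar>)}"

lemma butlast_words: "\<sigma> \<in> words \<Longrightarrow> butlast \<sigma> \<in> words"
  by (auto simp: words_def in_lists_conv_set dest: in_set_butlastD)

lemma cut_ge_1: "1 \<le> t \<Longrightarrow> cut t = {[]}"
  unfolding cut_def using r_word_le_1[OF butlast_words] by fastforce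

lemma cut_less_1_not_Nil: "t < 1 \<Longrightarrow> \<eta> \<in> cut t \<Longrightarrow> \<eta> \<noteq> []"
  by (auto simp: cut_def)

lemma cut_words: "cut t \<subseteq> words"
  by (auto simp: cut_def)

lemma \<Lambda>_eq_cut: "\<Lambda> n = cut (r_min ^ n)"
proof (cases "n = 0")
  case True
  then show ?thesis by (simp add: \<Lambda>_def cut_ge_1)
next
  case False
  then have "r_min ^ n < 1" using r_min_power_less_iff[of n 0] by simp
  then show ?thesis using False by (auto simp: \<Lambda>_def cut_def)
qed

lemma \<Lambda>_words: "\<Lambda> n \<subseteq> words"
  by (simp add: \<Lambda>_eq_cut cut_words)

lemma cut_Cons:
  assumes "j \<le> k"
  shows "j # \<eta> \<in> cut t \<longleftrightarrow> t < 1 \<and> \<eta> \<in> cut (t / \<bar>r j\<bar>)"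
proof -
  have pos: "0 < \<bar>r j\<bar>" using contraction assms by auto
  have "\<bar>r_word (butlast (j # \<eta>))\<bar> \<le> 1" if "\<eta> \<in> words"
    using that assms by (intro r_word_le_1 butlast_words) auto
  then show ?thesis
    using pos assms by (auto simp: cut_def field_simps abs_mult)
qed

lemma cut_less_1:
  assumes "t < 1"
  shows "cut t = (\<Union>j\<le>k. (#) j ` cut (t / \<bar>r j\<bar>))"
proof (intro equalityI subsetI)
  fix \<eta> assume \<eta>: "\<eta> \<in> cut t"
  then obtain j \<xi> where "\<eta> = j # \<xi>"
    using cut_less_1_not_Nil[OF assms] by (metis list.exhaust)
  have "j \<le> k" using cut_words \<eta> \<open>\<eta> = j # \<xi>\<close> by fastforce
  moreover from this have "\<xi> \<in> cut (t / \<bar>r j\<bar>)"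
    using cut_Cons \<eta> \<open>\<eta> = j # \<xi>\<close> by simp
  ultimately show "\<eta> \<in> (\<Union>j\<le>k. (#) j ` cut (t / \<bar>r j\<bar>))"
    using \<open>\<eta> = j # \<xi>\<close> by auto
next
  fix \<omega> assume "\<omega> \<in> (\<Union>j\<le>k. (#) j ` cut (t / \<bar>r j\<bar>))"
  then obtain j \<eta> where "j \<le> k" "\<eta> \<in> cut (t / \<bar>r j\<bar>)" "\<omega> = j # \<eta>" by auto
  then show "\<omega> \<in> cut t" using assms cut_Cons[of j] by simp
qed

text \<open>Dividing \<open>t\<close> by a contraction ratio, which is what removing the first letter of a word does to the
threshold, brings \<open>t\<close> above \<open>1\<close> after boundedly many steps.\<close>

lemma cut_induct [consumes 1, case_names large step]:
  assumes "0 < t"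
    and large: "\<And>t. 1 \<le> t \<Longrightarrow> Q t"
    and step: "\<And>t. 0 < t \<Longrightarrow> t < 1 \<Longrightarrow> (\<And>j. j \<le> k \<Longrightarrow> Q (t / \<bar>r j\<bar>)) \<Longrightarrow> Q t"
  shows "Q t"
proof -
  obtain R where R: "0 < R" "R < 1" "\<And>j. j \<le> k \<Longrightarrow> \<bar>r j\<bar> \<le> R"
    by (rule r_max_exists) blast
  have "Q t" if "0 < t" "R ^ n \<le> t" for n t
    using that
  proof (induction n arbitrary: t)
    case 0
    then show ?case by (simp add: large)
  next
    case (Suc n)
    show ?case
    proof (cases "t < 1")
      case True
      show ?thesis
      proof (rule step[OF \<open>0 < t\<close> True])
        fix j assume j: "j \<le> k"
        have p: "0 < \<bar>r j\<bar>" "\<bar>r j\<bar> \<le> R" using R j contraction by auto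
        have "R ^ n * \<bar>r j\<bar> \<le> R ^ n * R" using p R by (intro mult_left_mono) auto
        also have "\<dots> \<le> t" using Suc.prems by (simp add: mult.commute)
        finally show "Q (t / \<bar>r j\<bar>)"
          using p \<open>0 < t\<close> by (intro Suc.IH) (auto simp: field_simps)
      qed
    qed (simp add: large)
  qed
  moreover obtain n where "R ^ n \<le> t"
    using real_arch_pow_inv[OF \<open>0 < t\<close> \<open>R < 1\<close>] by (auto intro: less_imp_le)
  ultimately show ?thesis using \<open>0 < t\<close> by blast
qed

lemma finite_cut: "0 < t \<Longrightarrow> finite (cut t)"
proof (induction t rule: cut_induct)
  case (large t)
  then show ?case by (simp add: cut_ge_1)
next
  case (step t)
  then show ?case by (subst cut_less_1) auto
qed

lemma finite_\<Lambda>: "finite (\<Lambda> n)"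
  by (simp add: \<Lambda>_eq_cut finite_cut)

lemma sum_cut_less_1:
  assumes "0 < t" "t < 1"
  shows "(\<Sum>\<eta>\<in>cut t. F \<eta>) = (\<Sum>j\<le>k. \<Sum>\<eta>\<in>cut (t / \<bar>r j\<bar>). F (j # \<eta>))"
proof -
  have fin: "finite (cut (t / \<bar>r j\<bar>))" if "j \<le> k" for j
    using contraction[OF that] assms by (intro finite_cut) auto
  have "(\<Sum>\<eta>\<in>cut t. F \<eta>) = (\<Sum>j\<le>k. \<Sum>\<eta>\<in>(#) j ` cut (t / \<bar>r j\<bar>). F \<eta>)"
    unfolding cut_less_1[OF assms(2)] using fin by (intro sum.UNION_disjoint) auto
  also have "\<dots> = (\<Sum>j\<le>k. \<Sum>\<eta>\<in>cut (t / \<bar>r j\<bar>). F (j # \<eta>))"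
    by (simp add: sum.reindex)
  finally show ?thesis .
qed

text \<open>A cut is a cross-section of the tree of words: additive mass placed at the root is the total mass of
the cross-section.\<close>

lemma sum_cut:
  fixes F :: "nat list \<Rightarrow> real"
  assumes "0 < t" "\<And>\<sigma>. F \<sigma> = (\<Sum>j\<le>k. F (\<sigma> @ [j]))"
  shows "(\<Sum>\<eta>\<in>cut t. F \<eta>) = F []"
  using assms
proof (induction t arbitrary: F rule: cut_induct)
  case (large t)
  show ?case by (simp add: cut_ge_1[OF large.hyps])
next
  case (step t)
  have "(\<Sum>\<eta>\<in>cut (t / \<bar>r j\<bar>). F (j # \<eta>)) = F [j]" if "j \<le> k" for j
  proof (rule step.IH[OF that])
    show "F (j # \<sigma>) = (\<Sum>i\<le>k. F (j # \<sigma> @ [i]))" for \<sigma>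
      by (subst step.prems) simp
  qed
  then have "(\<Sum>\<eta>\<in>cut t. F \<eta>) = (\<Sum>j\<le>k. F ([] @ [j]))"
    using sum_cut_less_1[OF step.hyps, of F] by simp
  also have "\<dots> = F []" by (rule step.prems[symmetric])
  finally show ?case .
qed

text \<open>Cuts are compatible with prefixes, because passing from \<open>\<sigma>\<close> to \<open>\<sigma> @ \<eta>\<close> multiplies the ratios.\<close>

lemma cut_append:
  assumes "s \<le> t" "0 < s" "\<sigma> \<in> cut t"
  shows "\<sigma> @ \<eta> \<in> cut s \<longleftrightarrow> \<eta> \<in> cut (s / \<bar>r_word \<sigma>\<bar>)"
proof -
  have w: "\<sigma> \<in> words" and pos: "0 < \<bar>r_word \<sigma>\<bar>" and le: "\<bar>r_word \<sigma>\<bar> \<le> t"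
    and *: "\<sigma> = [] \<or> t < \<bar>r_word (butlast \<sigma>)\<bar>"
    using assms cut_words r_word_pos by (auto simp: cut_def)
  show ?thesis
  proof (cases "\<eta> = []")
    case True
    then show ?thesis using * assms w pos by (auto simp: cut_def field_simps)
  next
    case False
    then show ?thesis using w pos by (auto simp: cut_def butlast_append abs_mult field_simps)
  qed
qed

lemma cut_prefix_exists:
  assumes "s \<le> t" "0 < s" "\<omega> \<in> cut s"
  obtains \<sigma> \<eta> where "\<omega> = \<sigma> @ \<eta>" "\<sigma> \<in> cut t"
proof -
  have "\<exists>\<sigma> \<eta>. \<omega> = \<sigma> @ \<eta> \<and> \<sigma> \<in> cut t" if "\<omega> \<in> words" "\<bar>r_word \<omega>\<bar> \<le> t" for \<omega>
    using that
  proof (induction \<omega> rule: rev_induct)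
    case Nil
    then show ?case by (auto simp: cut_def)
  next
    case (snoc j \<omega>)
    show ?case
    proof (cases "\<bar>r_word \<omega>\<bar> \<le> t")
      case True
      with snoc show ?thesis by (metis append.assoc words_append)
    next
      case False
      with snoc.prems have "\<omega> @ [j] \<in> cut t" by (auto simp: cut_def)
      then show ?thesis by blast
    qed
  qed
  moreover have "\<omega> \<in> words" "\<bar>r_word \<omega>\<bar> \<le> t" using assms by (auto simp: cut_def)
  ultimately show ?thesis using that by blast
qed

lemma cut_prefix_unique:
  assumes "\<sigma> \<in> cut t" "\<tau> \<in> cut t" "\<sigma> @ \<eta> = \<tau> @ \<xi>"
  shows "\<sigma> = \<tau>"
proof -
  have *: "\<zeta> = []" if "\<sigma> \<in> cut t" "\<sigma> @ \<zeta> \<in> cut t" for \<sigma> \<zeta>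
  proof (rule ccontr)
    assume "\<zeta> \<noteq> []"
    with that have "t < \<bar>r_word \<sigma>\<bar> * \<bar>r_word (butlast \<zeta>)\<bar>" "\<zeta> \<in> words" "\<bar>r_word \<sigma>\<bar> \<le> t"
      by (auto simp: cut_def butlast_append abs_mult)
    moreover have "\<bar>r_word \<sigma>\<bar> * \<bar>r_word (butlast \<zeta>)\<bar> \<le> \<bar>r_word \<sigma>\<bar>"
      using r_word_le_1[OF butlast_words[OF \<open>\<zeta> \<in> words\<close>]] by (simp add: mult_left_le)
    ultimately show False by linarith
  qed
  from assms(3) obtain us where "\<sigma> = \<tau> @ us \<or> \<sigma> @ us = \<tau>"
    by (auto simp: append_eq_append_conv2)
  then show ?thesis using *[of \<tau> us] *[of \<sigma> us] assms by auto
qed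

lemma \<Lambda>_append:
  assumes "n \<le> m" "\<sigma> \<in> \<Lambda> n"
  shows "\<sigma> @ \<eta> \<in> \<Lambda> m \<longleftrightarrow> \<eta> \<in> cut (r_min ^ m / \<bar>r_word \<sigma>\<bar>)"
  using assms cut_append[of "r_min ^ m" "r_min ^ n" \<sigma> \<eta>] by (simp add: \<Lambda>_eq_cut r_min_power_le_iff)

lemma \<Lambda>_prefix_exists:
  assumes "n \<le> m" "\<omega> \<in> \<Lambda> m"
  obtains \<sigma> \<eta> where "\<omega> = \<sigma> @ \<eta>" "\<sigma> \<in> \<Lambda> n" "\<eta> \<in> cut (r_min ^ m / \<bar>r_word \<sigma>\<bar>)"
proof -
  have "r_min ^ m \<le> r_min ^ n" "\<omega> \<in> cut (r_min ^ m)"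
    using assms by (auto simp: r_min_power_le_iff \<Lambda>_eq_cut)
  then obtain \<sigma> \<eta> where "\<omega> = \<sigma> @ \<eta>" "\<sigma> \<in> cut (r_min ^ n)"
    using cut_prefix_exists r_min_power_bounds(1) by metis
  then show ?thesis
    using that \<Lambda>_append[OF assms(1), of \<sigma> \<eta>] assms(2) by (simp add: \<Lambda>_eq_cut)
qed

lemma \<Lambda>_prefix_unique:
  assumes "\<sigma> \<in> \<Lambda> n" "\<tau> \<in> \<Lambda> n" "\<sigma> @ \<eta> = \<tau> @ \<xi>"
  shows "\<sigma> = \<tau>"
  using assms cut_prefix_unique by (simp add: \<Lambda>_eq_cut)

lemma r_word_\<Lambda>:
  assumes "\<sigma> \<in> \<Lambda> n"
  shows "\<bar>r_word \<sigma>\<bar> \<le> r_min ^ n" "r_min ^ Suc n < \<bar>r_word \<sigma>\<bar>"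
proof -
  show "\<bar>r_word \<sigma>\<bar> \<le> r_min ^ n" using assms by (simp add: \<Lambda>_eq_cut cut_def)
  show "r_min ^ Suc n < \<bar>r_word \<sigma>\<bar>"
  proof (cases "\<sigma> = []")
    case True
    then show ?thesis using r_min_power_less_iff[of "Suc n" 0] by simp
  next
    case False
    then obtain \<tau> j where \<sigma>: "\<sigma> = \<tau> @ [j]" by (metis rev_exhaust)
    with assms have "j \<le> k" "r_min ^ n < \<bar>r_word \<tau>\<bar>" by (auto simp: \<Lambda>_eq_cut cut_def)
    then have "r_min ^ n * r_min < \<bar>r_word \<tau>\<bar> * \<bar>r j\<bar>"
      using r_min_le[of j] r_min_bounds by (intro mult_less_le_imp_less) auto
    then show ?thesis using \<sigma> by (simp add: abs_mult mult.commute)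
  qed
qed

text \<open>Prefixing with such a word shifts the generation by exactly \<open>l\<close>. As \<open>r_word \<tau>\<close> is positive, \<open>S_word \<tau>\<close> also
preserves the left-to-right order used in characteristic vectors.\<close>

definition exact :: "nat list \<Rightarrow> nat \<Rightarrow> bool"
  where "exact \<tau> l \<longleftrightarrow> \<tau> \<in> words \<and> r_word \<tau> = r_min ^ l"

lemma exact_Nil: "exact [] 0"
  by (simp add: exact_def)

lemma exact_append: "exact \<sigma> l \<Longrightarrow> exact \<tau> l' \<Longrightarrow> exact (\<sigma> @ \<tau>) (l + l')"
  by (simp add: exact_def power_add)

text \<open>A word whose ratio is an exact power lies in \<open>\<Lambda> l\<close> automatically, as its last letter contracts
strictly.\<close>

lemma exact_\<Lambda>:
  assumes ex: "exact \<tau> l"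
  shows "\<tau> @ \<sigma> \<in> \<Lambda> (l + n) \<longleftrightarrow> \<sigma> \<in> \<Lambda> n"
proof -
  have \<tau>: "\<tau> \<in> words" "\<bar>r_word \<tau>\<bar> = r_min ^ l" using ex by (simp_all add: exact_def)
  have "\<tau> \<in> \<Lambda> l"
  proof (cases "\<tau> = []")
    case False
    then obtain \<omega> j where \<omega>: "\<tau> = \<omega> @ [j]" by (metis rev_exhaust)
    with \<tau> have "j \<le> k" "\<omega> \<in> words" by auto
    then have "\<bar>r_word \<omega>\<bar> * \<bar>r j\<bar> < \<bar>r_word \<omega>\<bar> * 1"
      using contraction[of j] r_word_pos[of \<omega>] by (intro mult_strict_left_mono) auto
    then show ?thesis using \<tau> \<omega> by (auto simp: \<Lambda>_eq_cut cut_def abs_mult)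
  qed (use \<tau> in \<open>auto simp: \<Lambda>_eq_cut cut_def\<close>)
  from \<Lambda>_append[OF _ this, of "l + n" \<sigma>] show ?thesis
    using \<tau> r_min_bounds by (simp add: power_add \<Lambda>_eq_cut)
qed

end

section \<open>Net intervals when the self-similar set is the unit interval\<close>

locale interval_ifs = self_similar_set k r d K
  for k :: nat and r d :: "nat \<Rightarrow> real" and K :: "real set" +
  assumes K_eq: "K = {0..1}"
begin

lemma unit_interval_self_similar: "{0..1} = (\<Union>j\<le>k. S j ` {0..1})"
  using K_self_similar unfolding K_eq .

lemma S_unit: "j \<le> k \<Longrightarrow> x \<in> {0..1} \<Longrightarrow> S j x \<in> {0..1}"
  using unit_interval_self_similar by blast

lemma S_word_unit: "\<sigma> \<in> words \<Longrightarrow> x \<in> {0..1} \<Longrightarrow> S_word \<sigma> x \<in> {0..1}"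
proof (induction \<sigma>)
  case (Cons j \<sigma>)
  then show ?case using S_unit[of j "S_word \<sigma> x"] by simp
qed simp

text \<open>Iterating \<open>K = (\<Union>j\<le>k. S j ` K)\<close> along the tree of words down to a cut.\<close>

lemma cut_covers:
  assumes "0 < t" "y \<in> {0..1}"
  shows "\<exists>\<eta>\<in>cut t. y \<in> S_word \<eta> ` {0..1}"
  using assms
proof (induction t arbitrary: y rule: cut_induct)
  case (large t)
  then show ?case by (simp add: cut_ge_1)
next
  case (step t)
  obtain j z where jz: "j \<le> k" "z \<in> {0..1}" "y = S j z"
    using step.prems unit_interval_self_similar by blast
  then obtain \<eta> where \<eta>: "\<eta> \<in> cut (t / \<bar>r j\<bar>)" "z \<in> S_word \<eta> ` {0..1}"
    using step.IH by blast
  then have "j # \<eta> \<in> cut t" using jz step.hyps by (simp add: cut_Cons)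
  moreover have "y \<in> S_word (j # \<eta>) ` {0..1}" using \<eta> jz by auto
  ultimately show ?case by blast
qed

definition lo :: "nat list \<Rightarrow> real" where "lo \<sigma> = min (S_word \<sigma> 0) (S_word \<sigma> 1)"
definition hi :: "nat list \<Rightarrow> real" where "hi \<sigma> = max (S_word \<sigma> 0) (S_word \<sigma> 1)"

lemma S_word_1: "S_word \<sigma> 1 = S_word \<sigma> 0 + r_word \<sigma>"
  using S_word_affine[of \<sigma> 1] by simp

lemma hi_minus_lo: "hi \<sigma> - lo \<sigma> = \<bar>r_word \<sigma>\<bar>"
  by (simp add: hi_def lo_def S_word_1)

lemma lo_less_hi: "\<sigma> \<in> words \<Longrightarrow> lo \<sigma> < hi \<sigma>"
  using hi_minus_lo[of \<sigma>] r_word_pos[of \<sigma>] by linarith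

lemma S_word_image: "S_word \<sigma> ` {0..1} = {lo \<sigma>..hi \<sigma>}"
proof -
  have "S_word \<sigma> = (\<lambda>x. r_word \<sigma> * x + S_word \<sigma> 0)" using S_word_affine by blast
  then have "S_word \<sigma> ` {0..1} = (\<lambda>x. r_word \<sigma> * x + S_word \<sigma> 0) ` {0..1}"
    by (rule arg_cong)
  also have "\<dots> = {lo \<sigma>..hi \<sigma>}"
    by (subst image_affinity_atLeastAtMost) (auto simp: lo_def hi_def S_word_1)
  finally show ?thesis .
qed

lemma lo_hi_endpoints: "{S_word \<sigma> 0, S_word \<sigma> 1} = {lo \<sigma>, hi \<sigma>}"
  by (auto simp: lo_def hi_def)

lemma lo_hi_unit: "\<sigma> \<in> words \<Longrightarrow> 0 \<le> lo \<sigma> \<and> hi \<sigma> \<le> 1"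
  using S_word_unit[of \<sigma> 0] S_word_unit[of \<sigma> 1] by (auto simp: lo_def hi_def)

lemma S_word_append_image: "\<eta> \<in> words \<Longrightarrow> S_word (\<sigma> @ \<eta>) ` {0..1} \<subseteq> S_word \<sigma> ` {0..1}"
  using S_word_unit by auto

lemma S_word_append_fun: "S_word (\<sigma> @ \<tau>) = S_word \<sigma> \<circ> S_word \<tau>"
  by (auto simp: fun_eq_iff)

lemma S_word_eq_r_word: "S_word \<sigma> = S_word \<tau> \<Longrightarrow> r_word \<sigma> = r_word \<tau>"
  using S_word_1[of \<sigma>] S_word_1[of \<tau>] by simp

lemma endpoints_eq: "endpoints n = (\<Union>\<sigma>\<in>\<Lambda> n. {lo \<sigma>, hi \<sigma>})"
  unfolding endpoints_def lo_hi_endpoints ..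

lemma lo_endpoint: "\<sigma> \<in> \<Lambda> n \<Longrightarrow> lo \<sigma> \<in> endpoints n"
  and hi_endpoint: "\<sigma> \<in> \<Lambda> n \<Longrightarrow> hi \<sigma> \<in> endpoints n"
  by (auto simp: endpoints_eq)

lemma finite_endpoints: "finite (endpoints n)"
  by (auto simp: endpoints_eq finite_\<Lambda>)

lemma endpoints_unit: "endpoints n \<subseteq> {0..1}"
proof
  fix x assume "x \<in> endpoints n"
  then obtain \<sigma> where "\<sigma> \<in> \<Lambda> n" "x = S_word \<sigma> 0 \<or> x = S_word \<sigma> 1"
    by (auto simp: endpoints_def)
  moreover from this have "\<sigma> \<in> words" using \<Lambda>_words by blast
  ultimately show "x \<in> {0..1}" using S_word_unit[of \<sigma> 0] S_word_unit[of \<sigma> 1] by auto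
qed

text \<open>An extreme point of the unit interval can only be hit at an end of a subinterval.\<close>

lemma extreme_point_lo_hi:
  assumes "\<eta> \<in> words" "e \<in> {0, 1}" "e \<in> S_word \<eta> ` {0..1}"
  shows "\<exists>u\<in>{0, 1}. S_word \<eta> u = e"
proof -
  have "e = lo \<eta> \<or> e = hi \<eta>"
    using assms lo_hi_unit[of \<eta>] unfolding S_word_image by auto
  then have "e \<in> {S_word \<eta> 0, S_word \<eta> 1}" using lo_hi_endpoints[of \<eta>] by simp
  then show ?thesis by auto
qed

text \<open>An endpoint of \<open>S_word \<sigma> ` {0..1}\<close> remains an endpoint of some longer word, since \<open>0\<close> and \<open>1\<close> belong to
\<open>K\<close> and are extreme in it.\<close>

lemma endpoints_mono:
  assumes "n \<le> m"
  shows "endpoints n \<subseteq> endpoints m"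
proof
  fix x assume "x \<in> endpoints n"
  then obtain \<sigma> e where \<sigma>: "\<sigma> \<in> \<Lambda> n" "e \<in> {0, 1}" "x = S_word \<sigma> e"
    by (auto simp: endpoints_def)
  have "\<sigma> \<in> words" using \<sigma>(1) \<Lambda>_words by blast
  then have "0 < r_min ^ m / \<bar>r_word \<sigma>\<bar>" using r_word_pos by simp
  then obtain \<eta> where \<eta>: "\<eta> \<in> cut (r_min ^ m / \<bar>r_word \<sigma>\<bar>)" "e \<in> S_word \<eta> ` {0..1}"
    using cut_covers[of "r_min ^ m / \<bar>r_word \<sigma>\<bar>" e] \<sigma>(2) by auto
  obtain u where "u \<in> {0, 1}" "S_word \<eta> u = e"
    using extreme_point_lo_hi[OF _ \<sigma>(2) \<eta>(2)] \<eta>(1) cut_words by blast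
  moreover have "\<sigma> @ \<eta> \<in> \<Lambda> m" using \<Lambda>_append[OF assms \<sigma>(1)] \<eta>(1) by simp
  ultimately show "x \<in> endpoints m" using \<sigma>(3) unfolding endpoints_def
    by (intro UN_I[of "\<sigma> @ \<eta>"]) auto
qed

lemma endpoints_0: "endpoints 0 = {0, 1}"
  by (simp add: endpoints_def \<Lambda>_def)

lemma zero_one_endpoints: "0 \<in> endpoints n" "1 \<in> endpoints n"
  using endpoints_mono[of 0 n] by (auto simp: endpoints_0)

text \<open>As \<open>K\<close> has no gaps, net intervals are just the intervals between consecutive endpoints, also in
generation \<open>0\<close>.\<close>

lemma net_intervals_iff:
  "(a, b) \<in> net_intervals n \<longleftrightarrow>
    a \<in> endpoints n \<and> b \<in> endpoints n \<and> a < b \<and> {a<..<b} \<inter> endpoints n = {}"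
proof (cases "n = 0")
  case True
  then show ?thesis by (auto simp: net_intervals_def endpoints_0)
next
  case False
  have "{a<..<b} \<inter> K \<noteq> {}" if "a \<in> endpoints n" "b \<in> endpoints n" "a < b"
  proof -
    have "(a + b) / 2 \<in> {a<..<b} \<inter> K" using that endpoints_unit[of n] by (auto simp: K_eq)
    then show ?thesis by blast
  qed
  then show ?thesis using False by (auto simp: net_intervals_def)
qed

lemma net_interval_props:
  assumes "\<Delta> \<in> net_intervals n"
  shows "fst \<Delta> \<in> endpoints n" "snd \<Delta> \<in> endpoints n" "fst \<Delta> < snd \<Delta>" "0 \<le> fst \<Delta>" "snd \<Delta> \<le> 1"
    "{fst \<Delta><..<snd \<Delta>} \<inter> endpoints n = {}"
  using assms net_intervals_iff[of "fst \<Delta>" "snd \<Delta>" n] endpoints_unit[of n] by auto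

lemma net_interval_right:
  assumes "x \<in> endpoints n" "y \<in> endpoints n" "x < y"
  obtains b where "(x, b) \<in> net_intervals n" "b \<le> y"
proof -
  let ?A = "{e \<in> endpoints n. x < e}"
  have fin: "finite ?A" and mem: "y \<in> ?A" using finite_endpoints assms by auto
  have "Min ?A \<in> ?A" using fin mem by (intro Min_in) auto
  moreover have "Min ?A \<le> e" if "e \<in> ?A" for e using fin that by (rule Min_le)
  ultimately have "(x, Min ?A) \<in> net_intervals n"
    using assms by (fastforce simp: net_intervals_iff)
  moreover have "Min ?A \<le> y" using fin mem by (rule Min_le)
  ultimately show ?thesis by (rule that)
qed

lemma net_interval_left:
  assumes "x \<in> endpoints n" "y \<in> endpoints n" "x < y"
  obtains a where "(a, y) \<in> net_intervals n" "x \<le> a"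
proof -
  let ?A = "{e \<in> endpoints n. e < y}"
  have fin: "finite ?A" and mem: "x \<in> ?A" using finite_endpoints assms by auto
  have "Max ?A \<in> ?A" using fin mem by (intro Max_in) auto
  moreover have "e \<le> Max ?A" if "e \<in> ?A" for e using fin that by (rule Max_ge)
  ultimately have "(Max ?A, y) \<in> net_intervals n"
    using assms by (fastforce simp: net_intervals_iff)
  moreover have "x \<le> Max ?A" using fin mem by (rule Max_ge)
  ultimately show ?thesis by (rule that)
qed

lemma net_interval_contains:
  assumes "u \<in> endpoints n" "v \<in> endpoints n" "u \<le> x" "x \<le> v" "u < v"
  obtains \<Delta> where "\<Delta> \<in> net_intervals n" "x \<in> cint \<Delta>" "u \<le> fst \<Delta>" "snd \<Delta> \<le> v"
proof (cases "x = v")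
  case True
  with assms obtain a where "(a, v) \<in> net_intervals n" "u \<le> a"
    using net_interval_left by metis
  then show ?thesis using that[of "(a, v)"] True net_interval_props(3)[of "(a, v)" n] by auto
next
  case False
  let ?A = "{e \<in> endpoints n. e \<le> x}"
  have fin: "finite ?A" and mem: "u \<in> ?A" using finite_endpoints assms by auto
  have m: "Max ?A \<in> ?A" using fin mem by (intro Max_in) auto
  then obtain b where b: "(Max ?A, b) \<in> net_intervals n" "b \<le> v"
    using net_interval_right[of "Max ?A" n v] assms False by auto
  have "x < b"
  proof (rule ccontr)
    assume "\<not> x < b"
    then have "b \<in> ?A" using net_interval_props(2)[OF b(1)] by auto
    then have "b \<le> Max ?A" using fin by (intro Max_ge)
    then show False using net_interval_props(3)[OF b(1)] by simp
  qed
  moreover have "u \<le> Max ?A" using fin mem by (rule Max_ge)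
  ultimately show ?thesis using that[OF b(1)] b(2) m by auto
qed

lemma net_interval_at:
  assumes "x \<in> {0..1}"
  obtains \<Delta> where "\<Delta> \<in> net_intervals n" "x \<in> cint \<Delta>"
  by (rule net_interval_contains[of 0 n 1 x]) (use zero_one_endpoints assms that in auto)

lemma covering_words_iff:
  assumes "\<Delta> \<in> net_intervals n"
  shows "\<sigma> \<in> covering_words n \<Delta> \<longleftrightarrow> \<sigma> \<in> \<Lambda> n \<and> lo \<sigma> \<le> fst \<Delta> \<and> snd \<Delta> \<le> hi \<sigma>"
  using net_interval_props(3)[OF assms] by (auto simp: covering_words_def S_word_image)

lemma covering_words_\<Lambda>: "covering_words n \<Delta> \<subseteq> \<Lambda> n"
  by (auto simp: covering_words_def)

lemma finite_covering_words: "finite (covering_words n \<Delta>)"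
  using covering_words_\<Lambda> finite_\<Lambda> finite_subset by blast

lemma net_interval_no_endpoint:
  assumes "\<Delta> \<in> net_intervals n" "e \<in> endpoints n"
  shows "e \<le> fst \<Delta> \<or> snd \<Delta> \<le> e"
proof (rule ccontr)
  assume "\<not> ?thesis"
  then have "e \<in> {fst \<Delta><..<snd \<Delta>} \<inter> endpoints n" using assms(2) by simp
  then show False using net_interval_props(6)[OF assms(1)] by blast
qed

text \<open>No endpoint of the generation lies in the interior of a net interval, so a word that meets the interior
covers.\<close>

lemma covering_words_overlap:
  assumes "\<Delta> \<in> net_intervals n" "\<sigma> \<in> \<Lambda> n" "lo \<sigma> < snd \<Delta>" "fst \<Delta> < hi \<sigma>"
  shows "\<sigma> \<in> covering_words n \<Delta>"
  using net_interval_no_endpoint[OF assms(1) lo_endpoint[OF assms(2)]]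
    net_interval_no_endpoint[OF assms(1) hi_endpoint[OF assms(2)]] assms
  by (auto simp: covering_words_iff)

lemma covering_words_nonempty:
  assumes "\<Delta> \<in> net_intervals n"
  obtains \<sigma> where "\<sigma> \<in> covering_words n \<Delta>"
proof -
  note p = net_interval_props[OF assms]
  define x where "x = (fst \<Delta> + snd \<Delta>) / 2"
  have x: "fst \<Delta> < x" "x < snd \<Delta>" using p by (auto simp: x_def)
  obtain \<sigma> where "\<sigma> \<in> \<Lambda> n" "x \<in> S_word \<sigma> ` {0..1}"
    using cut_covers[of "r_min ^ n" x] x p by (auto simp: \<Lambda>_eq_cut)
  then have "\<sigma> \<in> covering_words n \<Delta>"
    using x by (intro covering_words_overlap[OF assms]) (auto simp: S_word_image)
  then show ?thesis by (rule that)
qed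

lemma net_interval_length:
  assumes "\<Delta> \<in> net_intervals n"
  shows "snd \<Delta> - fst \<Delta> \<le> r_min ^ n"
proof -
  obtain \<sigma> where "\<sigma> \<in> covering_words n \<Delta>" using covering_words_nonempty[OF assms] .
  then show ?thesis
    using hi_minus_lo[of \<sigma>] r_word_\<Lambda>(1)[of \<sigma> n] by (auto simp: covering_words_iff[OF assms])
qed

lemma ancestor_exists:
  assumes "n \<le> m" "\<Delta>' \<in> net_intervals m"
  obtains \<Delta> where "\<Delta> \<in> net_intervals n" "cint \<Delta>' \<subseteq> cint \<Delta>"
proof -
  note p = net_interval_props[OF assms(2)]
  define x where "x = (fst \<Delta>' + snd \<Delta>') / 2"
  have x: "fst \<Delta>' < x" "x < snd \<Delta>'" using p by (auto simp: x_def)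
  obtain \<Delta> where \<Delta>: "\<Delta> \<in> net_intervals n" "x \<in> cint \<Delta>"
    using net_interval_at[of x n] p x by auto
  have "fst \<Delta> \<in> endpoints m" "snd \<Delta> \<in> endpoints m"
    using net_interval_props[OF \<Delta>(1)] endpoints_mono[OF assms(1)] by auto
  then have "cint \<Delta>' \<subseteq> cint \<Delta>"
    using net_interval_no_endpoint[OF assms(2), of "fst \<Delta>"]
      net_interval_no_endpoint[OF assms(2), of "snd \<Delta>"] x \<Delta>(2) by auto
  then show ?thesis using that \<Delta> by blast
qed

lemma net_interval_overlap_eq:
  assumes "\<Delta>\<^sub>1 \<in> net_intervals n" "\<Delta>\<^sub>2 \<in> net_intervals n" "fst \<Delta>\<^sub>1 < snd \<Delta>\<^sub>2" "fst \<Delta>\<^sub>2 < snd \<Delta>\<^sub>1"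
  shows "\<Delta>\<^sub>1 = \<Delta>\<^sub>2"
proof (rule prod_eqI)
  note p = net_interval_props[OF assms(1)] and q = net_interval_props[OF assms(2)]
  have "fst \<Delta>\<^sub>2 \<le> fst \<Delta>\<^sub>1" "fst \<Delta>\<^sub>1 \<le> fst \<Delta>\<^sub>2"
    using net_interval_no_endpoint[OF assms(1) q(1)] net_interval_no_endpoint[OF assms(2) p(1)]
      assms(3,4) by linarith+
  then show "fst \<Delta>\<^sub>1 = fst \<Delta>\<^sub>2" by simp
  have "snd \<Delta>\<^sub>2 \<le> snd \<Delta>\<^sub>1" "snd \<Delta>\<^sub>1 \<le> snd \<Delta>\<^sub>2"
    using net_interval_no_endpoint[OF assms(1) q(2)] net_interval_no_endpoint[OF assms(2) p(2)]
      assms(3,4) by linarith+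
  then show "snd \<Delta>\<^sub>1 = snd \<Delta>\<^sub>2" by simp
qed

lemma ancestor_unique:
  assumes "\<Delta>\<^sub>1 \<in> net_intervals n" "\<Delta>\<^sub>2 \<in> net_intervals n"
    "cint \<Delta>' \<subseteq> cint \<Delta>\<^sub>1" "cint \<Delta>' \<subseteq> cint \<Delta>\<^sub>2" "fst \<Delta>' < snd \<Delta>'"
  shows "\<Delta>\<^sub>1 = \<Delta>\<^sub>2"
proof -
  have "fst \<Delta>\<^sub>1 \<le> fst \<Delta>'" "snd \<Delta>' \<le> snd \<Delta>\<^sub>1" "fst \<Delta>\<^sub>2 \<le> fst \<Delta>'" "snd \<Delta>' \<le> snd \<Delta>\<^sub>2"
    using assms(3-5) by simp_all
  with assms(5) show ?thesis by (intro net_interval_overlap_eq[OF assms(1,2)]) linarith+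
qed

lemma parent_eq_iff:
  assumes "\<Delta>' \<in> net_intervals (Suc n)"
  shows "parent (Suc n) \<Delta>' = \<Delta> \<longleftrightarrow> \<Delta> \<in> net_intervals n \<and> cint \<Delta>' \<subseteq> cint \<Delta>"
proof -
  obtain \<Delta>\<^sub>0 where \<Delta>\<^sub>0: "\<Delta>\<^sub>0 \<in> net_intervals n" "cint \<Delta>' \<subseteq> cint \<Delta>\<^sub>0"
    using ancestor_exists[OF _ assms, of n] by (metis le_SucI order_refl)
  then have "\<exists>!\<Delta>. \<Delta> \<in> net_intervals n \<and> cint \<Delta>' \<subseteq> cint \<Delta>"
    by (metis ancestor_unique net_interval_props(3)[OF assms])
  note ex1 = this
  have "parent (Suc n) \<Delta>' \<in> net_intervals n \<and> cint \<Delta>' \<subseteq> cint (parent (Suc n) \<Delta>')"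
    unfolding parent_def diff_Suc_1 by (rule theI'[OF ex1])
  with ex1 show ?thesis by blast
qed

lemma parent_net_interval:
  assumes "\<Delta>' \<in> net_intervals (Suc n)"
  shows "parent (Suc n) \<Delta>' \<in> net_intervals n" "cint \<Delta>' \<subseteq> cint (parent (Suc n) \<Delta>')"
  using parent_eq_iff[OF assms, of "parent (Suc n) \<Delta>'"] by auto

lemma descendant_through:
  assumes "\<Delta>\<^sub>1 \<in> net_intervals n" "\<Delta>\<^sub>2 \<in> net_intervals m" "n \<le> m"
    "cint \<Delta> \<subseteq> cint \<Delta>\<^sub>1" "cint \<Delta> \<subseteq> cint \<Delta>\<^sub>2" "fst \<Delta> < snd \<Delta>"
  shows "cint \<Delta>\<^sub>2 \<subseteq> cint \<Delta>\<^sub>1"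
proof -
  obtain \<Delta>\<^sub>3 where 3: "\<Delta>\<^sub>3 \<in> net_intervals n" "cint \<Delta>\<^sub>2 \<subseteq> cint \<Delta>\<^sub>3"
    using ancestor_exists[OF assms(3,2)] by blast
  then have "\<Delta>\<^sub>3 = \<Delta>\<^sub>1"
    using subset_trans[OF assms(5) 3(2)] by (intro ancestor_unique[OF 3(1) assms(1) _ assms(4,6)])
  with 3 show ?thesis by simp
qed

text \<open>The words covering a descendant are found by continuing the words that cover the ancestor. This is the
reason why the subdivision of a net interval depends only on its covering maps.\<close>

lemma covering_words_descendant:
  assumes "n \<le> m" "\<Delta> \<in> net_intervals n" "\<Delta>' \<in> net_intervals m" "cint \<Delta>' \<subseteq> cint \<Delta>"
  shows "covering_words m \<Delta>' = {\<sigma> @ \<eta> | \<sigma> \<eta>. \<sigma> \<in> covering_words n \<Delta> \<and>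
    \<eta> \<in> cut (r_min ^ m / \<bar>r_word \<sigma>\<bar>) \<and> cint \<Delta>' \<subseteq> S_word (\<sigma> @ \<eta>) ` {0..1}}" (is "?L = ?R")
proof (intro equalityI subsetI)
  fix \<omega> assume \<omega>: "\<omega> \<in> ?L"
  then have "\<omega> \<in> \<Lambda> m" using covering_words_\<Lambda> by blast
  then obtain \<sigma> \<eta> where *: "\<omega> = \<sigma> @ \<eta>" "\<sigma> \<in> \<Lambda> n" "\<eta> \<in> cut (r_min ^ m / \<bar>r_word \<sigma>\<bar>)"
    using \<Lambda>_prefix_exists[OF assms(1)] by metis
  have sub: "cint \<Delta>' \<subseteq> S_word \<omega> ` {0..1}" using \<omega> by (simp add: covering_words_def)
  moreover have "S_word \<omega> ` {0..1} \<subseteq> S_word \<sigma> ` {0..1}"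
    using S_word_append_image * cut_words by blast
  ultimately have "cint \<Delta>' \<subseteq> {lo \<sigma>..hi \<sigma>}" unfolding S_word_image by (rule subset_trans)
  then have "\<sigma> \<in> covering_words n \<Delta>"
    using assms(4) net_interval_props(3)[OF assms(3)]
    by (intro covering_words_overlap[OF assms(2) *(2)]) auto
  then show "\<omega> \<in> ?R" using * sub by blast
next
  fix \<omega> assume "\<omega> \<in> ?R"
  then show "\<omega> \<in> ?L"
    using \<Lambda>_append[OF assms(1)] covering_words_\<Lambda> by (auto simp: covering_words_def)
qed

end

section \<open>Finiteness consequences of finite type\<close>

context interval_ifs begin

lemma S_word_image_open: "{lo \<sigma><..<hi \<sigma>} \<subseteq> S_word \<sigma> ` {0<..<1}"
proof
  fix x assume x: "x \<in> {lo \<sigma><..<hi \<sigma>}"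
  then have "x \<in> S_word \<sigma> ` {0..1}" by (simp add: S_word_image)
  then obtain u where u: "u \<in> {0..1}" "x = S_word \<sigma> u" by blast
  have "u \<noteq> 0" "u \<noteq> 1" using x u(2) by (auto simp: lo_def hi_def)
  then show "x \<in> S_word \<sigma> ` {0<..<1}" using u by auto
qed

lemma neighboursI:
  assumes "\<tau> \<in> \<Lambda> n" "lo \<sigma> < x" "x < hi \<sigma>" "lo \<tau> < x" "x < hi \<tau>"
  shows "\<tau> \<in> neighbours n \<sigma>"
  using assms S_word_image_open[of \<sigma>] S_word_image_open[of \<tau>] unfolding neighbours_def
  by fastforce

lemma covering_words_neighbours:
  assumes "\<Delta> \<in> net_intervals n" "\<sigma> \<in> covering_words n \<Delta>"
  shows "covering_words n \<Delta> \<subseteq> neighbours n \<sigma>"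
proof
  fix \<tau> assume "\<tau> \<in> covering_words n \<Delta>"
  then show "\<tau> \<in> neighbours n \<sigma>"
    using assms net_interval_props(3)[OF assms(1)]
    by (intro neighboursI[of _ _ _ "(fst \<Delta> + snd \<Delta>) / 2"])
       (auto simp: covering_words_iff[OF assms(1)])
qed

text \<open>The three invariants below are built from absolute values and cardinalities, so the slope of the similarity is
recorded up to sign.\<close>

lemma same_neighbourhood_typeE:
  assumes "same_neighbourhood_type (n, \<sigma>) (m, \<tau>)"
  obtains s c where "\<bar>s\<bar> = r_min ^ m / r_min ^ n"
    "(\<lambda>\<eta>. (\<lambda>x. s * x + c) \<circ> S_word \<eta>) ` neighbours n \<sigma> = S_word ` neighbours m \<tau>"
    "(\<lambda>x. s * x + c) \<circ> S_word \<sigma> = S_word \<tau>"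
proof -
  obtain \<epsilon> c where *: "\<epsilon> \<in> {1, -1::real}"
    "(\<lambda>\<eta>. (\<lambda>x. \<epsilon> * r_min powi (int m - int n) * x + c) \<circ> S_word \<eta>) ` neighbours n \<sigma> = S_word ` neighbours m \<tau>"
    "(\<lambda>x. \<epsilon> * r_min powi (int m - int n) * x + c) \<circ> S_word \<sigma> = S_word \<tau>"
    using assms unfolding same_neighbourhood_type_def Let_def by auto
  have "r_min powi (int m - int n) = r_min ^ m / r_min ^ n"
    using r_min_bounds by (simp add: power_int_diff)
  then have "\<bar>\<epsilon> * r_min powi (int m - int n)\<bar> = r_min ^ m / r_min ^ n"
    using *(1) r_min_power_bounds(1) by (auto simp: abs_mult)
  then show ?thesis using that * by blast
qed

lemma same_neighbourhood_type_refl: "same_neighbourhood_type (n, \<sigma>) (n, \<sigma>)"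
  unfolding same_neighbourhood_type_def Let_def split
  by (intro exI[of _ 1] exI[of _ 0]) (auto simp: fun_eq_iff image_def)

lemma r_word_same_type:
  assumes "same_neighbourhood_type (n, \<sigma>) (m, \<tau>)"
  shows "\<bar>r_word \<sigma>\<bar> / r_min ^ n = \<bar>r_word \<tau>\<bar> / r_min ^ m"
proof -
  obtain s c where s: "\<bar>s\<bar> = r_min ^ m / r_min ^ n" "(\<lambda>x. s * x + c) \<circ> S_word \<sigma> = S_word \<tau>"
    using same_neighbourhood_typeE[OF assms] by metis
  have "S_word \<tau> 0 = s * S_word \<sigma> 0 + c" "S_word \<tau> 1 = s * S_word \<sigma> 1 + c"
    using s(2) by (simp_all add: fun_eq_iff)
  then have "r_word \<tau> = s * r_word \<sigma>" by (simp add: S_word_1 algebra_simps)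
  then show ?thesis using s(1) by (simp add: abs_mult)
qed

lemma card_neighbour_maps_same_type:
  assumes "same_neighbourhood_type (n, \<sigma>) (m, \<tau>)"
  shows "card (S_word ` neighbours n \<sigma>) = card (S_word ` neighbours m \<tau>)"
proof -
  obtain s c where s: "\<bar>s\<bar> = r_min ^ m / r_min ^ n"
    "(\<lambda>\<eta>. (\<lambda>x. s * x + c) \<circ> S_word \<eta>) ` neighbours n \<sigma> = S_word ` neighbours m \<tau>"
    using same_neighbourhood_typeE[OF assms] by metis
  have "s \<noteq> 0" using s(1) by auto
  then have "inj (\<lambda>v. (\<lambda>x. s * x + c) \<circ> (v :: real \<Rightarrow> real))" by (auto simp: inj_def fun_eq_iff)
  then have "card ((\<lambda>v. (\<lambda>x. s * x + c) \<circ> v) ` S_word ` neighbours n \<sigma>) = card (S_word ` neighbours n \<sigma>)"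
    by (intro card_image) (auto simp: inj_on_def inj_def)
  then show ?thesis using s(2) by (simp add: image_image)
qed

text \<open>The normalized lengths of net intervals are among these numbers, by
\<open>norm_length_neighbour_gap\<close>. Absolute values make the set insensitive to orientation.\<close>

definition neighbour_gaps :: "nat \<Rightarrow> nat list \<Rightarrow> real set"
  where "neighbour_gaps n \<sigma> = (\<Union>u\<in>S_word ` neighbours n \<sigma>. \<Union>v\<in>S_word ` neighbours n \<sigma>.
    \<Union>e\<in>{0, 1}. \<Union>e'\<in>{0, 1}. {\<bar>u e - v e'\<bar> / r_min ^ n})"

lemma neighbour_gaps_same_type:
  assumes "same_neighbourhood_type (n, \<sigma>) (m, \<tau>)"
  shows "neighbour_gaps n \<sigma> = neighbour_gaps m \<tau>"
proof -
  obtain s c where s: "\<bar>s\<bar> = r_min ^ m / r_min ^ n"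
    "(\<lambda>\<eta>. (\<lambda>x. s * x + c) \<circ> S_word \<eta>) ` neighbours n \<sigma> = S_word ` neighbours m \<tau>"
    using same_neighbourhood_typeE[OF assms] by metis
  have eq: "\<bar>(s * x + c) - (s * y + c)\<bar> / r_min ^ m = \<bar>x - y\<bar> / r_min ^ n" for x y
  proof -
    have "(s * x + c) - (s * y + c) = s * (x - y)" by (simp add: algebra_simps)
    then show ?thesis using s(1) by (simp add: abs_mult)
  qed
  have "neighbour_gaps m \<tau> = (\<Union>\<eta>\<in>neighbours n \<sigma>. \<Union>\<xi>\<in>neighbours n \<sigma>. \<Union>e\<in>{0, 1}. \<Union>e'\<in>{0, 1}.
      {\<bar>(s * S_word \<eta> e + c) - (s * S_word \<xi> e' + c)\<bar> / r_min ^ m})"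
    unfolding neighbour_gaps_def s(2)[symmetric] by simp
  also have "\<dots> = neighbour_gaps n \<sigma>" unfolding eq unfolding neighbour_gaps_def by simp
  finally show ?thesis by simp
qed

lemma finite_neighbours: "finite (neighbours n \<sigma>)"
  using finite_\<Lambda> by (simp add: neighbours_def)

lemma finite_neighbour_gaps: "finite (neighbour_gaps n \<sigma>)"
  using finite_neighbours by (simp add: neighbour_gaps_def)

text \<open>An endpoint in the interior of the image of \<open>\<sigma>\<close> belongs to a word whose open image overlaps that of \<open>\<sigma>\<close>; an
endpoint on its boundary belongs to \<open>\<sigma>\<close> itself.\<close>

lemma endpoint_neighbour:
  assumes "\<sigma> \<in> \<Lambda> n" "e \<in> endpoints n" "lo \<sigma> \<le> e" "e \<le> hi \<sigma>"
  obtains \<eta> u where "\<eta> \<in> neighbours n \<sigma>" "u \<in> {0, 1}" "e = S_word \<eta> u"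
proof -
  have w: "\<tau> \<in> \<Lambda> n \<Longrightarrow> lo \<tau> < hi \<tau>" for \<tau> using \<Lambda>_words lo_less_hi by blast
  have "\<exists>\<eta>\<in>neighbours n \<sigma>. e = lo \<eta> \<or> e = hi \<eta>"
  proof (cases "e = lo \<sigma> \<or> e = hi \<sigma>")
    case True
    moreover have "\<sigma> \<in> neighbours n \<sigma>"
      using w[OF assms(1)] assms(1) by (intro neighboursI[of _ _ _ "(lo \<sigma> + hi \<sigma>) / 2"]) auto
    ultimately show ?thesis by blast
  next
    case False
    then have e: "lo \<sigma> < e" "e < hi \<sigma>" using assms by auto
    obtain \<eta> where \<eta>: "\<eta> \<in> \<Lambda> n" "e = lo \<eta> \<or> e = hi \<eta>"
      using assms(2) by (auto simp: endpoints_eq)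
    have "\<eta> \<in> neighbours n \<sigma>"
    proof (cases "e = lo \<eta>")
      case True
      then show ?thesis using e w[OF \<eta>(1)] \<eta>(1)
        by (intro neighboursI[of _ _ _ "(e + min (hi \<sigma>) (hi \<eta>)) / 2"]) auto
    next
      case False
      then have "e = hi \<eta>" using \<eta>(2) by simp
      then show ?thesis using e w[OF \<eta>(1)] \<eta>(1)
        by (intro neighboursI[of _ _ _ "(e + max (lo \<sigma>) (lo \<eta>)) / 2"]) auto
    qed
    with \<eta>(2) show ?thesis by blast
  qed
  then obtain \<eta> where \<eta>: "\<eta> \<in> neighbours n \<sigma>" "e \<in> {S_word \<eta> 0, S_word \<eta> 1}"
    using lo_hi_endpoints by auto
  then show ?thesis using that[of \<eta>] by auto
qed

lemma norm_length_neighbour_gap: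
  assumes "\<Delta> \<in> net_intervals n" "\<sigma> \<in> covering_words n \<Delta>"
  shows "(snd \<Delta> - fst \<Delta>) / r_min ^ n \<in> neighbour_gaps n \<sigma>"
proof -
  note p = net_interval_props[OF assms(1)]
  have \<sigma>: "\<sigma> \<in> \<Lambda> n" "lo \<sigma> \<le> fst \<Delta>" "snd \<Delta> \<le> hi \<sigma>"
    using assms by (auto simp: covering_words_iff[OF assms(1)])
  obtain \<eta> u where 1: "\<eta> \<in> neighbours n \<sigma>" "u \<in> {0, 1}" "fst \<Delta> = S_word \<eta> u"
    using endpoint_neighbour[OF \<sigma>(1) p(1)] \<sigma> p by force
  obtain \<xi> v where 2: "\<xi> \<in> neighbours n \<sigma>" "v \<in> {0, 1}" "snd \<Delta> = S_word \<xi> v"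
    using endpoint_neighbour[OF \<sigma>(1) p(2)] \<sigma> p by force
  have "snd \<Delta> - fst \<Delta> = \<bar>S_word \<xi> v - S_word \<eta> u\<bar>" using p 1 2 by simp
  then show ?thesis unfolding neighbour_gaps_def using 1 2
    by (intro UN_I[of "S_word \<xi>"] UN_I[of "S_word \<eta>"] UN_I[of v] UN_I[of u]) auto
qed

end

locale finite_type_interval_ifs = interval_ifs +
  assumes finite_type: "finite_type"
begin

text \<open>A quantity that is constant on neighbourhood types takes finitely many values.\<close>

lemma finite_type_invariant:
  assumes "\<And>n \<sigma> m \<tau>. \<sigma> \<in> \<Lambda> n \<Longrightarrow> \<tau> \<in> \<Lambda> m \<Longrightarrow>
    same_neighbourhood_type (n, \<sigma>) (m, \<tau>) \<Longrightarrow> I n \<sigma> = I m \<tau>"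
  shows "finite {I n \<sigma> | n \<sigma>. \<sigma> \<in> \<Lambda> n}"
proof -
  let ?A = "SIGMA n:UNIV. \<Lambda> n"
  let ?R = "{(x, y). x \<in> ?A \<and> y \<in> ?A \<and> same_neighbourhood_type x y}"
  let ?J = "\<lambda>X. case (SOME y. y \<in> X) of (n, \<sigma>) \<Rightarrow> I n \<sigma>"
  have "{I n \<sigma> | n \<sigma>. \<sigma> \<in> \<Lambda> n} \<subseteq> ?J ` (?A // ?R)"
  proof
    fix z assume "z \<in> {I n \<sigma> | n \<sigma>. \<sigma> \<in> \<Lambda> n}"
    then obtain n \<sigma> where \<sigma>: "\<sigma> \<in> \<Lambda> n" "z = I n \<sigma>" by blast
    let ?X = "?R `` {(n, \<sigma>)}"
    have "(n, \<sigma>) \<in> ?X" using \<sigma> same_neighbourhood_type_refl by auto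
    then have s: "(SOME y. y \<in> ?X) \<in> ?X" by (rule someI)
    obtain m \<tau> where \<tau>: "(SOME y. y \<in> ?X) = (m, \<tau>)" by fastforce
    have "\<tau> \<in> \<Lambda> m" "same_neighbourhood_type (n, \<sigma>) (m, \<tau>)" using s unfolding \<tau> by auto
    then have "z = I m \<tau>" using assms \<sigma> by metis
    then have "z = ?J ?X" unfolding \<tau> by simp
    moreover have "?X \<in> ?A // ?R" using \<sigma>(1) by (intro quotientI) auto
    ultimately show "z \<in> ?J ` (?A // ?R)" by (rule image_eqI)
  qed
  moreover have "finite (?A // ?R)" using finite_type unfolding finite_type_def .
  ultimately show ?thesis using finite_surj by blast
qed

lemma covering_maps_bounded:
  obtains N where "\<And>n \<Delta>. \<Delta> \<in> net_intervals n \<Longrightarrow> card (S_word ` covering_words n \<Delta>) \<le> N"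
proof -
  let ?C = "{card (S_word ` neighbours n \<sigma>) | n \<sigma>. \<sigma> \<in> \<Lambda> n}"
  have fin: "finite ?C"
    by (rule finite_type_invariant) (rule card_neighbour_maps_same_type)
  show ?thesis
  proof (rule that)
    fix n \<Delta> assume \<Delta>: "\<Delta> \<in> net_intervals n"
    obtain \<sigma> where \<sigma>: "\<sigma> \<in> covering_words n \<Delta>" using covering_words_nonempty[OF \<Delta>] .
    have "card (S_word ` covering_words n \<Delta>) \<le> card (S_word ` neighbours n \<sigma>)"
      using covering_words_neighbours[OF \<Delta> \<sigma>] finite_neighbours by (intro card_mono) auto
    also have "\<sigma> \<in> \<Lambda> n" using \<sigma> covering_words_\<Lambda> by blast
    then have "card (S_word ` neighbours n \<sigma>) \<le> Max ?C" using fin by (intro Max_ge) blast+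
    finally show "card (S_word ` covering_words n \<Delta>) \<le> Max ?C" .
  qed
qed

lemma net_interval_length_lower:
  obtains c where "0 < c" "\<And>n \<Delta>. \<Delta> \<in> net_intervals n \<Longrightarrow> c * r_min ^ n \<le> snd \<Delta> - fst \<Delta>"
proof -
  let ?G = "\<Union>{neighbour_gaps n \<sigma> | n \<sigma>. \<sigma> \<in> \<Lambda> n}"
  let ?P = "insert 1 {g \<in> ?G. 0 < g}"
  have "finite {neighbour_gaps n \<sigma> | n \<sigma>. \<sigma> \<in> \<Lambda> n}"
    by (rule finite_type_invariant) (rule neighbour_gaps_same_type)
  moreover have "finite G" if "G \<in> {neighbour_gaps n \<sigma> | n \<sigma>. \<sigma> \<in> \<Lambda> n}" for G
    using that finite_neighbour_gaps by auto
  ultimately have "finite ?G" by (rule finite_Union)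
  then have "finite {g \<in> ?G. 0 < g}" by (rule finite_subset[rotated]) blast
  then have fin: "finite ?P" by (rule finite.insertI)
  show ?thesis
  proof (rule that)
    have "Min ?P \<in> ?P" using fin by (intro Min_in) auto
    then show "0 < Min ?P" by auto
    fix n \<Delta> assume \<Delta>: "\<Delta> \<in> net_intervals n"
    obtain \<sigma> where \<sigma>: "\<sigma> \<in> covering_words n \<Delta>" using covering_words_nonempty[OF \<Delta>] .
    have "\<sigma> \<in> \<Lambda> n" using \<sigma> covering_words_\<Lambda> by blast
    then have "(snd \<Delta> - fst \<Delta>) / r_min ^ n \<in> ?P"
      using norm_length_neighbour_gap[OF \<Delta> \<sigma>] net_interval_props(3)[OF \<Delta>] by auto
    then have "Min ?P \<le> (snd \<Delta> - fst \<Delta>) / r_min ^ n" using fin by (intro Min_le)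
    then show "Min ?P * r_min ^ n \<le> snd \<Delta> - fst \<Delta>" by (simp add: pos_le_divide_eq)
  qed
qed

lemma finite_normalized_ratios: "finite {r_word \<sigma> / r_min ^ n | n \<sigma>. \<sigma> \<in> \<Lambda> n}"
proof -
  let ?Y = "{\<bar>r_word \<sigma>\<bar> / r_min ^ n | n \<sigma>. \<sigma> \<in> \<Lambda> n}"
  have "finite ?Y" by (rule finite_type_invariant) (rule r_word_same_type)
  then have "finite (?Y \<union> uminus ` ?Y)" by (intro finite_UnI finite_imageI)
  moreover have "{r_word \<sigma> / r_min ^ n | n \<sigma>. \<sigma> \<in> \<Lambda> n} \<subseteq> ?Y \<union> uminus ` ?Y"
  proof
    fix y assume "y \<in> {r_word \<sigma> / r_min ^ n | n \<sigma>. \<sigma> \<in> \<Lambda> n}"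
    then obtain n \<sigma> where *: "\<sigma> \<in> \<Lambda> n" "y = r_word \<sigma> / r_min ^ n" by blast
    then have "\<bar>y\<bar> \<in> ?Y" by auto
    show "y \<in> ?Y \<union> uminus ` ?Y"
    proof (cases "0 \<le> y")
      case True
      with \<open>\<bar>y\<bar> \<in> ?Y\<close> show ?thesis by simp
    next
      case False
      then have "y = - \<bar>y\<bar>" by simp
      then have "y \<in> uminus ` ?Y" using \<open>\<bar>y\<bar> \<in> ?Y\<close> by (rule image_eqI)
      then show ?thesis by (rule UnI2)
    qed
  qed
  ultimately show ?thesis by (rule finite_subset[rotated])
qed

lemma r_word_replicate: "r_word (replicate t j) = r j ^ t"
  by (induction t) auto

text \<open>The normalized ratios of the words \<open>[j, \<dots>, j]\<close> in \<open>\<Lambda> n\<close>, for \<open>n = 0, 1, \<dots>\<close>, take finitely many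
values, so two of them agree by the pigeonhole principle; comparing the exponents gives the relation.\<close>

lemma ratio_commensurable:
  assumes "j \<le> k"
  obtains e f where "0 < e" "\<bar>r j\<bar> ^ e = r_min ^ f"
proof -
  have rj: "0 < \<bar>r j\<bar>" "\<bar>r j\<bar> < 1" using contraction[OF assms] by auto
  define T where "T n = (LEAST t. \<bar>r j\<bar> ^ t \<le> r_min ^ n)" for n
  have T\<Lambda>: "replicate (T n) j \<in> \<Lambda> n" for n
  proof -
    have "\<exists>t. \<bar>r j\<bar> ^ t \<le> r_min ^ n"
      using real_arch_pow_inv[OF r_min_power_bounds(1) rj(2)] by (auto intro: less_imp_le)
    then have 1: "\<bar>r j\<bar> ^ T n \<le> r_min ^ n" unfolding T_def by (rule LeastI_ex)
    have 2: "r_min ^ n < \<bar>r j\<bar> ^ (T n - 1)" if "T n \<noteq> 0"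
    proof -
      have "T n - 1 < T n" using that by simp
      then show ?thesis using not_less_Least[of "T n - 1"] unfolding T_def by force
    qed
    show ?thesis using 1 2 assms
      by (auto simp: \<Lambda>_eq_cut cut_def words_def butlast_conv_take r_word_replicate power_abs)
  qed
  let ?g = "\<lambda>n. r_word (replicate (T n) j) / r_min ^ n"
  have "range ?g \<subseteq> {r_word \<sigma> / r_min ^ n | n \<sigma>. \<sigma> \<in> \<Lambda> n}" using T\<Lambda> by blast
  then have "finite (range ?g)" using finite_normalized_ratios finite_subset by blast
  then have "\<not> inj ?g" using finite_imageD infinite_UNIV_nat by blast
  then obtain a b where "?g a = ?g b" "a < b"
    unfolding inj_def by (metis linorder_neqE_nat)
  then have "r j ^ T a / r_min ^ a = r j ^ T b / r_min ^ b" by (simp add: r_word_replicate)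
  then have "\<bar>r j ^ T a / r_min ^ a\<bar> = \<bar>r j ^ T b / r_min ^ b\<bar>" by simp
  then have eq: "\<bar>r j\<bar> ^ T a * r_min ^ b = \<bar>r j\<bar> ^ T b * r_min ^ a"
    using r_min_bounds by (simp add: abs_divide power_abs field_simps)
  have "r_min ^ b = r_min ^ a * r_min ^ (b - a)" using \<open>a < b\<close> by (simp flip: power_add)
  with eq have eq2: "\<bar>r j\<bar> ^ T a * r_min ^ (b - a) = \<bar>r j\<bar> ^ T b" by simp
  have "r_min ^ (b - a) < r_min ^ 0" using \<open>a < b\<close> by (subst r_min_power_less_iff) simp
  then have "\<bar>r j\<bar> ^ T a * r_min ^ (b - a) < \<bar>r j\<bar> ^ T a * 1"
    using rj by (intro mult_strict_left_mono) auto
  with eq2 have "T a < T b" using rj by (simp add: power_strict_decreasing_iff)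
  moreover have "\<bar>r j\<bar> ^ T b = \<bar>r j\<bar> ^ T a * \<bar>r j\<bar> ^ (T b - T a)"
    using \<open>T a < T b\<close> by (simp flip: power_add)
  ultimately show ?thesis using that[of "T b - T a" "b - a"] eq2 rj by simp
qed

text \<open>The exponent is doubled to absorb the signs of the ratios.\<close>

lemma word_ratio_commensurable:
  obtains E where "0 < E" "\<And>\<sigma>. \<sigma> \<in> words \<Longrightarrow> \<exists>f. r_word \<sigma> ^ E = r_min ^ f"
proof -
  have "\<forall>j\<in>{..k}. \<exists>ef. 0 < fst ef \<and> \<bar>r j\<bar> ^ fst ef = r_min ^ snd ef"
  proof
    fix j assume "j \<in> {..k}"
    then have "j \<le> k" by simp
    then obtain e f where "0 < e" "\<bar>r j\<bar> ^ e = r_min ^ f" by (rule ratio_commensurable)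
    then show "\<exists>ef. 0 < fst ef \<and> \<bar>r j\<bar> ^ fst ef = r_min ^ snd ef"
      by (intro exI[of _ "(e, f)"]) simp
  qed
  then obtain ef where *: "\<forall>j\<in>{..k}. 0 < fst (ef j) \<and> \<bar>r j\<bar> ^ fst (ef j) = r_min ^ snd (ef j)"
    by (rule bchoice[THEN exE])
  define e f where "e j = fst (ef j)" and "f j = snd (ef j)" for j
  have ef: "0 < e j \<and> \<bar>r j\<bar> ^ e j = r_min ^ f j" if "j \<le> k" for j
    using * that by (simp add: e_def f_def)
  let ?E = "2 * (\<Prod>j\<le>k. e j)"
  have letter: "\<exists>f. r j ^ ?E = r_min ^ f" if "j \<le> k" for j
  proof -
    have "e j dvd (\<Prod>j\<le>k. e j)" using that by (intro dvd_prodI) auto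
    then obtain q where q: "(\<Prod>j\<le>k. e j) = e j * q" ..
    have "r j ^ ?E = (\<bar>r j\<bar> ^ e j) ^ (2 * q)"
      unfolding q by (simp add: power_mult[symmetric] mult.left_commute power_even_abs)
    also have "\<dots> = r_min ^ (f j * (2 * q))" using ef[OF that] by (simp add: power_mult)
    finally show ?thesis ..
  qed
  have "\<exists>f. r_word \<sigma> ^ ?E = r_min ^ f" if "\<sigma> \<in> words" for \<sigma>
    using that
  proof (induction \<sigma>)
    case Nil
    show ?case by (intro exI[of _ 0]) simp
  next
    case (Cons j \<sigma>)
    then obtain f where "r_word \<sigma> ^ ?E = r_min ^ f" by auto
    moreover obtain g where "r j ^ ?E = r_min ^ g" using letter Cons.prems by auto
    ultimately have "r_word (j # \<sigma>) ^ ?E = r_min ^ (g + f)"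
      unfolding r_word_Cons power_mult_distrib power_add by (simp only:)
    then show ?case ..
  qed
  moreover have "0 < ?E" using ef by (auto intro!: prod_pos)
  ultimately show ?thesis by (intro that)
qed

text \<open>If \<open>\<tau>\<close> has the same normalized ratio as \<open>\<sigma>\<close>, then appending \<open>E - 1\<close> copies of \<open>\<tau>\<close> to \<open>\<sigma>\<close> gives a
ratio that differs from \<open>r_word \<tau> ^ E\<close> by a power of \<open>r_min\<close>, hence an exact power. As there are finitely many
normalized ratios, boundedly many letters suffice.\<close>

lemma exact_completion:
  obtains C where "\<And>n \<sigma>. \<sigma> \<in> \<Lambda> n \<Longrightarrow>
    \<exists>\<zeta>\<in>words. \<exists>l. exact (\<sigma> @ \<zeta>) l \<and> n \<le> l \<and> l \<le> n + C"
proof -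
  obtain E where E: "0 < E" "\<And>\<sigma>. \<sigma> \<in> words \<Longrightarrow> \<exists>f. r_word \<sigma> ^ E = r_min ^ f"
    by (rule word_ratio_commensurable) (rule that)
  let ?Y = "{r_word \<sigma> / r_min ^ n | n \<sigma>. \<sigma> \<in> \<Lambda> n}"
  have "\<forall>y. \<exists>N \<tau> f. y \<in> ?Y \<longrightarrow> \<tau> \<in> \<Lambda> N \<and> y = r_word \<tau> / r_min ^ N \<and> r_word \<tau> ^ E = r_min ^ f"
    using E(2) \<Lambda>_words by blast
  then obtain N where "\<forall>y. \<exists>\<tau> f. y \<in> ?Y \<longrightarrow>
      \<tau> \<in> \<Lambda> (N y) \<and> y = r_word \<tau> / r_min ^ N y \<and> r_word \<tau> ^ E = r_min ^ f"
    by (rule choice[THEN exE])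
  then obtain \<tau> where "\<forall>y. \<exists>f. y \<in> ?Y \<longrightarrow>
      \<tau> y \<in> \<Lambda> (N y) \<and> y = r_word (\<tau> y) / r_min ^ N y \<and> r_word (\<tau> y) ^ E = r_min ^ f"
    by (rule choice[THEN exE])
  then obtain f where "\<forall>y. y \<in> ?Y \<longrightarrow>
      \<tau> y \<in> \<Lambda> (N y) \<and> y = r_word (\<tau> y) / r_min ^ N y \<and> r_word (\<tau> y) ^ E = r_min ^ f y"
    by (rule choice[THEN exE])
  then have Y: "\<And>y. y \<in> ?Y \<Longrightarrow>
      \<tau> y \<in> \<Lambda> (N y) \<and> y = r_word (\<tau> y) / r_min ^ N y \<and> r_word (\<tau> y) ^ E = r_min ^ f y"
    by simp
  show ?thesis
  proof (rule that)
    fix n \<sigma> assume \<sigma>: "\<sigma> \<in> \<Lambda> n"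
    define y where "y = r_word \<sigma> / r_min ^ n"
    have y: "y \<in> ?Y" unfolding y_def using \<sigma> by blast
    note Yy = Y[OF y]
    define \<zeta> where "\<zeta> = concat (replicate (E - 1) (\<tau> y))"
    have \<tau>w: "\<tau> y \<in> words" and \<sigma>w: "\<sigma> \<in> words" using Yy \<sigma> \<Lambda>_words by auto
    have cr: "concat (replicate i (\<tau> y)) \<in> words \<and> r_word (concat (replicate i (\<tau> y))) = r_word (\<tau> y) ^ i" for i
      using \<tau>w by (induction i) auto
    then have \<zeta>: "\<zeta> \<in> words" "r_word \<zeta> = r_word (\<tau> y) ^ (E - 1)" by (auto simp: \<zeta>_def)
    have "r_word \<sigma> = r_word (\<tau> y) / r_min ^ N y * r_min ^ n"
      using Yy unfolding y_def by (simp add: field_simps)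
    then have "r_word (\<sigma> @ \<zeta>) = r_word (\<tau> y) ^ E / r_min ^ N y * r_min ^ n"
      using \<zeta>(2) E(1) by (simp add: power_eq_if)
    then have *: "r_word (\<sigma> @ \<zeta>) = r_min ^ (f y + n) / r_min ^ N y"
      using Yy by (simp add: power_add)
    have "\<bar>r_word (\<sigma> @ \<zeta>)\<bar> \<le> 1" using \<sigma>w \<zeta> by (intro r_word_le_1) simp
    then have "r_min ^ (f y + n) \<le> r_min ^ N y" unfolding * by (simp add: abs_divide)
    then have le: "N y \<le> f y + n" by (simp add: r_min_power_le_iff)
    have r: "r_word (\<sigma> @ \<zeta>) = r_min ^ (f y + n - N y)"
      unfolding * using le r_min_bounds by (simp add: power_diff)
    have "\<bar>r_word (\<sigma> @ \<zeta>)\<bar> \<le> r_min ^ n"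
    proof -
      have "\<bar>r_word \<sigma>\<bar> * \<bar>r_word \<zeta>\<bar> \<le> \<bar>r_word \<sigma>\<bar>" using r_word_le_1[OF \<zeta>(1)] by (simp add: mult_left_le)
      then show ?thesis using r_word_\<Lambda>(1)[OF \<sigma>] by (simp add: abs_mult)
    qed
    then have "n \<le> f y + n - N y" unfolding r by (simp add: r_min_power_le_iff)
    moreover have "f y \<le> Max (f ` ?Y)" using y finite_normalized_ratios by (intro Max_ge) auto
    moreover have "exact (\<sigma> @ \<zeta>) (f y + n - N y)" using r \<sigma>w \<zeta>(1) by (simp add: exact_def)
    ultimately show "\<exists>\<zeta>\<in>words. \<exists>l. exact (\<sigma> @ \<zeta>) l \<and> n \<le> l \<and> l \<le> n + Max (f ` ?Y)"
      using \<zeta>(1) by (intro bexI[of _ \<zeta>] exI[of _ "f y + n - N y"]) auto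
  qed
qed

text \<open>Follow \<open>\<sigma>\<close> towards the midpoint of \<open>\<Delta>\<close> until the image is shorter than half of \<open>\<Delta>\<close>, which takes a bounded
number of generations because \<open>\<Delta>\<close> is not too short; then complete to an exact word.\<close>

lemma exact_descent:
  obtains C where "\<And>n \<Delta> \<sigma>. \<Delta> \<in> net_intervals n \<Longrightarrow> \<sigma> \<in> covering_words n \<Delta> \<Longrightarrow>
    \<exists>\<eta>\<in>words. \<exists>l. exact (\<sigma> @ \<eta>) l \<and> n \<le> l \<and> l \<le> n + C \<and>
      S_word (\<sigma> @ \<eta>) ` {0..1} \<subseteq> cint \<Delta>"
proof -
  obtain c where c: "0 < c" "\<And>n \<Delta>. \<Delta> \<in> net_intervals n \<Longrightarrow> c * r_min ^ n \<le> snd \<Delta> - fst \<Delta>"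
    by (rule net_interval_length_lower) (rule that)
  obtain s where s: "r_min ^ s < c / 2" using real_arch_pow_inv[of "c / 2" r_min] c r_min_bounds by auto
  obtain C where C: "\<And>n \<sigma>. \<sigma> \<in> \<Lambda> n \<Longrightarrow>
    \<exists>\<zeta>\<in>words. \<exists>l. exact (\<sigma> @ \<zeta>) l \<and> n \<le> l \<and> l \<le> n + C"
    by (rule exact_completion) (rule that)
  show ?thesis
  proof (rule that)
    fix n \<Delta> \<sigma> assume \<Delta>: "\<Delta> \<in> net_intervals n" and "\<sigma> \<in> covering_words n \<Delta>"
    then have \<sigma>: "\<sigma> \<in> \<Lambda> n" "lo \<sigma> \<le> fst \<Delta>" "snd \<Delta> \<le> hi \<sigma>" by (auto simp: covering_words_iff)
    note p = net_interval_props[OF \<Delta>]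
    define x where "x = (fst \<Delta> + snd \<Delta>) / 2"
    have "x \<in> S_word \<sigma> ` {0..1}" using \<sigma> p unfolding S_word_image by (simp add: x_def)
    then obtain y where y: "y \<in> {0..1}" "x = S_word \<sigma> y" by blast
    have "\<sigma> \<in> words" using \<sigma>(1) \<Lambda>_words by blast
    then have "0 < r_min ^ (n + s) / \<bar>r_word \<sigma>\<bar>" using r_word_pos by simp
    then obtain \<xi> where \<xi>: "\<xi> \<in> cut (r_min ^ (n + s) / \<bar>r_word \<sigma>\<bar>)" "y \<in> S_word \<xi> ` {0..1}"
      using cut_covers y by blast
    then have \<omega>: "\<sigma> @ \<xi> \<in> \<Lambda> (n + s)" using \<Lambda>_append[of n "n + s" \<sigma> \<xi>] \<sigma> by simp
    then obtain \<zeta> l where \<zeta>: "\<zeta> \<in> words" "exact ((\<sigma> @ \<xi>) @ \<zeta>) l" "n + s \<le> l" "l \<le> n + s + C"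
      using C by blast
    have "x \<in> S_word (\<sigma> @ \<xi>) ` {0..1}" using y \<xi>(2) by auto
    then have x: "lo (\<sigma> @ \<xi>) \<le> x" "x \<le> hi (\<sigma> @ \<xi>)" unfolding S_word_image by auto
    have "hi (\<sigma> @ \<xi>) - lo (\<sigma> @ \<xi>) \<le> r_min ^ s * r_min ^ n"
      using r_word_\<Lambda>(1)[OF \<omega>] unfolding hi_minus_lo by (simp add: power_add mult.commute)
    also have "\<dots> \<le> c / 2 * r_min ^ n" using s by (intro mult_right_mono) auto
    also have "\<dots> \<le> (snd \<Delta> - fst \<Delta>) / 2" using c(2)[OF \<Delta>] by simp
    finally have "S_word (\<sigma> @ \<xi>) ` {0..1} \<subseteq> cint \<Delta>"
      using x unfolding S_word_image x_def by auto
    then have "S_word ((\<sigma> @ \<xi>) @ \<zeta>) ` {0..1} \<subseteq> cint \<Delta>"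
      using S_word_append_image[OF \<zeta>(1)] by blast
    moreover have "\<xi> @ \<zeta> \<in> words" using \<zeta>(1) \<xi>(1) cut_words by auto
    ultimately show "\<exists>\<eta>\<in>words. \<exists>l. exact (\<sigma> @ \<eta>) l \<and> n \<le> l \<and> l \<le> n + (s + C) \<and>
      S_word (\<sigma> @ \<eta>) ` {0..1} \<subseteq> cint \<Delta>"
      using \<zeta> by (intro bexI[of _ "\<xi> @ \<zeta>"] exI[of _ l]) auto
  qed
qed

end

section \<open>Similar net intervals\<close>

lemma set_lex_list:
  assumes "finite A"
  shows "set (lex_list A) = A"
proof -
  have "finite {L. (a, L) \<in> A}" for a
  proof (rule finite_subset)
    show "{L. (a, L) \<in> A} \<subseteq> snd ` A" by force
  qed (use assms in simp)
  then show ?thesis using assms unfolding lex_list_def by force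
qed

context interval_ifs begin

text \<open>The similarity \<open>f\<close> preserves orientation and scales generation \<open>n\<close> to generation \<open>m\<close>. This relation is
equality of normalized length and neighbour set (\<open>similar_net_char\<close> and \<open>similar_netI\<close>), in a form that keeps
the similarity at hand.\<close>

definition similar_net :: "nat \<Rightarrow> real \<times> real \<Rightarrow> nat \<Rightarrow> real \<times> real \<Rightarrow> (real \<Rightarrow> real) \<Rightarrow> bool"
  where "similar_net n \<Delta> m \<Delta>' f \<longleftrightarrow> \<Delta> \<in> net_intervals n \<and> \<Delta>' \<in> net_intervals m \<and>
    (\<exists>c. f = (\<lambda>x. r_min ^ m / r_min ^ n * x + c)) \<and> \<Delta>' = map_prod f f \<Delta> \<and>
    (\<lambda>\<sigma>. f \<circ> S_word \<sigma>) ` covering_words n \<Delta> = S_word ` covering_words m \<Delta>'"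

lemma similar_netD:
  assumes "similar_net n \<Delta> m \<Delta>' f"
  shows "\<Delta> \<in> net_intervals n" "\<Delta>' \<in> net_intervals m" "\<Delta>' = map_prod f f \<Delta>"
    "fst \<Delta>' = f (fst \<Delta>)" "snd \<Delta>' = f (snd \<Delta>)"
    "f x \<le> f y \<longleftrightarrow> x \<le> y" "f x < f y \<longleftrightarrow> x < y" "f x - f y = r_min ^ m / r_min ^ n * (x - y)"
proof -
  show 1: "\<Delta> \<in> net_intervals n" "\<Delta>' \<in> net_intervals m" "\<Delta>' = map_prod f f \<Delta>"
    using assms by (auto simp: similar_net_def)
  show "fst \<Delta>' = f (fst \<Delta>)" "snd \<Delta>' = f (snd \<Delta>)" by (simp_all add: 1(3))
  obtain c where f: "f = (\<lambda>x. r_min ^ m / r_min ^ n * x + c)"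
    using assms by (auto simp: similar_net_def)
  have s: "0 < r_min ^ m / r_min ^ n" by simp
  show "f x \<le> f y \<longleftrightarrow> x \<le> y" "f x < f y \<longleftrightarrow> x < y" unfolding f
    by (simp_all only: add_le_cancel_right add_less_cancel_right mult_le_cancel_left_pos[OF s] mult_less_cancel_left_pos[OF s])
  show "f x - f y = r_min ^ m / r_min ^ n * (x - y)" unfolding f by (simp add: algebra_simps diff_divide_distrib)
qed

lemma similar_net_sym:
  assumes "similar_net n \<Delta> m \<Delta>' f"
  obtains g where "similar_net m \<Delta>' n \<Delta> g" "\<And>x. g (f x) = x" "\<And>x. f (g x) = x"
proof -
  note d = similar_netD[OF assms]
  obtain c where f: "f = (\<lambda>x. r_min ^ m / r_min ^ n * x + c)"
    using assms by (auto simp: similar_net_def)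
  define g where "g = (\<lambda>x. r_min ^ n / r_min ^ m * x + (- (r_min ^ n / r_min ^ m * c)))"
  have gf: "g (f x) = x" and fg: "f (g x) = x" for x
    unfolding f g_def by (simp_all add: field_simps)
  have eq: "(\<lambda>\<sigma>. f \<circ> S_word \<sigma>) ` covering_words n \<Delta> = S_word ` covering_words m \<Delta>'"
    using assms by (simp add: similar_net_def)
  have "g \<circ> (f \<circ> h) = h" for h :: "real \<Rightarrow> real" by (simp add: fun_eq_iff gf)
  then have "S_word ` covering_words n \<Delta> = (\<lambda>h. g \<circ> h) ` (\<lambda>\<sigma>. f \<circ> S_word \<sigma>) ` covering_words n \<Delta>"
    by (simp add: image_image)
  also have "\<dots> = (\<lambda>\<sigma>. g \<circ> S_word \<sigma>) ` covering_words m \<Delta>'"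
    unfolding eq by (simp add: image_image)
  finally have "(\<lambda>\<sigma>. g \<circ> S_word \<sigma>) ` covering_words m \<Delta>' = S_word ` covering_words n \<Delta>" by simp
  moreover have "\<Delta> = map_prod g g \<Delta>'" using d(4,5) gf by (simp add: prod_eq_iff)
  ultimately have "similar_net m \<Delta>' n \<Delta> g"
    unfolding similar_net_def using d(1,2) unfolding g_def by blast
  then show ?thesis using that gf fg by simp
qed

lemma similar_net_word:
  assumes "similar_net n \<Delta> m \<Delta>' f" "\<sigma> \<in> covering_words n \<Delta>"
  obtains \<sigma>' where "\<sigma>' \<in> covering_words m \<Delta>'" "S_word \<sigma>' = f \<circ> S_word \<sigma>"
    "\<And>i. r_min ^ (m + i) / \<bar>r_word \<sigma>'\<bar> = r_min ^ (n + i) / \<bar>r_word \<sigma>\<bar>"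
proof -
  have "f \<circ> S_word \<sigma> \<in> S_word ` covering_words m \<Delta>'"
    using assms by (auto simp: similar_net_def)
  then obtain \<sigma>' where \<sigma>': "\<sigma>' \<in> covering_words m \<Delta>'" "S_word \<sigma>' = f \<circ> S_word \<sigma>" by auto
  have "r_word \<sigma>' = f (S_word \<sigma> 1) - f (S_word \<sigma> 0)"
    using \<sigma>'(2) S_word_1[of \<sigma>'] by simp
  then have "r_word \<sigma>' = r_min ^ m / r_min ^ n * r_word \<sigma>"
    unfolding similar_netD(8)[OF assms(1)] by (simp add: S_word_1)
  then have "r_min ^ (m + i) / \<bar>r_word \<sigma>'\<bar> = r_min ^ (n + i) / \<bar>r_word \<sigma>\<bar>" for i
    by (simp add: abs_mult power_add)
  then show ?thesis using that \<sigma>' by blast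
qed

text \<open>An endpoint inside \<open>\<Delta>\<close> comes from a continuation of a covering word. The corresponding covering word of
\<open>\<Delta>'\<close> has the same continuations, since the similarity rescales its ratio by the same factor as the
generation.\<close>

lemma similar_net_endpoint:
  assumes "similar_net n \<Delta> m \<Delta>' f" "e \<in> endpoints (n + i)" "e \<in> cint \<Delta>"
  shows "f e \<in> endpoints (m + i)"
proof (cases "e = fst \<Delta> \<or> e = snd \<Delta>")
  case True
  then show ?thesis
    using net_interval_props(1,2)[OF similar_netD(2)[OF assms(1)]] endpoints_mono[of m "m + i"]
      similar_netD(4,5)[OF assms(1)] by auto
next
  case False
  then have e: "fst \<Delta> < e" "e < snd \<Delta>" using assms(3) by auto
  obtain \<omega> u where \<omega>: "\<omega> \<in> \<Lambda> (n + i)" "u \<in> {0, 1}" "e = S_word \<omega> u"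
    using assms(2) by (auto simp: endpoints_def)
  obtain \<sigma> \<eta> where \<sigma>: "\<omega> = \<sigma> @ \<eta>" "\<sigma> \<in> \<Lambda> n" "\<eta> \<in> cut (r_min ^ (n + i) / \<bar>r_word \<sigma>\<bar>)"
    using \<Lambda>_prefix_exists[OF _ \<omega>(1), of n] by auto
  have "S_word \<eta> u \<in> {0..1}" using \<sigma>(3) cut_words \<omega>(2) by (intro S_word_unit) auto
  then have "e \<in> S_word \<sigma> ` {0..1}" using \<omega>(3) \<sigma>(1) by auto
  then have "\<sigma> \<in> covering_words n \<Delta>"
    using e unfolding S_word_image
    by (intro covering_words_overlap[OF similar_netD(1)[OF assms(1)] \<sigma>(2)]) auto
  then obtain \<sigma>' where \<sigma>': "\<sigma>' \<in> covering_words m \<Delta>'" "S_word \<sigma>' = f \<circ> S_word \<sigma>"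
    "\<And>i. r_min ^ (m + i) / \<bar>r_word \<sigma>'\<bar> = r_min ^ (n + i) / \<bar>r_word \<sigma>\<bar>"
    using similar_net_word[OF assms(1)] by blast
  then have "\<sigma>' @ \<eta> \<in> \<Lambda> (m + i)"
    using \<Lambda>_append[of m "m + i" \<sigma>' \<eta>] \<sigma>(3) covering_words_\<Lambda>[of m \<Delta>'] by auto
  moreover have "f e = S_word (\<sigma>' @ \<eta>) u" using \<omega>(3) \<sigma>(1) \<sigma>'(2) by simp
  ultimately show ?thesis unfolding endpoints_def using \<omega>(2) by (intro UN_I) auto
qed

lemma similar_net_image:
  assumes "similar_net n \<Delta> m \<Delta>' f"
  shows "f ` {a..b} = {f a..f b}"
proof -
  obtain g where g: "similar_net m \<Delta>' n \<Delta> g" "\<And>x. g (f x) = x" "\<And>x. f (g x) = x"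
    by (rule similar_net_sym[OF assms]) (rule that)
  show ?thesis
  proof (intro equalityI subsetI)
    fix y assume "y \<in> {f a..f b}"
    then have "g y \<in> {a..b}" using similar_netD(6)[OF assms, of a "g y"] similar_netD(6)[OF assms, of "g y" b] g(3) by auto
    then show "y \<in> f ` {a..b}" using g(3)[of y] by (metis imageI)
  qed (use similar_netD(6)[OF assms] in auto)
qed

lemma similar_net_covering_word:
  assumes "similar_net n \<Delta> m \<Delta>' f" "\<Delta>\<^sub>1 \<in> net_intervals (n + i)" "cint \<Delta>\<^sub>1 \<subseteq> cint \<Delta>"
    "map_prod f f \<Delta>\<^sub>1 \<in> net_intervals (m + i)" "\<omega> \<in> covering_words (n + i) \<Delta>\<^sub>1"
  shows "f \<circ> S_word \<omega> \<in> S_word ` covering_words (m + i) (map_prod f f \<Delta>\<^sub>1)"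
proof -
  obtain \<sigma> \<eta> where \<sigma>: "\<omega> = \<sigma> @ \<eta>" "\<sigma> \<in> covering_words n \<Delta>" "\<eta> \<in> cut (r_min ^ (n + i) / \<bar>r_word \<sigma>\<bar>)"
    "cint \<Delta>\<^sub>1 \<subseteq> S_word \<omega> ` {0..1}"
    using assms(5) covering_words_descendant[OF _ similar_netD(1)[OF assms(1)] assms(2,3)] by auto
  obtain \<sigma>' where \<sigma>': "\<sigma>' \<in> covering_words m \<Delta>'" "S_word \<sigma>' = f \<circ> S_word \<sigma>"
    "\<And>i. r_min ^ (m + i) / \<bar>r_word \<sigma>'\<bar> = r_min ^ (n + i) / \<bar>r_word \<sigma>\<bar>"
    using similar_net_word[OF assms(1) \<sigma>(2)] by blast
  have "\<sigma>' @ \<eta> \<in> \<Lambda> (m + i)"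
    using \<Lambda>_append[of m "m + i" \<sigma>' \<eta>] \<sigma>(3) \<sigma>'(1,3) covering_words_\<Lambda>[of m \<Delta>'] by auto
  moreover have eq: "S_word (\<sigma>' @ \<eta>) = f \<circ> S_word \<omega>"
    using \<sigma>(1) \<sigma>'(2) by (simp add: S_word_append_fun comp_assoc)
  moreover have "cint (map_prod f f \<Delta>\<^sub>1) = f ` cint \<Delta>\<^sub>1"
    by (simp add: similar_net_image[OF assms(1)])
  moreover have "f ` cint \<Delta>\<^sub>1 \<subseteq> f ` S_word \<omega> ` {0..1}" using \<sigma>(4) by (rule image_mono)
  ultimately have "\<sigma>' @ \<eta> \<in> covering_words (m + i) (map_prod f f \<Delta>\<^sub>1)"
    unfolding covering_words_def by (simp add: image_comp)
  then show ?thesis unfolding eq[symmetric] by (rule imageI)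
qed

text \<open>The subdivision of a net interval is determined by its covering maps.\<close>

lemma similar_net_descendant:
  assumes "similar_net n \<Delta> m \<Delta>' f" "\<Delta>\<^sub>1 \<in> net_intervals (n + i)" "cint \<Delta>\<^sub>1 \<subseteq> cint \<Delta>"
  shows "similar_net (n + i) \<Delta>\<^sub>1 (m + i) (map_prod f f \<Delta>\<^sub>1) f" (is ?sim)
    "cint (map_prod f f \<Delta>\<^sub>1) \<subseteq> cint \<Delta>'"
proof -
  note d = similar_netD[OF assms(1)] and p = net_interval_props[OF assms(2)]
  obtain g where g: "similar_net m \<Delta>' n \<Delta> g" "\<And>x. g (f x) = x" "\<And>x. f (g x) = x"
    by (rule similar_net_sym[OF assms(1)]) (rule that)
  have ord: "fst \<Delta> \<le> fst \<Delta>\<^sub>1" "snd \<Delta>\<^sub>1 \<le> snd \<Delta>" using assms(3) p(3) by auto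
  show sub: "cint (map_prod f f \<Delta>\<^sub>1) \<subseteq> cint \<Delta>'"
    using ord by (simp add: d(4-6))
  have "{f (fst \<Delta>\<^sub>1)<..<f (snd \<Delta>\<^sub>1)} \<inter> endpoints (m + i) = {}"
  proof (rule ccontr)
    assume "\<not> ?thesis"
    then obtain e where e: "f (fst \<Delta>\<^sub>1) < e" "e < f (snd \<Delta>\<^sub>1)" "e \<in> endpoints (m + i)" by auto
    have "e \<in> cint (map_prod f f \<Delta>\<^sub>1)" using e by simp
    with sub have "e \<in> cint \<Delta>'" by (rule subsetD)
    then have "g e \<in> endpoints (n + i)" using similar_net_endpoint[OF g(1) e(3)] by simp
    moreover have "fst \<Delta>\<^sub>1 < g e" "g e < snd \<Delta>\<^sub>1"
      using e(1,2) d(7)[of "fst \<Delta>\<^sub>1" "g e"] d(7)[of "g e" "snd \<Delta>\<^sub>1"] by (simp_all add: g(3))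
    ultimately show False using net_interval_no_endpoint[OF assms(2)] by force
  qed
  moreover have "f (fst \<Delta>\<^sub>1) \<in> endpoints (m + i)" "f (snd \<Delta>\<^sub>1) \<in> endpoints (m + i)"
    using similar_net_endpoint[OF assms(1) p(1)] similar_net_endpoint[OF assms(1) p(2)] ord p(3) by auto
  ultimately have net: "map_prod f f \<Delta>\<^sub>1 \<in> net_intervals (m + i)"
    using p(3) by (cases \<Delta>\<^sub>1) (simp add: net_intervals_iff d(7))
  have cov: "(\<lambda>\<sigma>. f \<circ> S_word \<sigma>) ` covering_words (n + i) \<Delta>\<^sub>1 =
    S_word ` covering_words (m + i) (map_prod f f \<Delta>\<^sub>1)"
  proof (intro equalityI subsetI)
    fix h assume "h \<in> S_word ` covering_words (m + i) (map_prod f f \<Delta>\<^sub>1)"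
    then obtain \<omega> where \<omega>: "\<omega> \<in> covering_words (m + i) (map_prod f f \<Delta>\<^sub>1)" "h = S_word \<omega>" by blast
    have inverses: "map_prod g g (map_prod f f \<Delta>\<^sub>1) = \<Delta>\<^sub>1" by (cases \<Delta>\<^sub>1) (simp add: g(2))
    have "g \<circ> S_word \<omega> \<in> S_word ` covering_words (n + i) \<Delta>\<^sub>1"
      using similar_net_covering_word[OF g(1) net sub _ \<omega>(1)] assms(2) unfolding inverses by simp
    then obtain \<tau> where \<tau>: "\<tau> \<in> covering_words (n + i) \<Delta>\<^sub>1" "S_word \<tau> = g \<circ> S_word \<omega>" by auto
    have "h = f \<circ> S_word \<tau>" unfolding \<tau>(2) \<omega>(2) by (simp add: fun_eq_iff g(3))
    then show "h \<in> (\<lambda>\<sigma>. f \<circ> S_word \<sigma>) ` covering_words (n + i) \<Delta>\<^sub>1" using \<tau>(1) by (rule image_eqI)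
  qed (use similar_net_covering_word[OF assms net] in auto)
  obtain c where f: "f = (\<lambda>x. r_min ^ m / r_min ^ n * x + c)"
    using assms(1) by (auto simp: similar_net_def)
  then have "f = (\<lambda>x. r_min ^ (m + i) / r_min ^ (n + i) * x + c)" by (simp add: power_add)
  then show ?sim unfolding similar_net_def using assms(2) net cov by blast
qed

lemma set_neighbour_set:
  "set (neighbour_set n \<Delta>) =
    (\<lambda>\<sigma>. ((fst \<Delta> - S_word \<sigma> 0) / r_min ^ n, r_word \<sigma> / r_min ^ n)) ` covering_words n \<Delta>"
  unfolding neighbour_set_def by (intro set_lex_list finite_imageI finite_covering_words)

lemma similar_net_pair_iff:
  assumes f: "f = (\<lambda>x. r_min ^ m / r_min ^ n * x + c)" and a: "f a = a'"
  shows "S_word \<sigma>' = f \<circ> S_word \<sigma> \<longleftrightarrow>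
    ((a' - S_word \<sigma>' 0) / r_min ^ m, r_word \<sigma>' / r_min ^ m) = ((a - S_word \<sigma> 0) / r_min ^ n, r_word \<sigma> / r_min ^ n)"
    (is "?L \<longleftrightarrow> ?R")
proof -
  have diff: "f x - f y = r_min ^ m / r_min ^ n * (x - y)" for x y unfolding f by (simp add: algebra_simps diff_divide_distrib)
  have affine: "f (S_word \<sigma> x) = r_min ^ m / r_min ^ n * (r_word \<sigma> * x) + f (S_word \<sigma> 0)" for x
    unfolding f S_word_affine[of \<sigma> x] by (simp add: algebra_simps add_divide_distrib)
  have "?L \<longleftrightarrow> S_word \<sigma>' 0 = f (S_word \<sigma> 0) \<and> r_word \<sigma>' = r_min ^ m / r_min ^ n * r_word \<sigma>"
  proof
    assume L: ?L
    then have 0: "S_word \<sigma>' 0 = f (S_word \<sigma> 0)" by simp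
    have "S_word \<sigma>' 1 = f (S_word \<sigma> 1)" using L by simp
    then have "r_word \<sigma>' = r_min ^ m / r_min ^ n * r_word \<sigma>"
      unfolding affine[of 1] using S_word_1[of \<sigma>'] 0 by simp
    with 0 show "S_word \<sigma>' 0 = f (S_word \<sigma> 0) \<and> r_word \<sigma>' = r_min ^ m / r_min ^ n * r_word \<sigma>" by simp
  next
    assume R: "S_word \<sigma>' 0 = f (S_word \<sigma> 0) \<and> r_word \<sigma>' = r_min ^ m / r_min ^ n * r_word \<sigma>"
    show ?L
    proof
      fix x
      show "S_word \<sigma>' x = (f \<circ> S_word \<sigma>) x"
        using R affine[of x] S_word_affine[of \<sigma>' x] by simp
    qed
  qed
  also have "S_word \<sigma>' 0 = f (S_word \<sigma> 0) \<longleftrightarrow> a' - S_word \<sigma>' 0 = f a - f (S_word \<sigma> 0)"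
    using a by auto
  also have "\<dots> \<longleftrightarrow> a' - S_word \<sigma>' 0 = r_min ^ m / r_min ^ n * (a - S_word \<sigma> 0)" unfolding diff ..
  finally show ?thesis by (auto simp: field_simps)
qed

lemma similar_net_char:
  assumes "similar_net n \<Delta> m \<Delta>' f"
  shows "norm_length n \<Delta> = norm_length m \<Delta>'" "neighbour_set n \<Delta> = neighbour_set m \<Delta>'"
proof -
  note d = similar_netD[OF assms]
  obtain c where f: "f = (\<lambda>x. r_min ^ m / r_min ^ n * x + c)"
    using assms by (auto simp: similar_net_def)
  show "norm_length n \<Delta> = norm_length m \<Delta>'"
    unfolding norm_length_def d(4,5) d(8) by simp
  let ?p = "\<lambda>n \<Delta> \<sigma>. ((fst \<Delta> - S_word \<sigma> 0) / r_min ^ n, r_word \<sigma> / r_min ^ n)"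
  note iff = similar_net_pair_iff[OF f d(4)[symmetric]]
  have "?p n \<Delta> ` covering_words n \<Delta> = ?p m \<Delta>' ` covering_words m \<Delta>'"
  proof (intro equalityI subsetI)
    fix z assume "z \<in> ?p n \<Delta> ` covering_words n \<Delta>"
    then obtain \<sigma> where \<sigma>: "\<sigma> \<in> covering_words n \<Delta>" "z = ?p n \<Delta> \<sigma>" by blast
    obtain \<sigma>' where \<sigma>': "\<sigma>' \<in> covering_words m \<Delta>'" "S_word \<sigma>' = f \<circ> S_word \<sigma>"
      using similar_net_word[OF assms \<sigma>(1)] by blast
    have "z = ?p m \<Delta>' \<sigma>'" unfolding \<sigma>(2) by (rule iff[THEN iffD1, OF \<sigma>'(2), symmetric])
    then show "z \<in> ?p m \<Delta>' ` covering_words m \<Delta>'" using \<sigma>'(1) by (rule image_eqI)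
  next
    fix z assume "z \<in> ?p m \<Delta>' ` covering_words m \<Delta>'"
    then obtain \<sigma>' where \<sigma>': "\<sigma>' \<in> covering_words m \<Delta>'" "z = ?p m \<Delta>' \<sigma>'" by blast
    have "S_word \<sigma>' \<in> (\<lambda>\<sigma>. f \<circ> S_word \<sigma>) ` covering_words n \<Delta>"
      using assms \<sigma>'(1) by (simp add: similar_net_def)
    then obtain \<sigma> where \<sigma>: "\<sigma> \<in> covering_words n \<Delta>" "S_word \<sigma>' = f \<circ> S_word \<sigma>" by blast
    have "z = ?p n \<Delta> \<sigma>" unfolding \<sigma>'(2) by (rule iff[THEN iffD1, OF \<sigma>(2)])
    then show "z \<in> ?p n \<Delta> ` covering_words n \<Delta>" using \<sigma>(1) by (rule image_eqI)
  qed
  then show "neighbour_set n \<Delta> = neighbour_set m \<Delta>'" unfolding neighbour_set_def by (rule arg_cong)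
qed

lemma similar_netI:
  assumes "\<Delta> \<in> net_intervals n" "\<Delta>' \<in> net_intervals m"
    "norm_length n \<Delta> = norm_length m \<Delta>'" "neighbour_set n \<Delta> = neighbour_set m \<Delta>'"
  obtains f where "similar_net n \<Delta> m \<Delta>' f"
proof -
  define c where "c = fst \<Delta>' - r_min ^ m / r_min ^ n * fst \<Delta>"
  define f where f: "f = (\<lambda>x. r_min ^ m / r_min ^ n * x + c)"
  have a: "f (fst \<Delta>) = fst \<Delta>'" by (simp add: f c_def)
  have "snd \<Delta>' - fst \<Delta>' = r_min ^ m / r_min ^ n * (snd \<Delta> - fst \<Delta>)"
    using assms(3) by (simp add: norm_length_def field_simps)
  then have b: "f (snd \<Delta>) = snd \<Delta>'" by (simp add: f c_def algebra_simps diff_divide_distrib)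
  let ?p = "\<lambda>n \<Delta> \<sigma>. ((fst \<Delta> - S_word \<sigma> 0) / r_min ^ n, r_word \<sigma> / r_min ^ n)"
  note iff = similar_net_pair_iff[OF f a]
  have eq: "?p n \<Delta> ` covering_words n \<Delta> = ?p m \<Delta>' ` covering_words m \<Delta>'"
    using assms(4) unfolding set_neighbour_set[symmetric] by (rule arg_cong)
  have "(\<lambda>\<sigma>. f \<circ> S_word \<sigma>) ` covering_words n \<Delta> = S_word ` covering_words m \<Delta>'"
  proof (intro equalityI subsetI)
    fix h assume "h \<in> (\<lambda>\<sigma>. f \<circ> S_word \<sigma>) ` covering_words n \<Delta>"
    then obtain \<sigma> where \<sigma>: "\<sigma> \<in> covering_words n \<Delta>" "h = f \<circ> S_word \<sigma>" by blast
    then have "?p n \<Delta> \<sigma> \<in> ?p m \<Delta>' ` covering_words m \<Delta>'" unfolding eq[symmetric] by (intro imageI)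
    then obtain \<sigma>' where \<sigma>': "\<sigma>' \<in> covering_words m \<Delta>'" "?p n \<Delta> \<sigma> = ?p m \<Delta>' \<sigma>'" by blast
    have "h = S_word \<sigma>'" unfolding \<sigma>(2) by (rule iff[THEN iffD2, OF \<sigma>'(2)[symmetric], symmetric])
    then show "h \<in> S_word ` covering_words m \<Delta>'" using \<sigma>'(1) by (rule image_eqI)
  next
    fix h assume "h \<in> S_word ` covering_words m \<Delta>'"
    then obtain \<sigma>' where \<sigma>': "\<sigma>' \<in> covering_words m \<Delta>'" "h = S_word \<sigma>'" by blast
    then have "?p m \<Delta>' \<sigma>' \<in> ?p n \<Delta> ` covering_words n \<Delta>" unfolding eq by (intro imageI)
    then obtain \<sigma> where \<sigma>: "\<sigma> \<in> covering_words n \<Delta>" "?p m \<Delta>' \<sigma>' = ?p n \<Delta> \<sigma>" by blast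
    have "h = f \<circ> S_word \<sigma>" unfolding \<sigma>'(2) by (rule iff[THEN iffD2, OF \<sigma>(2)])
    then show "h \<in> (\<lambda>\<sigma>. f \<circ> S_word \<sigma>) ` covering_words n \<Delta>" using \<sigma>(1) by (rule image_eqI)
  qed
  moreover have "\<Delta>' = map_prod f f \<Delta>" using a b by (simp add: prod_eq_iff)
  ultimately have "similar_net n \<Delta> m \<Delta>' f"
    unfolding similar_net_def using assms(1,2) f by blast
  then show ?thesis by (rule that)
qed

definition like_siblings :: "nat \<Rightarrow> real \<times> real \<Rightarrow> (real \<times> real) set"
  where "like_siblings n \<Delta> = {\<Delta>' \<in> net_intervals n. parent n \<Delta>' = parent n \<Delta> \<and>
      norm_length n \<Delta>' = norm_length n \<Delta> \<and> neighbour_set n \<Delta>' = neighbour_set n \<Delta> \<and>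
      fst \<Delta>' \<le> fst \<Delta>}"

lemma similar_net_like_siblings:
  assumes "similar_net n \<Delta> m \<Delta>' f" "\<Delta>\<^sub>1 \<in> net_intervals (Suc n)" "cint \<Delta>\<^sub>1 \<subseteq> cint \<Delta>"
  shows "map_prod f f ` like_siblings (Suc n) \<Delta>\<^sub>1 \<subseteq> like_siblings (Suc m) (map_prod f f \<Delta>\<^sub>1)"
proof
  note d = similar_netD[OF assms(1)]
  have desc: "similar_net (Suc n) D (Suc m) (map_prod f f D) f" "cint (map_prod f f D) \<subseteq> cint \<Delta>'"
    if "D \<in> net_intervals (Suc n)" "cint D \<subseteq> cint \<Delta>" for D
    using similar_net_descendant[OF assms(1), of D 1] that by simp_all
  have par: "parent (Suc m) (map_prod f f D) = \<Delta>'"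
    if "D \<in> net_intervals (Suc n)" "cint D \<subseteq> cint \<Delta>" for D
    using parent_eq_iff[OF similar_netD(2)[OF desc(1)[OF that]]] desc(2)[OF that] d(2) by simp
  have p1: "parent (Suc n) \<Delta>\<^sub>1 = \<Delta>" using parent_eq_iff[OF assms(2)] assms(3) d(1) by simp
  fix z assume "z \<in> map_prod f f ` like_siblings (Suc n) \<Delta>\<^sub>1"
  then obtain D where z: "z = map_prod f f D" and "D \<in> like_siblings (Suc n) \<Delta>\<^sub>1" by (rule imageE)
  then have D: "D \<in> net_intervals (Suc n)" "parent (Suc n) D = \<Delta>"
    and eq: "norm_length (Suc n) D = norm_length (Suc n) \<Delta>\<^sub>1"
      "neighbour_set (Suc n) D = neighbour_set (Suc n) \<Delta>\<^sub>1" and le: "fst D \<le> fst \<Delta>\<^sub>1"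
    by (simp_all add: like_siblings_def p1)
  have sub: "cint D \<subseteq> cint \<Delta>" using parent_net_interval(2)[OF D(1)] unfolding D(2) .
  note dD = desc[OF D(1) sub] and d1 = desc[OF assms(2,3)]
  show "z \<in> like_siblings (Suc m) (map_prod f f \<Delta>\<^sub>1)"
    unfolding like_siblings_def z mem_Collect_eq par[OF D(1) sub] par[OF assms(2,3)]
    using similar_netD(2)[OF dD(1)] similar_net_char[OF dD(1)] similar_net_char[OF d1(1)] eq le d(6)
    by simp
qed

lemma similar_net_sibling_index:
  assumes "similar_net n \<Delta> m \<Delta>' f" "\<Delta>\<^sub>1 \<in> net_intervals (Suc n)" "cint \<Delta>\<^sub>1 \<subseteq> cint \<Delta>"
  shows "sibling_index (Suc n) \<Delta>\<^sub>1 = sibling_index (Suc m) (map_prod f f \<Delta>\<^sub>1)"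
proof -
  obtain g where g: "similar_net m \<Delta>' n \<Delta> g" "\<And>x. g (f x) = x" "\<And>x. f (g x) = x"
    by (rule similar_net_sym[OF assms(1)]) (rule that)
  have inverses: "map_prod g g (map_prod f f D) = D" "map_prod f f (map_prod g g D) = D" for D
    by (cases D; simp add: g(2,3))+
  have 1: "similar_net (Suc n) \<Delta>\<^sub>1 (Suc m) (map_prod f f \<Delta>\<^sub>1) f" "cint (map_prod f f \<Delta>\<^sub>1) \<subseteq> cint \<Delta>'"
    using similar_net_descendant[OF assms(1), of \<Delta>\<^sub>1 1] assms(2,3) by simp_all
  have "map_prod g g ` like_siblings (Suc m) (map_prod f f \<Delta>\<^sub>1) \<subseteq> like_siblings (Suc n) \<Delta>\<^sub>1"
    using similar_net_like_siblings[OF g(1) similar_netD(2)[OF 1(1)] 1(2)] unfolding inverses .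
  then have "map_prod f f ` map_prod g g ` like_siblings (Suc m) (map_prod f f \<Delta>\<^sub>1)
      \<subseteq> map_prod f f ` like_siblings (Suc n) \<Delta>\<^sub>1" by (rule image_mono)
  then have "like_siblings (Suc m) (map_prod f f \<Delta>\<^sub>1) \<subseteq> map_prod f f ` like_siblings (Suc n) \<Delta>\<^sub>1"
    by (simp add: image_image inverses)
  with similar_net_like_siblings[OF assms]
  have eq: "like_siblings (Suc m) (map_prod f f \<Delta>\<^sub>1) = map_prod f f ` like_siblings (Suc n) \<Delta>\<^sub>1" by simp
  have "inj (map_prod f f)" using inverses(1) by (rule inj_on_inverseI)
  then have "card (map_prod f f ` like_siblings (Suc n) \<Delta>\<^sub>1) = card (like_siblings (Suc n) \<Delta>\<^sub>1)"
    by (rule card_image[OF inj_on_subset[OF _ subset_UNIV]])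
  then show ?thesis unfolding sibling_index_def like_siblings_def[symmetric] eq by simp
qed

text \<open>The index among like siblings is visible only to the parent, so equality of the full characteristic
vectors requires a proper descendant.\<close>

lemma similar_net_char_vec:
  assumes "similar_net n \<Delta> m \<Delta>' f" "\<Delta>\<^sub>1 \<in> net_intervals (n + Suc i)" "cint \<Delta>\<^sub>1 \<subseteq> cint \<Delta>"
  shows "char_vec (n + Suc i) \<Delta>\<^sub>1 = char_vec (m + Suc i) (map_prod f f \<Delta>\<^sub>1)"
proof -
  have \<Delta>1: "\<Delta>\<^sub>1 \<in> net_intervals (Suc (n + i))" using assms(2) by simp
  let ?D = "parent (Suc (n + i)) \<Delta>\<^sub>1"
  note D = parent_net_interval[OF \<Delta>1]
  have "cint ?D \<subseteq> cint \<Delta>"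
    using descendant_through[OF similar_netD(1)[OF assms(1)] D(1) _ assms(3) D(2)
        net_interval_props(3)[OF assms(2)]] by simp
  then have "similar_net (n + i) ?D (m + i) (map_prod f f ?D) f"
    using similar_net_descendant[OF assms(1) D(1)] by simp
  from similar_net_sibling_index[OF this \<Delta>1 D(2)]
  have "sibling_index (n + Suc i) \<Delta>\<^sub>1 = sibling_index (m + Suc i) (map_prod f f \<Delta>\<^sub>1)" by simp
  then show ?thesis
    unfolding char_vec_def using similar_net_char[OF similar_net_descendant(1)[OF assms]] by simp
qed

end

section \<open>Copies of a maximal net interval and the essential class\<close>

text \<open>Such a net interval exists because the numbers of covering maps are bounded (\<open>covering_maps_bounded\<close>). Maps are
counted, not words: different words with the same map count once.\<close>

locale maximal_net_interval = finite_type_interval_ifs +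
  fixes m :: nat and Ds :: "real \<times> real"
  assumes Ds_net: "Ds \<in> net_intervals m"
    and Ds_maximal: "\<And>n \<Delta>. \<Delta> \<in> net_intervals n \<Longrightarrow>
      card (S_word ` covering_words n \<Delta>) \<le> card (S_word ` covering_words m Ds)"
begin

text \<open>The image of \<open>Ds\<close>. It is a net interval when \<open>\<tau>\<close> is exact (\<open>copy_net_interval\<close>).\<close>

definition copy :: "nat list \<Rightarrow> real \<times> real"
  where "copy \<tau> = map_prod (S_word \<tau>) (S_word \<tau>) Ds"

lemma copy_append: "copy (\<sigma> @ \<tau>) = map_prod (S_word \<sigma>) (S_word \<sigma>) (copy \<tau>)"
  by (simp add: copy_def prod_eq_iff)

lemma copy_Nil: "copy [] = Ds"
  by (simp add: copy_def prod_eq_iff)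

lemma exact_less: "exact \<tau> l \<Longrightarrow> S_word \<tau> x < S_word \<tau> y \<longleftrightarrow> x < y"
  and exact_le: "exact \<tau> l \<Longrightarrow> S_word \<tau> x \<le> S_word \<tau> y \<longleftrightarrow> x \<le> y"
  using S_word_affine[of \<tau> x] S_word_affine[of \<tau> y] by (simp_all add: exact_def r_min_bounds)

lemma exact_image:
  assumes "exact \<tau> l"
  shows "S_word \<tau> ` {a..b} = {S_word \<tau> a..S_word \<tau> b}"
proof -
  have "S_word \<tau> = (\<lambda>x. r_word \<tau> * x + S_word \<tau> 0)" using S_word_affine by blast
  then have "S_word \<tau> ` {a..b} = (\<lambda>x. r_word \<tau> * x + S_word \<tau> 0) ` {a..b}" by (rule arg_cong)
  also have "\<dots> = {r_word \<tau> * a + S_word \<tau> 0..r_word \<tau> * b + S_word \<tau> 0}"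
    using assms by (subst image_affinity_atLeastAtMost) (auto simp: exact_def r_min_bounds)
  finally show ?thesis using S_word_affine[of \<tau> a] S_word_affine[of \<tau> b] by simp
qed

lemma cint_copy_append: "exact \<sigma> l \<Longrightarrow> cint (copy (\<sigma> @ \<tau>)) = S_word \<sigma> ` cint (copy \<tau>)"
  by (simp add: copy_append exact_image)

lemma cint_copy: "exact \<sigma> l \<Longrightarrow> cint (copy \<sigma>) = S_word \<sigma> ` cint Ds"
  by (simp add: copy_def exact_image)

lemma copy_subset_image:
  assumes "exact \<tau> l"
  shows "cint (copy \<tau>) \<subseteq> S_word \<tau> ` {0..1}"
  unfolding cint_copy[OF assms] using net_interval_props[OF Ds_net] by (intro image_mono) auto

text \<open>All maps \<open>S_word \<tau> \<circ> S_word \<sigma>\<close> with \<open>\<sigma>\<close> covering \<open>Ds\<close> cover \<open>\<Delta>\<close>. Their number is already the maximal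
possible one.\<close>

lemma covering_maps_in_copy:
  assumes "exact \<tau> l" "\<Delta> \<in> net_intervals (l + m)" "cint \<Delta> \<subseteq> cint (copy \<tau>)"
  shows "(\<lambda>\<sigma>. S_word \<tau> \<circ> S_word \<sigma>) ` covering_words m Ds = S_word ` covering_words (l + m) \<Delta>"
    (is "?A = ?B")
proof (rule card_seteq)
  show "finite ?B" using finite_covering_words by simp
  show "?A \<subseteq> ?B"
  proof
    fix h assume "h \<in> ?A"
    then obtain \<sigma> where \<sigma>: "\<sigma> \<in> covering_words m Ds" "h = S_word \<tau> \<circ> S_word \<sigma>" by blast
    have "cint Ds \<subseteq> S_word \<sigma> ` {0..1}" "\<sigma> \<in> \<Lambda> m" using \<sigma>(1) by (auto simp: covering_words_def)
    have "cint \<Delta> \<subseteq> S_word \<tau> ` cint Ds" using assms(3) unfolding cint_copy[OF assms(1)] .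
    also have "\<dots> \<subseteq> S_word \<tau> ` S_word \<sigma> ` {0..1}"
      using \<open>cint Ds \<subseteq> S_word \<sigma> ` {0..1}\<close> by (rule image_mono)
    also have "\<dots> = S_word (\<tau> @ \<sigma>) ` {0..1}" by (simp add: image_image)
    finally have "\<tau> @ \<sigma> \<in> covering_words (l + m) \<Delta>"
      using \<open>\<sigma> \<in> \<Lambda> m\<close> exact_\<Lambda>[OF assms(1)] by (simp add: covering_words_def)
    then show "h \<in> ?B" unfolding \<sigma>(2) S_word_append_fun[symmetric] by (rule imageI)
  qed
  have "inj (\<lambda>h :: real \<Rightarrow> real. S_word \<tau> \<circ> h)"
  proof (rule injI)
    fix g h :: "real \<Rightarrow> real"
    assume "S_word \<tau> \<circ> g = S_word \<tau> \<circ> h"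
    then have "S_word \<tau> (g x) = S_word \<tau> (h x)" for x by (simp add: fun_eq_iff)
    then have "g x = h x" for x
      using exact_le[OF assms(1), of "g x" "h x"] exact_le[OF assms(1), of "h x" "g x"] by (intro antisym) simp_all
    then show "g = h" by (rule ext)
  qed
  then have "card ((\<lambda>h. S_word \<tau> \<circ> h) ` (S_word ` covering_words m Ds)) = card (S_word ` covering_words m Ds)"
    by (rule card_image[OF inj_on_subset[OF _ subset_UNIV]])
  then have "card ?A = card (S_word ` covering_words m Ds)" by (simp add: image_image)
  then show "card ?B \<le> card ?A" using Ds_maximal[OF assms(2)] by simp
qed

text \<open>Suppose an endpoint of some word \<open>\<omega>\<close> fell into the interior of the copy. Then \<open>\<omega>\<close> would cover a net interval
inside the copy, so by maximality \<open>S_word \<omega>\<close> would be one of the maps that cover the whole copy, and its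
endpoints could not be interior.\<close>

lemma copy_net_interval:
  assumes "exact \<tau> l"
  shows "copy \<tau> \<in> net_intervals (l + m)"
proof -
  note p = net_interval_props[OF Ds_net]
  have ends: "S_word \<tau> e \<in> endpoints (l + m)" if e_m: "e \<in> endpoints m" for e
  proof -
    obtain \<sigma> u where "\<sigma> \<in> \<Lambda> m" "u \<in> {0, 1}" "e = S_word \<sigma> u"
      using e_m unfolding endpoints_def by blast
    then show ?thesis using exact_\<Lambda>[OF assms] unfolding endpoints_def
      by (intro UN_I[of "\<tau> @ \<sigma>"]) auto
  qed
  have ab: "fst (copy \<tau>) < snd (copy \<tau>)" "fst (copy \<tau>) \<in> endpoints (l + m)" "snd (copy \<tau>) \<in> endpoints (l + m)"
    using p ends exact_less[OF assms] by (simp_all add: copy_def)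
  have "\<not> (fst (copy \<tau>) < e \<and> e < snd (copy \<tau>))" if e: "e \<in> endpoints (l + m)" for e
  proof
    assume in_e: "fst (copy \<tau>) < e \<and> e < snd (copy \<tau>)"
    obtain \<omega> where \<omega>: "\<omega> \<in> \<Lambda> (l + m)" "e = lo \<omega> \<or> e = hi \<omega>" using e by (auto simp: endpoints_eq)
    have lh: "lo \<omega> < hi \<omega>" using \<omega>(1) \<Lambda>_words lo_less_hi by blast
    have lhe: "lo \<omega> \<in> endpoints (l + m)" "hi \<omega> \<in> endpoints (l + m)"
      using lo_endpoint[OF \<omega>(1)] hi_endpoint[OF \<omega>(1)] .
    obtain \<Delta> where \<Delta>: "\<Delta> \<in> net_intervals (l + m)" "fst (copy \<tau>) \<le> fst \<Delta>" "snd \<Delta> \<le> snd (copy \<tau>)"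
      "lo \<omega> \<le> fst \<Delta>" "snd \<Delta> \<le> hi \<omega>"
    proof (cases "e = lo \<omega>")
      case True
      have "min (hi \<omega>) (snd (copy \<tau>)) \<in> endpoints (l + m)" using lhe ab by (simp add: min_def)
      then obtain b where "(e, b) \<in> net_intervals (l + m)" "b \<le> min (hi \<omega>) (snd (copy \<tau>))"
        using net_interval_right[OF e] True lh in_e by (metis min_less_iff_conj)
      then show ?thesis using that[of "(e, b)"] True in_e by simp
    next
      case False
      then have "e = hi \<omega>" using \<omega>(2) by simp
      have "max (lo \<omega>) (fst (copy \<tau>)) \<in> endpoints (l + m)" using lhe ab by (simp add: max_def)
      then obtain a where "(a, e) \<in> net_intervals (l + m)" "max (lo \<omega>) (fst (copy \<tau>)) \<le> a"
        using net_interval_left[OF _ e] \<open>e = hi \<omega>\<close> lh in_e by (metis max_less_iff_conj)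
      then show ?thesis using that[of "(a, e)"] \<open>e = hi \<omega>\<close> in_e by simp
    qed
    have "\<omega> \<in> covering_words (l + m) \<Delta>" using \<Delta> \<omega>(1) by (simp add: covering_words_iff)
    then have "S_word \<omega> \<in> (\<lambda>\<sigma>. S_word \<tau> \<circ> S_word \<sigma>) ` covering_words m Ds"
      using covering_maps_in_copy[OF assms \<Delta>(1)] \<Delta>(2,3) by simp
    then obtain \<sigma> where \<sigma>: "\<sigma> \<in> covering_words m Ds" "S_word \<omega> = S_word \<tau> \<circ> S_word \<sigma>" by blast
    have "cint (copy \<tau>) \<subseteq> S_word \<tau> ` S_word \<sigma> ` {0..1}"
      unfolding cint_copy[OF assms] using \<sigma>(1) by (intro image_mono) (simp add: covering_words_def)
    also have "\<dots> = {lo \<omega>..hi \<omega>}" unfolding S_word_image[symmetric] \<sigma>(2) by (simp add: image_image)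
    finally show False using ab(1) in_e \<omega>(2) by auto
  qed
  then have "{fst (copy \<tau>)<..<snd (copy \<tau>)} \<inter> endpoints (l + m) = {}" by auto
  then show ?thesis using ab net_intervals_iff[of "fst (copy \<tau>)" "snd (copy \<tau>)" "l + m"] by simp
qed

lemma copy_similar:
  assumes "exact \<tau> l"
  shows "similar_net m Ds (l + m) (copy \<tau>) (S_word \<tau>)"
proof -
  have "S_word \<tau> = (\<lambda>x. r_min ^ (l + m) / r_min ^ m * x + S_word \<tau> 0)"
  proof
    show "S_word \<tau> x = r_min ^ (l + m) / r_min ^ m * x + S_word \<tau> 0" for x
      using S_word_affine[of \<tau> x] assms by (simp add: exact_def power_add)
  qed
  then have "\<exists>c. S_word \<tau> = (\<lambda>x. r_min ^ (l + m) / r_min ^ m * x + c)" by blast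
  then show ?thesis
    unfolding similar_net_def using Ds_net copy_net_interval[OF assms] copy_def[of \<tau>]
      covering_maps_in_copy[OF assms copy_net_interval[OF assms] order_refl] by blast
qed

lemma copy_inside:
  assumes "\<Delta> \<in> net_intervals n"
  obtains \<tau> l where "exact \<tau> l" "n \<le> l" "S_word \<tau> ` {0..1} \<subseteq> cint \<Delta>"
proof -
  obtain C where C: "\<And>n \<Delta> \<sigma>. \<Delta> \<in> net_intervals n \<Longrightarrow> \<sigma> \<in> covering_words n \<Delta> \<Longrightarrow>
    \<exists>\<eta>\<in>words. \<exists>l. exact (\<sigma> @ \<eta>) l \<and> n \<le> l \<and> l \<le> n + C \<and> S_word (\<sigma> @ \<eta>) ` {0..1} \<subseteq> cint \<Delta>"
    by (rule exact_descent) (rule that)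
  obtain \<sigma> where "\<sigma> \<in> covering_words n \<Delta>" using covering_words_nonempty[OF assms] .
  then obtain \<eta> l where "exact (\<sigma> @ \<eta>) l" "n \<le> l" "S_word (\<sigma> @ \<eta>) ` {0..1} \<subseteq> cint \<Delta>"
    using C[OF assms] by blast
  then show ?thesis by (rule that)
qed

definition descendant_vectors :: "nat \<Rightarrow> real \<times> real \<Rightarrow> char_vector set"
  where "descendant_vectors n \<Delta> =
    {\<gamma>. \<exists>n' D. n \<le> n' \<and> D \<in> net_intervals n' \<and> cint D \<subseteq> cint \<Delta> \<and> \<gamma> = char_vec n' D}"

lemma descendant_vectorsI:
  "n \<le> n' \<Longrightarrow> D \<in> net_intervals n' \<Longrightarrow> cint D \<subseteq> cint \<Delta> \<Longrightarrow> char_vec n' D \<in> descendant_vectors n \<Delta>"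
  unfolding descendant_vectors_def by blast

lemma descendant_vectorsE:
  assumes "\<gamma> \<in> descendant_vectors n \<Delta>"
  obtains n' D where "n \<le> n'" "D \<in> net_intervals n'" "cint D \<subseteq> cint \<Delta>" "\<gamma> = char_vec n' D"
  using assms unfolding descendant_vectors_def by blast

lemma descendant_vectors_\<Omega>: "descendant_vectors n \<Delta> \<subseteq> \<Omega>"
  unfolding descendant_vectors_def \<Omega>_def by blast

lemma descendant_path:
  assumes "\<Delta> \<in> net_intervals n" "\<Delta>' \<in> net_intervals (n + i)" "cint \<Delta>' \<subseteq> cint \<Delta>"
  shows "\<exists>\<gamma>s. admissible_path \<gamma>s \<and> hd \<gamma>s = char_vec n \<Delta> \<and> last \<gamma>s = char_vec (n + i) \<Delta>' \<and>
    set \<gamma>s \<subseteq> descendant_vectors n \<Delta>"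
  using assms(2,3)
proof (induction i arbitrary: \<Delta>')
  case 0
  then have "\<Delta>' = \<Delta>" using ancestor_unique[OF _ assms(1) order_refl, of \<Delta>'] net_interval_props(3) by simp
  moreover have in_dv: "char_vec n \<Delta> \<in> descendant_vectors n \<Delta>"
    using assms(1) by (intro descendant_vectorsI) simp_all
  then have "admissible_path [char_vec n \<Delta>]"
    using subsetD[OF descendant_vectors_\<Omega> in_dv] by (simp add: admissible_path_def)
  ultimately show ?case using in_dv by (intro exI[of _ "[char_vec n \<Delta>]"]) simp
next
  case (Suc i)
  have \<Delta>': "\<Delta>' \<in> net_intervals (Suc (n + i))" using Suc.prems by simp
  let ?D = "parent (Suc (n + i)) \<Delta>'"
  note D = parent_net_interval[OF \<Delta>']
  have sub: "cint ?D \<subseteq> cint \<Delta>"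
    by (rule descendant_through[OF assms(1) D(1) _ Suc.prems(2) D(2) net_interval_props(3)[OF \<Delta>']]) simp
  obtain \<gamma>s where \<gamma>s: "admissible_path \<gamma>s" "hd \<gamma>s = char_vec n \<Delta>" "last \<gamma>s = char_vec (n + i) ?D"
    "set \<gamma>s \<subseteq> descendant_vectors n \<Delta>"
    using Suc.IH[OF D(1) sub] by blast
  let ?\<beta> = "char_vec (n + Suc i) \<Delta>'"
  have "is_child ?\<beta> (last \<gamma>s)" unfolding is_child_def \<gamma>s(3) using \<Delta>'
    by (intro exI[of _ "n + i"] exI[of _ \<Delta>']) simp
  moreover have dv: "?\<beta> \<in> descendant_vectors n \<Delta>"
    using Suc.prems by (intro descendant_vectorsI) simp_all
  moreover have "?\<beta> \<in> \<Omega>" using dv descendant_vectors_\<Omega> by blast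
  ultimately have "admissible_path (\<gamma>s @ [?\<beta>])"
    using \<gamma>s(1) by (simp add: admissible_path_def successively_append_iff)
  moreover have "hd (\<gamma>s @ [?\<beta>]) = char_vec n \<Delta>" using \<gamma>s(1,2) by (simp add: admissible_path_def)
  ultimately show ?case using \<gamma>s(4) dv by (intro exI[of _ "\<gamma>s @ [?\<beta>]"]) simp
qed

text \<open>This set turns out to be the essential class (\<open>essential_class_eq\<close>). The net interval \<open>Ds\<close> itself is left out because
its sibling index need not recur.\<close>

definition core :: "char_vector set"
  where "core = descendant_vectors (Suc m) Ds"

lemma coreI: "m < n \<Longrightarrow> \<Delta> \<in> net_intervals n \<Longrightarrow> cint \<Delta> \<subseteq> cint Ds \<Longrightarrow> char_vec n \<Delta> \<in> core"
  unfolding core_def by (intro descendant_vectorsI) simp_all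

lemma coreE:
  assumes "\<gamma> \<in> core"
  obtains n \<Delta> where "m < n" "\<Delta> \<in> net_intervals n" "cint \<Delta> \<subseteq> cint Ds" "\<gamma> = char_vec n \<Delta>"
  using assms unfolding core_def by (rule descendant_vectorsE) (rule that, simp_all)

lemma copy_char_vec:
  assumes "exact \<tau> l" "m < n" "\<Delta> \<in> net_intervals n" "cint \<Delta> \<subseteq> cint Ds"
  shows "map_prod (S_word \<tau>) (S_word \<tau>) \<Delta> \<in> net_intervals (l + n)"
    "cint (map_prod (S_word \<tau>) (S_word \<tau>) \<Delta>) \<subseteq> cint (copy \<tau>)"
    "char_vec (l + n) (map_prod (S_word \<tau>) (S_word \<tau>) \<Delta>) = char_vec n \<Delta>"
proof -
  obtain i where i: "n = m + Suc i" using assms(2) by (metis less_imp_Suc_add add_Suc_right)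
  then have \<Delta>: "\<Delta> \<in> net_intervals (m + Suc i)" using assms(3) by simp
  note d = similar_net_descendant[OF copy_similar[OF assms(1)] \<Delta> assms(4)]
  show "map_prod (S_word \<tau>) (S_word \<tau>) \<Delta> \<in> net_intervals (l + n)"
    using similar_netD(2)[OF d(1)] i by (simp add: add.assoc)
  show "cint (map_prod (S_word \<tau>) (S_word \<tau>) \<Delta>) \<subseteq> cint (copy \<tau>)" by (rule d(2))
  show "char_vec (l + n) (map_prod (S_word \<tau>) (S_word \<tau>) \<Delta>) = char_vec n \<Delta>"
    using similar_net_char_vec[OF copy_similar[OF assms(1)] \<Delta> assms(4)] i by (simp add: add.assoc)
qed

text \<open>Below every net interval lies a copy of \<open>Ds\<close>, whose descendants have the characteristic vectors of the
corresponding descendants of \<open>Ds\<close>.\<close>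

lemma path_into_core:
  assumes "\<Delta> \<in> net_intervals n" "\<beta> \<in> core"
  shows "\<exists>\<gamma>s. admissible_path \<gamma>s \<and> hd \<gamma>s = char_vec n \<Delta> \<and> last \<gamma>s = \<beta> \<and>
    set \<gamma>s \<subseteq> descendant_vectors n \<Delta>"
proof -
  obtain \<tau> l where \<tau>: "exact \<tau> l" "n \<le> l" "S_word \<tau> ` {0..1} \<subseteq> cint \<Delta>"
    by (rule copy_inside[OF assms(1)]) (rule that)
  obtain n2 D2 where D2: "m < n2" "D2 \<in> net_intervals n2" "cint D2 \<subseteq> cint Ds" "\<beta> = char_vec n2 D2"
    using coreE[OF assms(2)] .
  let ?D = "map_prod (S_word \<tau>) (S_word \<tau>) D2"
  note c = copy_char_vec[OF \<tau>(1) D2(1-3)]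
  have "cint ?D \<subseteq> cint \<Delta>" using c(2) copy_subset_image[OF \<tau>(1)] \<tau>(3) by (blast intro: subset_trans)
  moreover have "?D \<in> net_intervals (n + (l + n2 - n))" using c(1) \<tau>(2) by simp
  ultimately show ?thesis
    using descendant_path[OF assms(1), of ?D "l + n2 - n"] c(3) D2(4) \<tau>(2) by simp
qed

lemma core_nonempty: "core \<noteq> {}"
proof -
  obtain \<Delta> where \<Delta>: "\<Delta> \<in> net_intervals (Suc m)" "cint \<Delta> \<subseteq> cint Ds"
  proof -
    have "fst Ds \<in> endpoints (Suc m)" "snd Ds \<in> endpoints (Suc m)"
      using net_interval_props(1,2)[OF Ds_net] endpoints_mono[of m "Suc m"] by auto
    then obtain b where "(fst Ds, b) \<in> net_intervals (Suc m)" "b \<le> snd Ds"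
      using net_interval_right net_interval_props(3)[OF Ds_net] by metis
    then show ?thesis using that[of "(fst Ds, b)"] by simp
  qed
  then show ?thesis using coreI[of "Suc m" \<Delta>] by auto
qed

lemma core_closed:
  assumes "\<alpha> \<in> core" "is_child \<beta> \<alpha>"
  shows "\<beta> \<in> core"
proof -
  obtain n \<Delta> where \<Delta>: "m < n" "\<Delta> \<in> net_intervals n" "cint \<Delta> \<subseteq> cint Ds" "\<alpha> = char_vec n \<Delta>"
    using coreE[OF assms(1)] .
  obtain n' D where D: "D \<in> net_intervals (Suc n')" "\<beta> = char_vec (Suc n') D"
    "\<alpha> = char_vec n' (parent (Suc n') D)"
    using assms(2) unfolding is_child_def by blast
  note p = parent_net_interval[OF D(1)]
  have "norm_length n' (parent (Suc n') D) = norm_length n \<Delta>"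
    "neighbour_set n' (parent (Suc n') D) = neighbour_set n \<Delta>"
    using \<Delta>(4) D(3) by (simp_all add: char_vec_def)
  then obtain f where f: "similar_net n' (parent (Suc n') D) n \<Delta> f"
    using similar_netI[OF p(1) \<Delta>(2)] by blast
  have D': "D \<in> net_intervals (n' + Suc 0)" using D(1) by simp
  note d = similar_net_descendant[OF f D' p(2)]
  have "\<beta> = char_vec (n + Suc 0) (map_prod f f D)"
    using similar_net_char_vec[OF f D' p(2)] D(2) by simp
  moreover have "char_vec (n + Suc 0) (map_prod f f D) \<in> core"
    using \<Delta>(1,3) similar_netD(2)[OF d(1)] d(2) by (intro coreI) auto
  ultimately show ?thesis by simp
qed

lemma core_\<Omega>: "core \<subseteq> \<Omega>"
  unfolding core_def by (rule descendant_vectors_\<Omega>)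

lemma core_essential: "is_essential_class core"
proof -
  have "\<exists>\<gamma>s. admissible_path \<gamma>s \<and> set \<gamma>s \<subseteq> core \<and> hd \<gamma>s = \<alpha> \<and> last \<gamma>s = \<beta>"
    if \<alpha>: "\<alpha> \<in> core" and \<beta>: "\<beta> \<in> core" for \<alpha> \<beta>
  proof -
    obtain n \<Delta> where \<Delta>: "m < n" "\<Delta> \<in> net_intervals n" "cint \<Delta> \<subseteq> cint Ds" "\<alpha> = char_vec n \<Delta>"
      using coreE[OF \<alpha>] .
    obtain \<gamma>s where \<gamma>s: "admissible_path \<gamma>s" "hd \<gamma>s = char_vec n \<Delta>" "last \<gamma>s = \<beta>"
      "set \<gamma>s \<subseteq> descendant_vectors n \<Delta>"
      using path_into_core[OF \<Delta>(2) \<beta>] by blast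
    have "descendant_vectors n \<Delta> \<subseteq> core"
    proof
      fix \<gamma> assume "\<gamma> \<in> descendant_vectors n \<Delta>"
      then obtain n' D where D: "n \<le> n'" "D \<in> net_intervals n'" "cint D \<subseteq> cint \<Delta>" "\<gamma> = char_vec n' D"
        by (rule descendant_vectorsE)
      show "\<gamma> \<in> core" unfolding D(4)
        by (rule coreI[OF _ D(2) subset_trans[OF D(3) \<Delta>(3)]]) (use \<Delta>(1) D(1) in simp)
    qed
    then show ?thesis using \<gamma>s \<Delta>(4) by blast
  qed
  then show ?thesis
    unfolding is_essential_class_def loop_class_def
    using core_nonempty core_\<Omega> core_closed by blast
qed

lemma essential_class_path:
  assumes "is_essential_class E" "admissible_path \<gamma>s" "hd \<gamma>s \<in> E"
  shows "last \<gamma>s \<in> E"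
proof -
  have "\<gamma>s \<noteq> [] \<Longrightarrow> successively (\<lambda>\<gamma> \<beta>. is_child \<beta> \<gamma>) \<gamma>s \<Longrightarrow> set \<gamma>s \<subseteq> \<Omega> \<Longrightarrow> hd \<gamma>s \<in> E \<Longrightarrow> last \<gamma>s \<in> E"
  proof (induction \<gamma>s)
    case (Cons \<gamma> \<gamma>s)
    show ?case
    proof (cases "\<gamma>s = []")
      case False
      then obtain \<beta> \<beta>s where \<beta>: "\<gamma>s = \<beta> # \<beta>s" by (cases \<gamma>s) auto
      then have "\<beta> \<in> E" using Cons.prems assms(1) by (auto simp: is_essential_class_def)
      then show ?thesis using Cons \<beta> by simp
    qed (use Cons in simp)
  qed simp
  then show ?thesis using assms(2,3) by (simp add: admissible_path_def)
qed

text \<open>Two essential classes that meet are equal, and \<open>path_into_core\<close> leads from any essential class into \<open>core\<close>.\<close>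

lemma essential_class_eq: "essential_class = core"
  unfolding essential_class_def
proof (rule the_equality)
  show "is_essential_class core" by (rule core_essential)
next
  fix E assume E: "is_essential_class E"
  then obtain \<alpha> where \<alpha>: "\<alpha> \<in> E" "\<alpha> \<in> \<Omega>" by (auto simp: is_essential_class_def loop_class_def)
  then obtain n \<Delta> where \<Delta>: "\<Delta> \<in> net_intervals n" "\<alpha> = char_vec n \<Delta>" unfolding \<Omega>_def by blast
  have core_E: "core \<subseteq> E"
  proof
    fix \<beta> assume "\<beta> \<in> core"
    then obtain \<gamma>s where "admissible_path \<gamma>s" "hd \<gamma>s = \<alpha>" "last \<gamma>s = \<beta>"
      using path_into_core[OF \<Delta>(1)] \<Delta>(2) by blast
    then show "\<beta> \<in> E" using essential_class_path[OF E] \<alpha>(1) by blast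
  qed
  obtain \<beta> where \<beta>: "\<beta> \<in> core" using core_nonempty by blast
  have "\<gamma> \<in> core" if \<gamma>: "\<gamma> \<in> E" for \<gamma>
  proof -
    have "\<beta> \<in> E" using \<beta> core_E by blast
    moreover have "\<forall>\<alpha>\<in>E. \<forall>\<beta>\<in>E. \<exists>\<gamma>s. admissible_path \<gamma>s \<and> set \<gamma>s \<subseteq> E \<and> hd \<gamma>s = \<alpha> \<and> last \<gamma>s = \<beta>"
      using E by (simp add: is_essential_class_def loop_class_def)
    ultimately obtain \<gamma>s where "admissible_path \<gamma>s" "hd \<gamma>s = \<beta>" "last \<gamma>s = \<gamma>"
      using \<gamma> by blast
    then show ?thesis using essential_class_path[OF core_essential] \<beta> by blast
  qed
  with core_E show "E = core" by blast
qed

text \<open>From some generation on, the net intervals around an essential point are similar to descendants of \<open>Ds\<close>,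
so their covering probabilities can be compared with those below \<open>Ds\<close>.\<close>

lemma essential_pointsE:
  assumes "x \<in> essential_points"
  obtains \<Delta> N n0 D f where "\<And>n. \<Delta> n \<in> net_intervals n" "\<And>n. x \<in> cint (\<Delta> n)"
    "\<And>n. cint (\<Delta> (N + n)) \<subseteq> cint (\<Delta> N)" "similar_net N (\<Delta> N) n0 D f" "cint D \<subseteq> cint Ds"
proof -
  obtain \<gamma> where "symbolic_representation x \<gamma>" and ev: "\<forall>\<^sub>F j in sequentially. \<gamma> j \<in> core"
    using assms unfolding essential_points_def essential_class_eq by blast
  then obtain \<Delta> where \<Delta>: "\<And>n. \<Delta> n \<in> net_intervals n" "\<And>n. x \<in> cint (\<Delta> n)"
    "\<And>n. \<Delta> n = parent (Suc n) (\<Delta> (Suc n))" "\<And>n. \<gamma> n = char_vec n (\<Delta> n)"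
    unfolding symbolic_representation_def by blast
  obtain N where "\<gamma> N \<in> core" using ev by (auto simp: eventually_sequentially)
  then obtain n0 D where D: "m < n0" "D \<in> net_intervals n0" "cint D \<subseteq> cint Ds" "\<gamma> N = char_vec n0 D"
    by (rule coreE)
  then obtain f where f: "similar_net N (\<Delta> N) n0 D f"
    using similar_netI[OF \<Delta>(1) D(2), of N] \<Delta>(4)[of N] by (auto simp: char_vec_def)
  have "cint (\<Delta> (N + n)) \<subseteq> cint (\<Delta> N)" for n
  proof (induction n)
    case (Suc n)
    have "cint (\<Delta> (Suc (N + n))) \<subseteq> cint (\<Delta> (N + n))"
      using parent_net_interval(2)[OF \<Delta>(1), of "N + n"] by (simp only: \<Delta>(3)[of "N + n", symmetric])
    then show ?case using Suc.IH unfolding add_Suc_right by (rule subset_trans)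
  qed simp
  then show ?thesis using \<Delta>(1,2) f D(3) by (intro that)
qed

lemma essential_pointsI:
  assumes "\<And>n. \<Delta> n \<in> net_intervals n" "\<And>n. x \<in> cint (\<Delta> n)"
    "\<And>n. cint (\<Delta> (Suc n)) \<subseteq> cint (\<Delta> n)" "\<Delta> m = Ds"
  shows "x \<in> essential_points"
proof -
  have "\<Delta> 0 \<in> net_intervals 0" by (rule assms(1))
  then have "\<Delta> 0 = (0, 1)" by (simp add: net_intervals_def)
  moreover have "\<Delta> n = parent (Suc n) (\<Delta> (Suc n))" for n
    using parent_eq_iff[OF assms(1)] assms(1,3) by metis
  ultimately have rep: "symbolic_representation x (\<lambda>n. char_vec n (\<Delta> n))"
    unfolding symbolic_representation_def using assms(1,2) by blast
  have sub: "cint (\<Delta> (m + n)) \<subseteq> cint Ds" for n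
  proof (induction n)
    case 0
    then show ?case by (simp add: assms(4))
  next
    case (Suc n)
    show ?case using assms(3)[of "m + n"] Suc.IH unfolding add_Suc_right by (rule subset_trans)
  qed
  have "char_vec n (\<Delta> n) \<in> core" if "Suc m \<le> n" for n
    using sub[of "n - m"] that by (intro coreI assms(1)) simp_all
  then have "\<forall>\<^sub>F j in sequentially. char_vec j (\<Delta> j) \<in> essential_class"
    unfolding essential_class_eq eventually_sequentially by blast
  moreover have "x \<in> K"
    using assms(2)[of 0] \<open>\<Delta> 0 = (0, 1)\<close> by (simp add: K_eq)
  ultimately show ?thesis unfolding essential_points_def using rep by blast
qed

end

section \<open>Covering probabilities along descendants\<close>

locale net_interval_measure = maximal_net_interval k r d K m Ds + self_similar_measure k r d K \<mu> p
  for k :: nat and r d :: "nat \<Rightarrow> real" and K :: "real set" and m :: nat and Ds :: "real \<times> real"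
    and \<mu> :: "real measure" and p :: "nat \<Rightarrow> real"
begin

lemma p_word_Nil [simp]: "p_word [] = 1"
  and p_word_Cons [simp]: "p_word (j # \<sigma>) = p j * p_word \<sigma>"
  and p_word_append [simp]: "p_word (\<sigma> @ \<tau>) = p_word \<sigma> * p_word \<tau>"
  by (auto simp: p_word_def)

lemma p_word_pos: "\<sigma> \<in> words \<Longrightarrow> 0 < p_word \<sigma>"
  by (induction \<sigma>) (auto simp: p_pos)

lemma p_word_\<Lambda>_pos: "\<sigma> \<in> \<Lambda> n \<Longrightarrow> 0 < p_word \<sigma>"
  using p_word_pos \<Lambda>_words by blast

lemma sum_p_word_cut: "0 < t \<Longrightarrow> (\<Sum>\<eta>\<in>cut t. p_word \<eta>) = 1"
proof -
  have ext: "p_word \<sigma> = (\<Sum>j\<le>k. p_word (\<sigma> @ [j]))" for \<sigma>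
    using p_sum by (simp add: sum_distrib_left[symmetric])
  assume "0 < t"
  from sum_cut[OF this ext] show ?thesis by simp
qed

lemma P_pos:
  assumes "\<Delta> \<in> net_intervals n"
  shows "0 < P n \<Delta>"
proof -
  obtain \<sigma> where \<sigma>: "\<sigma> \<in> covering_words n \<Delta>" using covering_words_nonempty[OF assms] .
  have pos: "0 < p_word \<tau>" if "\<tau> \<in> covering_words n \<Delta>" for \<tau>
    using that covering_words_\<Lambda> p_word_\<Lambda>_pos by blast
  show ?thesis unfolding P_def using \<sigma> pos by (intro sum_pos finite_covering_words) auto
qed

lemma p_word_le_P:
  assumes "\<sigma> \<in> covering_words n \<Delta>"
  shows "p_word \<sigma> \<le> P n \<Delta>"
  unfolding P_def
proof (rule member_le_sum[OF assms _ finite_covering_words])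
  show "0 \<le> p_word \<tau>" if "\<tau> \<in> covering_words n \<Delta> - {\<sigma>}" for \<tau>
    using that covering_words_\<Lambda> p_word_\<Lambda>_pos by (intro less_imp_le) blast
qed

lemma P_le_1: "P n \<Delta> \<le> 1"
proof -
  have "P n \<Delta> \<le> (\<Sum>\<sigma>\<in>\<Lambda> n. p_word \<sigma>)"
    unfolding P_def using covering_words_\<Lambda> finite_\<Lambda> p_word_\<Lambda>_pos
    by (intro sum_mono2) (auto intro: less_imp_le)
  then show ?thesis by (simp add: \<Lambda>_eq_cut sum_p_word_cut)
qed

text \<open>The share of \<open>p_word \<sigma>\<close> that is carried on to the words covering the descendant \<open>\<Delta>\<close> of generation \<open>n\<close>.\<close>

definition rel_P :: "nat \<Rightarrow> real \<times> real \<Rightarrow> nat list \<Rightarrow> real"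
  where "rel_P n \<Delta> \<sigma> =
    (\<Sum>\<eta> | \<eta> \<in> cut (r_min ^ n / \<bar>r_word \<sigma>\<bar>) \<and> cint \<Delta> \<subseteq> S_word (\<sigma> @ \<eta>) ` {0..1}. p_word \<eta>)"

lemma rel_threshold_pos: "\<sigma> \<in> \<Lambda> n' \<Longrightarrow> 0 < r_min ^ n / \<bar>r_word \<sigma>\<bar>"
proof -
  assume "\<sigma> \<in> \<Lambda> n'"
  then have "\<sigma> \<in> words" using \<Lambda>_words by blast
  then show ?thesis using r_word_pos by simp
qed

lemma finite_rel_words:
  assumes "\<sigma> \<in> \<Lambda> n'"
  shows "finite (cut (r_min ^ n / \<bar>r_word \<sigma>\<bar>))"
  by (rule finite_cut[OF rel_threshold_pos[OF assms]])

lemma rel_P_bounds: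
  assumes "\<sigma> \<in> \<Lambda> n'"
  shows "0 \<le> rel_P n \<Delta> \<sigma>" "rel_P n \<Delta> \<sigma> \<le> 1"
proof -
  let ?t = "r_min ^ n / \<bar>r_word \<sigma>\<bar>"
  have nn: "0 \<le> p_word \<eta>" if "\<eta> \<in> cut ?t" for \<eta>
    using that cut_words p_word_pos by (intro less_imp_le) blast
  show "0 \<le> rel_P n \<Delta> \<sigma>" unfolding rel_P_def using nn by (intro sum_nonneg) auto
  have "rel_P n \<Delta> \<sigma> \<le> (\<Sum>\<eta>\<in>cut ?t. p_word \<eta>)"
    unfolding rel_P_def using finite_rel_words[OF assms] nn by (intro sum_mono2) auto
  also have "\<dots> = 1" by (rule sum_p_word_cut[OF rel_threshold_pos[OF assms]])
  finally show "rel_P n \<Delta> \<sigma> \<le> 1" .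
qed

text \<open>Group the words covering the descendant by their prefixes in \<open>\<Lambda> n\<close>.\<close>

lemma P_descendant:
  assumes "n \<le> n'" "\<Delta> \<in> net_intervals n" "\<Delta>' \<in> net_intervals n'" "cint \<Delta>' \<subseteq> cint \<Delta>"
  shows "P n' \<Delta>' = (\<Sum>\<sigma>\<in>covering_words n \<Delta>. p_word \<sigma> * rel_P n' \<Delta>' \<sigma>)"
proof -
  let ?B = "\<lambda>\<sigma>. {\<eta> \<in> cut (r_min ^ n' / \<bar>r_word \<sigma>\<bar>). cint \<Delta>' \<subseteq> S_word (\<sigma> @ \<eta>) ` {0..1}}"
  let ?X = "SIGMA \<sigma>:covering_words n \<Delta>. ?B \<sigma>"
  have cov: "covering_words n' \<Delta>' = (\<lambda>(\<sigma>, \<eta>). \<sigma> @ \<eta>) ` ?X"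
    unfolding covering_words_descendant[OF assms] by auto
  have inj: "inj_on (\<lambda>(\<sigma>, \<eta>). \<sigma> @ \<eta>) ?X"
  proof (rule inj_onI)
    fix x y assume xy: "x \<in> ?X" "y \<in> ?X" "(case x of (\<sigma>, \<eta>) \<Rightarrow> \<sigma> @ \<eta>) = (case y of (\<sigma>, \<eta>) \<Rightarrow> \<sigma> @ \<eta>)"
    obtain \<sigma> \<eta> \<tau> \<xi> where e: "x = (\<sigma>, \<eta>)" "y = (\<tau>, \<xi>)" by (cases x, cases y) blast
    have "\<sigma> \<in> covering_words n \<Delta>" "\<tau> \<in> covering_words n \<Delta>" "\<sigma> @ \<eta> = \<tau> @ \<xi>"
      using xy by (simp_all add: e)
    moreover from this have "\<sigma> \<in> \<Lambda> n" "\<tau> \<in> \<Lambda> n" using subsetD[OF covering_words_\<Lambda>] by blast+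
    ultimately show "x = y" using \<Lambda>_prefix_unique[of \<sigma> n \<tau> \<eta> \<xi>] by (simp add: e)
  qed
  have "P n' \<Delta>' = (\<Sum>x\<in>?X. p_word (case x of (\<sigma>, \<eta>) \<Rightarrow> \<sigma> @ \<eta>))"
    unfolding P_def cov by (subst sum.reindex[OF inj]) simp
  also have "\<dots> = (\<Sum>(\<sigma>, \<eta>)\<in>?X. p_word \<sigma> * p_word \<eta>)" by (intro sum.cong) auto
  also have "\<dots> = (\<Sum>\<sigma>\<in>covering_words n \<Delta>. \<Sum>\<eta>\<in>?B \<sigma>. p_word \<sigma> * p_word \<eta>)"
  proof (rule sum.Sigma[symmetric])
    show "\<forall>\<sigma>\<in>covering_words n \<Delta>. finite (?B \<sigma>)"
      using finite_rel_words[OF subsetD[OF covering_words_\<Lambda>]] by simp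
  qed (rule finite_covering_words)
  also have "\<dots> = (\<Sum>\<sigma>\<in>covering_words n \<Delta>. p_word \<sigma> * rel_P n' \<Delta>' \<sigma>)"
    by (simp add: rel_P_def sum_distrib_left)
  finally show ?thesis .
qed

lemma P_antimono:
  assumes "n \<le> n'" "\<Delta> \<in> net_intervals n" "\<Delta>' \<in> net_intervals n'" "cint \<Delta>' \<subseteq> cint \<Delta>"
  shows "P n' \<Delta>' \<le> P n \<Delta>"
proof -
  have "p_word \<sigma> * rel_P n' \<Delta>' \<sigma> \<le> p_word \<sigma>" if "\<sigma> \<in> covering_words n \<Delta>" for \<sigma>
  proof -
    have "\<sigma> \<in> \<Lambda> n" using that covering_words_\<Lambda> by blast
    then show ?thesis using rel_P_bounds(2) p_word_\<Lambda>_pos[of \<sigma> n] by (intro mult_left_le) auto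
  qed
  then show ?thesis unfolding P_descendant[OF assms] unfolding P_def by (rule sum_mono)
qed

text \<open>The shares \<open>rel_P\<close> agree for corresponding covering words of similar net intervals. In \<open>\<Delta>\<close> the share of
\<open>\<sigma>\<close> is at most \<open>P (n + i) \<Delta>\<^sub>1 / p_word \<sigma>\<close>, so the least \<open>p_word \<sigma>\<close> over the words covering \<open>\<Delta>\<close> gives a
constant that works for all \<open>\<Delta>'\<close> and all generations.\<close>

lemma P_transport:
  assumes "\<Delta> \<in> net_intervals n"
  obtains C where "0 < C"
    "\<And>m' \<Delta>' f i \<Delta>\<^sub>1. similar_net n \<Delta> m' \<Delta>' f \<Longrightarrow> \<Delta>\<^sub>1 \<in> net_intervals (n + i) \<Longrightarrow> cint \<Delta>\<^sub>1 \<subseteq> cint \<Delta> \<Longrightarrow>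
      P (m' + i) (map_prod f f \<Delta>\<^sub>1) \<le> C * P m' \<Delta>' * P (n + i) \<Delta>\<^sub>1"
proof
  let ?q = "Min (p_word ` covering_words n \<Delta>)"
  have fin: "finite (p_word ` covering_words n \<Delta>)" using finite_covering_words by simp
  have "p_word ` covering_words n \<Delta> \<noteq> {}" using covering_words_nonempty[OF assms] by blast
  then have "?q \<in> p_word ` covering_words n \<Delta>" using fin by (rule Min_in[rotated])
  then obtain \<sigma> where "?q = p_word \<sigma>" "\<sigma> \<in> covering_words n \<Delta>" by (rule imageE)
  then have q: "0 < ?q" using p_word_\<Lambda>_pos[OF subsetD[OF covering_words_\<Lambda>]] by simp
  then show "0 < 1 / ?q" by simp
  fix m' \<Delta>' f i \<Delta>1
  assume f: "similar_net n \<Delta> m' \<Delta>' f" and \<Delta>1: "\<Delta>1 \<in> net_intervals (n + i)" "cint \<Delta>1 \<subseteq> cint \<Delta>"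
  note d = similar_netD[OF f] and dd = similar_net_descendant[OF f \<Delta>1]
  have bound: "rel_P (m' + i) (map_prod f f \<Delta>1) \<sigma>' \<le> P (n + i) \<Delta>1 / ?q" if \<sigma>': "\<sigma>' \<in> covering_words m' \<Delta>'" for \<sigma>'
  proof -
    have "S_word \<sigma>' \<in> (\<lambda>\<sigma>. f \<circ> S_word \<sigma>) ` covering_words n \<Delta>"
      using f \<sigma>' by (simp add: similar_net_def)
    then obtain \<sigma> where \<sigma>: "\<sigma> \<in> covering_words n \<Delta>" "S_word \<sigma>' = f \<circ> S_word \<sigma>" by blast
    obtain \<sigma>'' where \<sigma>'': "S_word \<sigma>'' = f \<circ> S_word \<sigma>"
      "\<And>i. r_min ^ (m' + i) / \<bar>r_word \<sigma>''\<bar> = r_min ^ (n + i) / \<bar>r_word \<sigma>\<bar>"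
      using similar_net_word[OF f \<sigma>(1)] by blast
    have "r_word \<sigma>'' = r_word \<sigma>'" using \<sigma>''(1) \<sigma>(2) by (intro S_word_eq_r_word) simp
    then have cut: "cut (r_min ^ (m' + i) / \<bar>r_word \<sigma>'\<bar>) = cut (r_min ^ (n + i) / \<bar>r_word \<sigma>\<bar>)"
      using \<sigma>''(2)[of i] by simp
    have \<sigma>\<Lambda>: "\<sigma> \<in> \<Lambda> n" using \<sigma>(1) covering_words_\<Lambda> by blast
    have "inj f"
    proof (rule injI)
      fix x y assume "f x = f y"
      then show "x = y" using d(6)[of x y] d(6)[of y x] by simp
    qed
    have cov: "cint \<Delta>1 \<subseteq> S_word (\<sigma> @ \<eta>) ` {0..1}"
      if "cint (map_prod f f \<Delta>1) \<subseteq> S_word (\<sigma>' @ \<eta>) ` {0..1}" for \<eta>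
    proof -
      have "f ` cint \<Delta>1 = cint (map_prod f f \<Delta>1)" by (simp add: similar_net_image[OF f])
      moreover have "S_word (\<sigma>' @ \<eta>) ` {0..1} = f ` S_word (\<sigma> @ \<eta>) ` {0..1}"
        unfolding S_word_append_fun \<sigma>(2) by (simp add: image_image)
      ultimately have "f ` cint \<Delta>1 \<subseteq> f ` S_word (\<sigma> @ \<eta>) ` {0..1}" using that by simp
      then show ?thesis using inj_image_subset_iff[OF \<open>inj f\<close>] by blast
    qed
    have "rel_P (m' + i) (map_prod f f \<Delta>1) \<sigma>' \<le> rel_P (n + i) \<Delta>1 \<sigma>"
      unfolding rel_P_def cut
    proof (rule sum_mono2)
      show "finite {\<eta>. \<eta> \<in> cut (r_min ^ (n + i) / \<bar>r_word \<sigma>\<bar>) \<and> cint \<Delta>1 \<subseteq> S_word (\<sigma> @ \<eta>) ` {0..1}}"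
        using finite_rel_words[OF \<sigma>\<Lambda>, of "n + i"] by (rule finite_subset[rotated]) auto
      show "{\<eta>. \<eta> \<in> cut (r_min ^ (n + i) / \<bar>r_word \<sigma>\<bar>) \<and> cint (map_prod f f \<Delta>1) \<subseteq> S_word (\<sigma>' @ \<eta>) ` {0..1}}
        \<subseteq> {\<eta>. \<eta> \<in> cut (r_min ^ (n + i) / \<bar>r_word \<sigma>\<bar>) \<and> cint \<Delta>1 \<subseteq> S_word (\<sigma> @ \<eta>) ` {0..1}}"
        using cov by (intro Collect_mono) blast
      fix \<eta> assume "\<eta> \<in> {\<eta>. \<eta> \<in> cut (r_min ^ (n + i) / \<bar>r_word \<sigma>\<bar>) \<and> cint \<Delta>1 \<subseteq> S_word (\<sigma> @ \<eta>) ` {0..1}} -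
        {\<eta>. \<eta> \<in> cut (r_min ^ (n + i) / \<bar>r_word \<sigma>\<bar>) \<and> cint (map_prod f f \<Delta>1) \<subseteq> S_word (\<sigma>' @ \<eta>) ` {0..1}}"
      then have "\<eta> \<in> words" using cut_words by blast
      then show "0 \<le> p_word \<eta>" using p_word_pos less_imp_le by blast
    qed
    also have "\<dots> \<le> P (n + i) \<Delta>1 / ?q"
    proof -
      have "?q \<le> p_word \<sigma>" using fin \<sigma>(1) by (intro Min_le) auto
      then have "?q * rel_P (n + i) \<Delta>1 \<sigma> \<le> p_word \<sigma> * rel_P (n + i) \<Delta>1 \<sigma>"
        using rel_P_bounds(1)[OF \<sigma>\<Lambda>] by (rule mult_right_mono)
      also have "\<dots> \<le> P (n + i) \<Delta>1"
        unfolding P_descendant[OF le_add1 assms \<Delta>1]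
      proof (rule member_le_sum[OF \<sigma>(1) _ finite_covering_words])
        fix \<tau> assume "\<tau> \<in> covering_words n \<Delta> - {\<sigma>}"
        then have "\<tau> \<in> \<Lambda> n" using covering_words_\<Lambda> by blast
        then show "0 \<le> p_word \<tau> * rel_P (n + i) \<Delta>1 \<tau>"
          using p_word_\<Lambda>_pos rel_P_bounds(1) by (intro mult_nonneg_nonneg) (auto intro: less_imp_le)
      qed
      finally show ?thesis using q by (simp add: pos_le_divide_eq mult.commute)
    qed
    finally show ?thesis .
  qed
  have "P (m' + i) (map_prod f f \<Delta>1) = (\<Sum>\<sigma>'\<in>covering_words m' \<Delta>'. p_word \<sigma>' * rel_P (m' + i) (map_prod f f \<Delta>1) \<sigma>')"
    by (rule P_descendant[OF le_add1 d(2) similar_netD(2)[OF dd(1)] dd(2)])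
  also have "\<dots> \<le> (\<Sum>\<sigma>'\<in>covering_words m' \<Delta>'. p_word \<sigma>' * (P (n + i) \<Delta>1 / ?q))"
  proof (rule sum_mono)
    fix \<sigma>' assume \<sigma>': "\<sigma>' \<in> covering_words m' \<Delta>'"
    then have "0 \<le> p_word \<sigma>'" using covering_words_\<Lambda> p_word_\<Lambda>_pos by (intro less_imp_le) blast
    with bound[OF \<sigma>'] show "p_word \<sigma>' * rel_P (m' + i) (map_prod f f \<Delta>1) \<sigma>' \<le> p_word \<sigma>' * (P (n + i) \<Delta>1 / ?q)"
      by (rule mult_left_mono)
  qed
  also have "\<dots> = 1 / ?q * P m' \<Delta>' * P (n + i) \<Delta>1"
    unfolding P_def[of m'] by (simp add: sum_distrib_right[symmetric] sum_divide_distrib[symmetric])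
  finally show "P (m' + i) (map_prod f f \<Delta>1) \<le> 1 / ?q * P m' \<Delta>' * P (n + i) \<Delta>1" .
qed

text \<open>Probabilities are bounded below by a power of the ratios, so a connecting word of bounded contraction costs
only a constant factor.\<close>

lemma p_word_lower:
  obtains B where "\<And>\<sigma>. \<sigma> \<in> words \<Longrightarrow> \<bar>r_word \<sigma>\<bar> ^ B \<le> p_word \<sigma>"
proof -
  have "\<forall>j\<in>{..k}. \<exists>b. \<bar>r j\<bar> ^ b < p j"
    using contraction p_pos by (auto intro!: real_arch_pow_inv)
  then obtain b where b: "\<forall>j\<in>{..k}. \<bar>r j\<bar> ^ b j < p j" by (rule bchoice[THEN exE])
  let ?B = "\<Sum>j\<le>k. b j"
  have letter: "\<bar>r j\<bar> ^ ?B \<le> p j" if "j \<le> k" for j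
  proof -
    have "b j \<le> ?B" using that by (intro member_le_sum) auto
    then have "\<bar>r j\<bar> ^ ?B \<le> \<bar>r j\<bar> ^ b j" using contraction[OF that] by (intro power_decreasing) auto
    then show ?thesis using b that by force
  qed
  have "\<bar>r_word \<sigma>\<bar> ^ ?B \<le> p_word \<sigma>" if "\<sigma> \<in> words" for \<sigma>
    using that
  proof (induction \<sigma>)
    case (Cons j \<sigma>)
    then have "j \<le> k" "\<sigma> \<in> words" by auto
    then have "\<bar>r j\<bar> ^ ?B * \<bar>r_word \<sigma>\<bar> ^ ?B \<le> p j * p_word \<sigma>"
      using Cons.IH letter[of j] p_pos[of j] by (intro mult_mono) auto
    then show ?case by (simp add: abs_mult power_mult_distrib)
  qed simp
  then show ?thesis by (rule that)
qed

lemma P_lower: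
  obtains B where "\<And>n \<Delta>. \<Delta> \<in> net_intervals n \<Longrightarrow> r_min ^ (Suc n * B) \<le> P n \<Delta>"
proof -
  obtain B where B: "\<And>\<sigma>. \<sigma> \<in> words \<Longrightarrow> \<bar>r_word \<sigma>\<bar> ^ B \<le> p_word \<sigma>"
    by (rule p_word_lower) (rule that)
  have "r_min ^ (Suc n * B) \<le> P n \<Delta>" if \<Delta>: "\<Delta> \<in> net_intervals n" for n \<Delta>
  proof -
    obtain \<sigma> where \<sigma>: "\<sigma> \<in> covering_words n \<Delta>" using covering_words_nonempty[OF \<Delta>] .
    have "\<sigma> \<in> \<Lambda> n" using \<sigma> covering_words_\<Lambda> by blast
    then have "r_min ^ Suc n \<le> \<bar>r_word \<sigma>\<bar>" "\<sigma> \<in> words"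
      using r_word_\<Lambda>(2)[of \<sigma> n] \<Lambda>_words by auto
    then have "(r_min ^ Suc n) ^ B \<le> \<bar>r_word \<sigma>\<bar> ^ B"
      using r_min_bounds by (intro power_mono) simp_all
    also have "\<dots> \<le> p_word \<sigma>" using B \<open>\<sigma> \<in> words\<close> .
    also have "\<dots> \<le> P n \<Delta>" by (rule p_word_le_P[OF \<sigma>])
    finally show ?thesis by (simp only: power_mult)
  qed
  then show ?thesis by (rule that)
qed

text \<open>Many words may cover \<open>\<Delta>\<close>, but they give at most as many maps as for \<open>Ds\<close>; one of these maps
collects a fixed proportion of \<open>P n \<Delta>\<close>.\<close>

lemma dominant_covering_map:
  assumes "\<Delta> \<in> net_intervals n"
  obtains v where "v \<in> S_word ` covering_words n \<Delta>"
    "P n \<Delta> \<le> real (card (S_word ` covering_words m Ds)) * (\<Sum>\<sigma> | \<sigma> \<in> covering_words n \<Delta> \<and> S_word \<sigma> = v. p_word \<sigma>)"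
proof -
  let ?M = "S_word ` covering_words n \<Delta>" and ?N = "card (S_word ` covering_words m Ds)"
  let ?q = "\<lambda>v. \<Sum>\<sigma> | \<sigma> \<in> covering_words n \<Delta> \<and> S_word \<sigma> = v. p_word \<sigma>"
  have fin: "finite (?q ` ?M)" "?q ` ?M \<noteq> {}"
    using finite_covering_words covering_words_nonempty[OF assms] by blast+
  then have "Max (?q ` ?M) \<in> ?q ` ?M" by (rule Max_in)
  then obtain v where v: "v \<in> ?M" "Max (?q ` ?M) = ?q v" by (rule imageE)
  have max: "?q u \<le> ?q v" if "u \<in> ?M" for u
    unfolding v(2)[symmetric] using fin(1) that by (intro Max_ge imageI)
  have nn: "0 \<le> ?q v"
  proof (rule sum_nonneg)
    fix \<sigma> assume "\<sigma> \<in> {\<sigma>. \<sigma> \<in> covering_words n \<Delta> \<and> S_word \<sigma> = v}"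
    then have "\<sigma> \<in> \<Lambda> n" using covering_words_\<Lambda> by blast
    then show "0 \<le> p_word \<sigma>" using p_word_\<Lambda>_pos less_imp_le by blast
  qed
  have "P n \<Delta> = (\<Sum>u\<in>?M. ?q u)"
    unfolding P_def by (rule sum.image_gen[OF finite_covering_words])
  also have "\<dots> \<le> real (card ?M) * ?q v" using max by (rule sum_bounded_above)
  also have "\<dots> \<le> real ?N * ?q v" using Ds_maximal[OF assms] nn by (intro mult_right_mono) auto
  finally show ?thesis using that v(1) by blast
qed

text \<open>The factor \<open>c\<close> bounds what is lost when a copy of \<open>copy \<tau>'\<close> is placed inside \<open>\<Delta>\<close> by means of \<open>\<tau>\<close>, uniformly in
the word \<open>\<tau>'\<close>.\<close>

definition gluing_word :: "real \<Rightarrow> nat \<Rightarrow> real \<times> real \<Rightarrow> nat list \<Rightarrow> nat \<Rightarrow> bool"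
  where "gluing_word c n \<Delta> \<tau> l \<longleftrightarrow> exact \<tau> l \<and> S_word \<tau> ` {0..1} \<subseteq> cint \<Delta> \<and> n \<le> l \<and>
    (\<forall>\<tau>' l'. exact \<tau>' l' \<longrightarrow>
      c * P n \<Delta> * P (l' + m) (copy \<tau>') \<le> P (l + (l' + m)) (copy (\<tau> @ \<tau>')))"

text \<open>Take \<open>\<tau> = \<sigma>0 @ \<eta>\<close> with \<open>\<sigma>0\<close> representing the dominant covering map and \<open>\<eta>\<close> from \<open>exact_descent\<close>. If
\<open>\<sigma>\<close> is any word with the dominant map and \<open>\<omega>\<close> covers \<open>copy \<tau>'\<close>, then \<open>\<sigma> @ \<eta> @ \<omega>\<close> covers \<open>copy (\<tau> @ \<tau>')\<close>,
and different pairs give different words.\<close>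

lemma P_gluing:
  obtains C c where "0 < c"
    "\<And>n \<Delta>. \<Delta> \<in> net_intervals n \<Longrightarrow> \<exists>\<tau> l. gluing_word c n \<Delta> \<tau> l \<and> l \<le> n + C"
proof -
  obtain C where C: "\<And>n \<Delta> \<sigma>. \<Delta> \<in> net_intervals n \<Longrightarrow> \<sigma> \<in> covering_words n \<Delta> \<Longrightarrow>
    \<exists>\<eta>\<in>words. \<exists>l. exact (\<sigma> @ \<eta>) l \<and> n \<le> l \<and> l \<le> n + C \<and> S_word (\<sigma> @ \<eta>) ` {0..1} \<subseteq> cint \<Delta>"
    by (rule exact_descent) (rule that)
  obtain B where B: "\<And>\<sigma>. \<sigma> \<in> words \<Longrightarrow> \<bar>r_word \<sigma>\<bar> ^ B \<le> p_word \<sigma>"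
    by (rule p_word_lower) (rule that)
  let ?N = "card (S_word ` covering_words m Ds)"
  have "covering_words m Ds \<noteq> {}" using covering_words_nonempty[OF Ds_net] by blast
  then have "?N \<noteq> 0" using finite_covering_words by simp
  define c where "c = r_min ^ (C * B) / real ?N"
  have c0: "0 < c" using \<open>?N \<noteq> 0\<close> by (simp add: c_def)
  have "\<exists>\<tau> l. gluing_word c n \<Delta> \<tau> l \<and> l \<le> n + C" if \<Delta>: "\<Delta> \<in> net_intervals n" for n \<Delta>
  proof -
    obtain v where v: "v \<in> S_word ` covering_words n \<Delta>"
      "P n \<Delta> \<le> real ?N * (\<Sum>\<sigma> | \<sigma> \<in> covering_words n \<Delta> \<and> S_word \<sigma> = v. p_word \<sigma>)"
      by (rule dominant_covering_map[OF \<Delta>]) (rule that)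
    let ?G = "{\<sigma>. \<sigma> \<in> covering_words n \<Delta> \<and> S_word \<sigma> = v}"
    obtain \<sigma>0 where \<sigma>0: "\<sigma>0 \<in> covering_words n \<Delta>" "S_word \<sigma>0 = v" using v(1) by blast
    obtain \<eta> l where \<eta>: "\<eta> \<in> words" "exact (\<sigma>0 @ \<eta>) l" "n \<le> l" "l \<le> n + C"
      "S_word (\<sigma>0 @ \<eta>) ` {0..1} \<subseteq> cint \<Delta>"
      using C[OF \<Delta> \<sigma>0(1)] by blast
    have "\<sigma>0 \<in> \<Lambda> n" using \<sigma>0(1) covering_words_\<Lambda> by blast
    have p\<eta>: "r_min ^ (C * B) \<le> p_word \<eta>"
    proof -
      have "r_min ^ n * r_min ^ C \<le> r_min ^ l"
        unfolding power_add[symmetric] using \<eta>(4) by (simp add: r_min_power_le_iff)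
      also have "\<dots> = \<bar>r_word \<sigma>0\<bar> * \<bar>r_word \<eta>\<bar>" using \<eta>(2) by (simp add: exact_def abs_mult[symmetric])
      also have "\<dots> \<le> r_min ^ n * \<bar>r_word \<eta>\<bar>"
        using r_word_\<Lambda>(1)[OF \<open>\<sigma>0 \<in> \<Lambda> n\<close>] by (intro mult_right_mono) auto
      finally have "r_min ^ C \<le> \<bar>r_word \<eta>\<bar>" by simp
      then have "(r_min ^ C) ^ B \<le> \<bar>r_word \<eta>\<bar> ^ B" by (intro power_mono) auto
      also have "\<dots> \<le> p_word \<eta>" using B \<eta>(1) .
      finally show ?thesis by (simp only: power_mult)
    qed
    have glue: "c * P n \<Delta> * P (l' + m) (copy \<tau>') \<le> P (l + (l' + m)) (copy ((\<sigma>0 @ \<eta>) @ \<tau>'))"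
      if \<tau>': "exact \<tau>' l'" for \<tau>' l'
    proof -
      let ?H = "covering_words (l' + m) (copy \<tau>')"
      let ?j = "\<lambda>(\<sigma>, \<omega>). \<sigma> @ \<eta> @ \<omega>"
      have mem: "?j x \<in> covering_words (l + (l' + m)) (copy ((\<sigma>0 @ \<eta>) @ \<tau>'))" if x: "x \<in> ?G \<times> ?H" for x
      proof -
        obtain \<sigma> \<omega> where x: "x = (\<sigma>, \<omega>)" "\<sigma> \<in> covering_words n \<Delta>" "S_word \<sigma> = v" "\<omega> \<in> ?H"
          using x by blast
        have eq: "S_word (\<sigma> @ \<eta>) = S_word (\<sigma>0 @ \<eta>)" unfolding S_word_append_fun x(3) \<sigma>0(2) ..
        have "\<sigma> \<in> words" using x(2) covering_words_\<Lambda> \<Lambda>_words by blast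
        then have ex: "exact (\<sigma> @ \<eta>) l"
          using \<eta>(1,2) S_word_eq_r_word[OF eq] by (simp add: exact_def)
        have "\<omega> \<in> \<Lambda> (l' + m)" "cint (copy \<tau>') \<subseteq> S_word \<omega> ` {0..1}"
          using x(4) by (auto simp: covering_words_def)
        then have "(\<sigma> @ \<eta>) @ \<omega> \<in> \<Lambda> (l + (l' + m))" using exact_\<Lambda>[OF ex] by blast
        moreover have "cint (copy ((\<sigma>0 @ \<eta>) @ \<tau>')) \<subseteq> S_word ((\<sigma> @ \<eta>) @ \<omega>) ` {0..1}"
        proof -
          have "cint (copy ((\<sigma>0 @ \<eta>) @ \<tau>')) = S_word (\<sigma>0 @ \<eta>) ` cint (copy \<tau>')"
            by (rule cint_copy_append[OF \<eta>(2)])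
          also have "\<dots> \<subseteq> S_word (\<sigma>0 @ \<eta>) ` S_word \<omega> ` {0..1}"
            using \<open>cint (copy \<tau>') \<subseteq> S_word \<omega> ` {0..1}\<close> by (rule image_mono)
          also have "\<dots> = S_word ((\<sigma> @ \<eta>) @ \<omega>) ` {0..1}"
            unfolding S_word_append_fun[of "\<sigma> @ \<eta>" \<omega>] eq by (simp add: image_image)
          finally show ?thesis .
        qed
        ultimately show ?thesis unfolding x(1) covering_words_def by simp
      qed
      have inj: "inj_on ?j (?G \<times> ?H)"
      proof (rule inj_onI)
        fix x y assume xy: "x \<in> ?G \<times> ?H" "y \<in> ?G \<times> ?H" "?j x = ?j y"
        obtain \<sigma> \<omega> \<tau> \<xi> where e: "x = (\<sigma>, \<omega>)" "y = (\<tau>, \<xi>)" by (cases x, cases y) blast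
        have "\<sigma> \<in> \<Lambda> n" "\<tau> \<in> \<Lambda> n" using xy(1,2) covering_words_\<Lambda>[of n \<Delta>] unfolding e by blast+
        moreover have eq: "\<sigma> @ \<eta> @ \<omega> = \<tau> @ \<eta> @ \<xi>" using xy(3) by (simp add: e)
        ultimately have "\<sigma> = \<tau>" by (rule \<Lambda>_prefix_unique)
        with eq show "x = y" by (simp add: e)
      qed
      let ?Q = "\<Sum>\<sigma>\<in>?G. p_word \<sigma>"
      have "c * P n \<Delta> * P (l' + m) (copy \<tau>') \<le> ?Q * p_word \<eta> * P (l' + m) (copy \<tau>')"
      proof (rule mult_right_mono)
        have "0 \<le> ?Q"
        proof (rule sum_nonneg)
          fix \<sigma> assume "\<sigma> \<in> ?G"
          then have "\<sigma> \<in> \<Lambda> n" using covering_words_\<Lambda> by blast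
          then show "0 \<le> p_word \<sigma>" using p_word_\<Lambda>_pos less_imp_le by blast
        qed
        have "c * P n \<Delta> \<le> c * (real ?N * ?Q)" using v(2) c0 by (intro mult_left_mono) auto
        also have "\<dots> = ?Q * r_min ^ (C * B)" using \<open>?N \<noteq> 0\<close> by (simp add: c_def)
        also have "\<dots> \<le> ?Q * p_word \<eta>" using p\<eta> \<open>0 \<le> ?Q\<close> by (rule mult_left_mono)
        finally show "c * P n \<Delta> \<le> ?Q * p_word \<eta>" .
        show "0 \<le> P (l' + m) (copy \<tau>')" using P_pos[OF copy_net_interval[OF \<tau>']] by simp
      qed
      also have "\<dots> = (\<Sum>\<sigma>\<in>?G. \<Sum>\<omega>\<in>?H. p_word \<sigma> * p_word \<eta> * p_word \<omega>)"
        unfolding P_def sum_distrib_right[of p_word ?G "p_word \<eta>"] sum_product ..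
      also have "\<dots> = (\<Sum>x\<in>?G \<times> ?H. p_word (?j x))"
        by (simp add: sum.cartesian_product case_prod_unfold mult.assoc)
      also have "\<dots> = (\<Sum>\<omega>\<in>?j ` (?G \<times> ?H). p_word \<omega>)"
        by (subst sum.reindex[OF inj]) simp
      also have "\<dots> \<le> P (l + (l' + m)) (copy ((\<sigma>0 @ \<eta>) @ \<tau>'))"
        unfolding P_def
      proof (rule sum_mono2[OF finite_covering_words])
        show "?j ` (?G \<times> ?H) \<subseteq> covering_words (l + (l' + m)) (copy ((\<sigma>0 @ \<eta>) @ \<tau>'))"
          using mem by (rule image_subsetI)
        fix \<omega> assume "\<omega> \<in> covering_words (l + (l' + m)) (copy ((\<sigma>0 @ \<eta>) @ \<tau>')) - ?j ` (?G \<times> ?H)"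
        then have "\<omega> \<in> \<Lambda> (l + (l' + m))" using covering_words_\<Lambda> by blast
        then show "0 \<le> p_word \<omega>" using p_word_\<Lambda>_pos less_imp_le by blast
      qed
      finally show ?thesis .
    qed
    show ?thesis using \<eta>(2-5) glue
      by (intro exI[of _ "\<sigma>0 @ \<eta>"] exI[of _ l]) (simp add: gluing_word_def)
  qed
  with c0 show ?thesis by (rule that)
qed

end

section \<open>Local dimensions in terms of net intervals\<close>

lemma linear_rateI:
  fixes u :: "nat \<Rightarrow> real"
  assumes "\<And>\<epsilon>::real. 0 < \<epsilon> \<Longrightarrow> \<exists>C N. \<forall>n\<ge>N. \<bar>u n - L * n\<bar> \<le> \<epsilon> * n + C"
  shows "(\<lambda>n. u n / n) \<longlonglongrightarrow> L"
proof (rule LIMSEQ_I)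
  fix e :: real assume e: "0 < e"
  obtain C N where C: "\<And>n. n \<ge> N \<Longrightarrow> \<bar>u n - L * n\<bar> \<le> e / 2 * n + C"
    using assms[of "e / 2"] e by auto
  obtain M :: nat where M: "2 * \<bar>C\<bar> / e < M" using reals_Archimedean2 by blast
  show "\<exists>no. \<forall>n\<ge>no. norm (u n / n - L) < e"
  proof (intro exI[of _ "max N (max 1 M)"] allI impI)
    fix n :: nat assume n: "max N (max 1 M) \<le> n"
    have "2 * \<bar>C\<bar> < e * n"
    proof -
      have "real M \<le> real n" using n by simp
      with M have "2 * \<bar>C\<bar> / e < real n" by linarith
      then show ?thesis using e by (simp add: pos_divide_less_eq mult.commute)
    qed
    moreover have "\<bar>u n - L * n\<bar> \<le> e / 2 * n + C" using C n by simp
    ultimately have lt: "\<bar>u n - L * n\<bar> < e * n" by (simp add: abs_if split: if_splits)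
    have "u n / n - L = (u n - L * n) / n" using n by (simp add: field_simps)
    then have "norm (u n / n - L) = \<bar>u n - L * n\<bar> / n" by simp
    also have "\<dots> < e" using lt n by (simp add: pos_divide_less_eq)
    finally show "norm (u n / n - L) < e" .
  qed
qed

lemma linear_rateD:
  fixes u :: "nat \<Rightarrow> real" and \<epsilon> :: real
  assumes "(\<lambda>n. u n / n) \<longlonglongrightarrow> L" "0 < \<epsilon>"
  obtains N where "\<And>n. n \<ge> N \<Longrightarrow> \<bar>u n - L * n\<bar> \<le> \<epsilon> * n"
proof -
  obtain N where N: "\<And>n. n \<ge> N \<Longrightarrow> norm (u n / n - L) < \<epsilon>"
    using LIMSEQ_D[OF assms] by blast
  have "\<bar>u n - L * n\<bar> \<le> \<epsilon> * n" if "n \<ge> Suc N" for n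
  proof -
    have "u n / n - L = (u n - L * n) / n" using that by (simp add: field_simps)
    then have "\<bar>u n - L * n\<bar> / n < \<epsilon>" using N[of n] that by simp
    then show ?thesis using that by (simp add: pos_divide_less_eq)
  qed
  then show ?thesis by (rule that)
qed

text \<open>The scales \<open>\<rho> ^ n\<close> suffice: between two consecutive ones a monotone \<open>G\<close> is squeezed, while \<open>ln t\<close> changes by
a bounded amount.\<close>

lemma local_rate_iff:
  fixes G :: "real \<Rightarrow> real" and \<rho> D :: real
  assumes \<rho>: "0 < \<rho>" "\<rho> < 1"
    and mono: "\<And>s t. 0 < s \<Longrightarrow> s \<le> t \<Longrightarrow> G s \<le> G t"
  shows "((\<lambda>t. G t / ln t) \<longlongrightarrow> D) (at_right 0) \<longleftrightarrow> (\<lambda>n. G (\<rho> ^ n) / real n) \<longlonglongrightarrow> D * ln \<rho>"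
proof
  assume lim: "((\<lambda>t. G t / ln t) \<longlongrightarrow> D) (at_right 0)"
  have "(\<lambda>n. \<rho> ^ n) \<longlonglongrightarrow> 0" using \<rho> by (intro LIMSEQ_realpow_zero) auto
  moreover have "\<forall>\<^sub>F n in sequentially. \<rho> ^ n \<in> {0<..}" using \<rho> by (intro always_eventually) auto
  ultimately have "filterlim (\<lambda>n. \<rho> ^ n) (at_right 0) sequentially"
    unfolding at_within_def using \<rho>
    by (auto simp: filterlim_inf filterlim_principal elim!: eventually_mono)
  from filterlim_compose[OF lim this]
  have "(\<lambda>n. G (\<rho> ^ n) / ln (\<rho> ^ n)) \<longlonglongrightarrow> D" .
  then have "(\<lambda>n. G (\<rho> ^ n) / ln (\<rho> ^ n) * ln \<rho>) \<longlonglongrightarrow> D * ln \<rho>" by (intro tendsto_mult) auto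
  then show "(\<lambda>n. G (\<rho> ^ n) / real n) \<longlonglongrightarrow> D * ln \<rho>"
    using \<rho> by (simp add: ln_realpow)
next
  define L where "L = D * ln \<rho>"
  assume "(\<lambda>n. G (\<rho> ^ n) / real n) \<longlonglongrightarrow> D * ln \<rho>"
  then have lim: "(\<lambda>n. G (\<rho> ^ n) / real n) \<longlonglongrightarrow> L" by (simp add: L_def)
  have ln\<rho>: "ln \<rho> < 0" using \<rho> by simp
  have "((\<lambda>t. G t / (ln t / ln \<rho>)) \<longlongrightarrow> L) (at_right 0)"
  proof (rule tendstoI)
    fix e :: real assume e: "0 < e"
    obtain N where N: "\<And>n. n \<ge> N \<Longrightarrow> \<bar>G (\<rho> ^ n) - L * n\<bar> \<le> e / 2 * n"
      by (rule linear_rateD[OF lim, of "e / 2"]) (use e in auto)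
    define C where "C = e / 2 + \<bar>L\<bar>"
    obtain M :: nat where M: "2 * C / e < M" using reals_Archimedean2 by blast
    define T where "T = max (Suc N) M"
    have "dist (G t / (ln t / ln \<rho>)) L < e" if t: "0 < t" "t < \<rho> ^ T" for t
    proof -
      define z where "z = ln t / ln \<rho>"
      have "ln t < ln (\<rho> ^ T)" using t \<rho> by (subst ln_less_cancel_iff) auto
      then have "ln t < T * ln \<rho>" using \<rho> by (simp add: ln_realpow)
      then have zT: "real T < z" using ln\<rho> by (simp add: z_def neg_less_divide_eq)
      define n where "n = nat \<lfloor>z\<rfloor>"
      have "0 \<le> z" using zT by linarith
      then have n: "real n \<le> z" "z < real n + 1" unfolding n_def by linarith+
      define n' where "n' = Suc n"
      have n': "real n' = real n + 1" by (simp add: n'_def)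
      have "N \<le> n" using zT n by (simp add: T_def)
      then have "N \<le> n'" by (simp add: n'_def)
      have lnt: "ln t = z * ln \<rho>" using ln\<rho> by (simp add: z_def)
      have "t \<le> \<rho> ^ n"
      proof -
        have "ln t \<le> n * ln \<rho>" unfolding lnt using n n' ln\<rho> by (intro mult_right_mono_neg) auto
        then have "ln t \<le> ln (\<rho> ^ n)" using \<rho> by (simp add: ln_realpow)
        then show ?thesis using t \<rho> by (subst (asm) ln_le_cancel_iff) auto
      qed
      moreover have "\<rho> ^ n' \<le> t"
      proof -
        have "real n' * ln \<rho> \<le> ln t" unfolding lnt using n n' ln\<rho> by (intro mult_right_mono_neg) auto
        then have "ln (\<rho> ^ n') \<le> ln t" using \<rho> by (subst ln_realpow) auto
        then show ?thesis using t \<rho> by (subst (asm) ln_le_cancel_iff) auto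
      qed
      ultimately have "G (\<rho> ^ n') \<le> G t" "G t \<le> G (\<rho> ^ n)" using mono t \<rho> by auto
      moreover have "\<bar>G (\<rho> ^ n) - L * n\<bar> \<le> e / 2 * n" "\<bar>G (\<rho> ^ n') - L * n'\<bar> \<le> e / 2 * n'"
        by (rule N[OF \<open>N \<le> n\<close>], rule N[OF \<open>N \<le> n'\<close>])
      moreover have "\<bar>L * z - L * n\<bar> \<le> \<bar>L\<bar>" "\<bar>L * z - L * n'\<bar> \<le> \<bar>L\<bar>"
      proof -
        have "\<bar>L * z - L * n\<bar> = \<bar>L\<bar> * \<bar>z - n\<bar>" by (simp add: abs_mult[symmetric] algebra_simps)
        also have "\<dots> \<le> \<bar>L\<bar> * 1" using n n' by (intro mult_left_mono) auto
        finally show "\<bar>L * z - L * n\<bar> \<le> \<bar>L\<bar>" by simp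
        have "\<bar>L * z - L * n'\<bar> = \<bar>L\<bar> * \<bar>z - n'\<bar>" by (simp add: abs_mult[symmetric] algebra_simps)
        also have "\<dots> \<le> \<bar>L\<bar> * 1" using n n' by (intro mult_left_mono) auto
        finally show "\<bar>L * z - L * n'\<bar> \<le> \<bar>L\<bar>" by simp
      qed
      moreover have "e / 2 * n \<le> e / 2 * z" "e / 2 * n' \<le> e / 2 * z + e / 2"
        using n n' e by (auto simp: algebra_simps)
      ultimately have "\<bar>G t - L * z\<bar> \<le> e / 2 * z + C" unfolding C_def using e by linarith
      moreover have "2 * C < e * z"
      proof -
        have "real M \<le> T" by (simp add: T_def)
        with M zT have "2 * C / e < z" by linarith
        then show ?thesis using e by (simp add: pos_divide_less_eq mult.commute)
      qed
      ultimately have lt: "\<bar>G t - L * z\<bar> < e * z" by linarith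
      have z0: "0 < z" using zT by linarith
      then have "G t / z - L = (G t - L * z) / z" by (simp add: field_simps)
      then have "dist (G t / z) L = \<bar>G t - L * z\<bar> / z" using z0 by (simp add: dist_real_def)
      also have "\<dots> < e" using lt z0 by (simp add: pos_divide_less_eq)
      finally show ?thesis by (simp add: z_def)
    qed
    moreover have "0 < \<rho> ^ T" using \<rho> by simp
    ultimately show "\<forall>\<^sub>F t in at_right 0. dist (G t / (ln t / ln \<rho>)) L < e"
      unfolding eventually_at_right[OF zero_less_one] by blast
  qed
  then have "((\<lambda>t. G t / (ln t / ln \<rho>) / ln \<rho>) \<longlongrightarrow> L / ln \<rho>) (at_right 0)"
    using ln\<rho> by (intro tendsto_divide) auto
  then show "((\<lambda>t. G t / ln t) \<longlongrightarrow> D) (at_right 0)" using ln\<rho> by (simp add: L_def)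
qed

text \<open>For \<open>b n = ln (P n \<Delta>\<^sub>n)\<close> and \<open>g n\<close> the logarithm of the measure of the ball of radius \<open>r_min ^ n\<close>: a bounded
shift of scale and an arbitrarily small linear error do not change the rate.\<close>

lemma rate_transfer:
  fixes g b :: "nat \<Rightarrow> real"
  assumes lower: "\<And>n. b n \<le> g n + A"
    and upper: "\<And>\<epsilon>::real. 0 < \<epsilon> \<Longrightarrow> \<exists>C. \<forall>n\<ge>1. g (n + s) \<le> b n + \<epsilon> * n + C"
  shows "(\<lambda>n. g n / n) \<longlonglongrightarrow> L \<longleftrightarrow> (\<lambda>n. b n / n) \<longlonglongrightarrow> L"
proof
  assume lim: "(\<lambda>n. g n / n) \<longlonglongrightarrow> L"
  show "(\<lambda>n. b n / n) \<longlonglongrightarrow> L"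
  proof (rule linear_rateI)
    fix \<epsilon> :: real assume \<epsilon>: "0 < \<epsilon>"
    obtain N where N: "\<And>n. n \<ge> N \<Longrightarrow> \<bar>g n - L * n\<bar> \<le> \<epsilon> / 2 * n"
      by (rule linear_rateD[OF lim, of "\<epsilon> / 2"]) (use \<epsilon> in auto)
    obtain C where C: "\<And>n. n \<ge> 1 \<Longrightarrow> g (n + s) \<le> b n + \<epsilon> / 2 * n + C"
      using upper[of "\<epsilon> / 2"] \<epsilon> by auto
    show "\<exists>C N. \<forall>n\<ge>N. \<bar>b n - L * n\<bar> \<le> \<epsilon> * n + C"
    proof (intro exI[of _ "\<bar>A\<bar> + \<bar>C\<bar> + \<bar>L * s\<bar> + \<epsilon> / 2 * s"] exI[of _ "max 1 N"] allI impI)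
      fix n :: nat assume n: "max 1 N \<le> n"
      have "\<bar>g n - L * n\<bar> \<le> \<epsilon> / 2 * n" using N n by simp
      moreover have "\<bar>g (n + s) - (L * n + L * s)\<bar> \<le> \<epsilon> / 2 * n + \<epsilon> / 2 * s"
        using N[of "n + s"] n by (simp add: algebra_simps)
      moreover have "g (n + s) \<le> b n + \<epsilon> / 2 * n + C" using C n by simp
      moreover have "0 \<le> \<epsilon> / 2 * n" "0 \<le> \<epsilon> / 2 * s" using \<epsilon> by simp_all
      moreover have "\<epsilon> * n = \<epsilon> / 2 * n + \<epsilon> / 2 * n" by simp
      ultimately show "\<bar>b n - L * n\<bar> \<le> \<epsilon> * n + (\<bar>A\<bar> + \<bar>C\<bar> + \<bar>L * s\<bar> + \<epsilon> / 2 * s)"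
        using lower[of n] by linarith
    qed
  qed
next
  assume lim: "(\<lambda>n. b n / n) \<longlonglongrightarrow> L"
  show "(\<lambda>n. g n / n) \<longlonglongrightarrow> L"
  proof (rule linear_rateI)
    fix \<epsilon> :: real assume \<epsilon>: "0 < \<epsilon>"
    obtain N where N: "\<And>n. n \<ge> N \<Longrightarrow> \<bar>b n - L * n\<bar> \<le> \<epsilon> / 2 * n"
      by (rule linear_rateD[OF lim, of "\<epsilon> / 2"]) (use \<epsilon> in auto)
    obtain C where C: "\<And>n. n \<ge> 1 \<Longrightarrow> g (n + s) \<le> b n + \<epsilon> / 2 * n + C"
      using upper[of "\<epsilon> / 2"] \<epsilon> by auto
    show "\<exists>C N. \<forall>n\<ge>N. \<bar>g n - L * n\<bar> \<le> \<epsilon> * n + C"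
    proof (intro exI[of _ "\<bar>A\<bar> + \<bar>C\<bar> + \<bar>L * s\<bar>"] exI[of _ "max 1 N + s"] allI impI)
      fix n :: nat assume n: "max 1 N + s \<le> n"
      define i where "i = n - s"
      have i: "n = i + s" "max 1 N \<le> i" using n by (auto simp: i_def)
      have "\<bar>b n - L * n\<bar> \<le> \<epsilon> / 2 * n" using N n by simp
      moreover have "\<bar>b i - L * i\<bar> \<le> \<epsilon> / 2 * i" using N i by simp
      moreover have "L * n = L * i + L * s" "\<epsilon> * n = \<epsilon> / 2 * n + \<epsilon> / 2 * n"
        unfolding i(1) by (simp_all add: algebra_simps)
      moreover have "g n \<le> b i + \<epsilon> / 2 * i + C" unfolding i(1) using C i(2) by simp
      moreover have "\<epsilon> / 2 * i \<le> \<epsilon> / 2 * n" "0 \<le> \<epsilon> / 2 * i" using \<epsilon> i(1) by simp_all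
      ultimately show "\<bar>g n - L * n\<bar> \<le> \<epsilon> * n + (\<bar>A\<bar> + \<bar>C\<bar> + \<bar>L * s\<bar>)"
        using lower[of n] by linarith
    qed
  qed
qed

context net_interval_measure begin

lemma space_\<mu>: "space \<mu> = UNIV"
  using sets_eq_imp_space_eq[OF sets_\<mu>] by simp

lemma S_measurable: "S j \<in> borel_measurable borel"
proof -
  have "S j = (\<lambda>x. r j * x + d j)" by (simp add: fun_eq_iff S_def)
  then show ?thesis by simp
qed

lemma S_word_measurable: "S_word \<sigma> \<in> borel_measurable borel"
proof -
  have eq: "S_word \<sigma> = (\<lambda>x. r_word \<sigma> * x + S_word \<sigma> 0)" using S_word_affine by blast
  show ?thesis by (subst eq) simp
qed

lemma S_word_vimage_borel: "A \<in> sets borel \<Longrightarrow> S_word \<sigma> -` A \<in> sets borel"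
  using measurable_sets[OF S_word_measurable] by simp

lemma measure_self_similar:
  assumes "A \<in> sets borel"
  shows "measure \<mu> A = (\<Sum>j\<le>k. p j * measure \<mu> (S j -` A))"
proof -
  have "measure (distr \<mu> borel (S j)) A = measure \<mu> (S j -` A)" for j
  proof -
    have "S j \<in> measurable \<mu> borel"
      using S_measurable[of j] measurable_cong_sets[OF sets_\<mu> refl] by blast
    then show ?thesis using assms by (simp add: measure_distr space_\<mu>)
  qed
  then show ?thesis using \<mu>_self_similar[OF assms] by simp
qed

lemma measure_cut:
  assumes "A \<in> sets borel" "0 < t"
  shows "measure \<mu> A = (\<Sum>\<sigma>\<in>cut t. p_word \<sigma> * measure \<mu> (S_word \<sigma> -` A))"
proof -
  have "p_word \<sigma> * measure \<mu> (S_word \<sigma> -` A) =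
    (\<Sum>j\<le>k. p_word (\<sigma> @ [j]) * measure \<mu> (S_word (\<sigma> @ [j]) -` A))" for \<sigma>
  proof -
    have "S_word (\<sigma> @ [j]) -` A = S j -` (S_word \<sigma> -` A)" for j by auto
    then show ?thesis
      using measure_self_similar[OF S_word_vimage_borel[OF assms(1)], of \<sigma>]
      by (simp add: sum_distrib_left mult.assoc)
  qed
  from sum_cut[OF assms(2) this] show ?thesis by (simp add: vimage_def)
qed

definition outside :: "real \<Rightarrow> real set"
  where "outside t = {..<-t} \<union> {1 + t<..}"

text \<open>Pulling back by the contractions pushes the complement of a neighbourhood of the unit interval further out,
without decreasing its measure; so the measure is bounded by that of sets shrinking to the empty set.\<close>

lemma measure_outside: 
  assumes "0 < t"
  shows "measure \<mu> (outside t) = 0"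
proof -
  obtain R where R: "0 < R" "R < 1" "\<And>j. j \<le> k \<Longrightarrow> \<bar>r j\<bar> \<le> R"
    by (rule r_max_exists) (rule that)
  have sets: "outside s \<in> sets \<mu>" for s unfolding sets_\<mu> outside_def by simp
  have vimage: "S j -` outside s \<subseteq> outside (s / R)" if "0 < s" "j \<le> k" for s j
  proof
    fix x assume x: "x \<in> S j -` outside s"
    define y where "y = max 0 (min 1 x)"
    have y: "S j y \<in> {0..1}" using that by (intro S_unit) (auto simp: y_def)
    have e: "S j x - S j y = r j * (x - y)" by (simp add: S_def algebra_simps)
    have "s < \<bar>S j x - S j y\<bar>" using x y by (auto simp: outside_def)
    also have "\<dots> \<le> R * \<bar>x - y\<bar>" unfolding e abs_mult using R(3)[OF that(2)] by (intro mult_right_mono) auto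
    finally have "s / R < \<bar>x - y\<bar>" using R(1) by (simp add: pos_divide_less_eq mult.commute)
    moreover have "0 < s / R" using that R by simp
    ultimately show "x \<in> outside (s / R)" by (auto simp: outside_def y_def max_def min_def split: if_splits)
  qed
  have step: "measure \<mu> (outside s) \<le> measure \<mu> (outside (s / R))" if "0 < s" for s
  proof -
    have "measure \<mu> (outside s) = (\<Sum>j\<le>k. p j * measure \<mu> (S j -` outside s))"
      using sets by (intro measure_self_similar) (simp add: sets_\<mu>)
    also have "\<dots> \<le> (\<Sum>j\<le>k. p j * measure \<mu> (outside (s / R)))"
      using vimage[OF that] p_pos sets by (intro sum_mono mult_left_mono finite_measure_mono) (auto intro: less_imp_le)
    also have "\<dots> = measure \<mu> (outside (s / R))" using p_sum by (simp add: sum_distrib_right[symmetric])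
    finally show ?thesis .
  qed
  have iter: "measure \<mu> (outside t) \<le> measure \<mu> (outside (t / R ^ n))" for n
  proof (induction n)
    case (Suc n)
    have "measure \<mu> (outside (t / R ^ n)) \<le> measure \<mu> (outside (t / R ^ n / R))"
      using assms R(1) by (intro step) simp
    also have "t / R ^ n / R = t / R ^ Suc n" by (simp add: mult.commute)
    finally show ?case using Suc by linarith
  qed simp
  have "decseq (\<lambda>n. outside (t / R ^ n))"
  proof (rule decseq_SucI)
    fix n
    have "t / R ^ n \<le> t / R ^ Suc n"
      using assms R by (intro divide_left_mono) (auto simp: mult_left_le_one_le)
    then show "outside (t / R ^ Suc n) \<subseteq> outside (t / R ^ n)" by (auto simp: outside_def)
  qed
  then have "(\<lambda>n. measure \<mu> (outside (t / R ^ n))) \<longlonglongrightarrow> measure \<mu> (\<Inter>n. outside (t / R ^ n))"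
    using sets by (intro finite_Lim_measure_decseq) auto
  moreover have "(\<Inter>n. outside (t / R ^ n)) = {}"
  proof -
    have "\<exists>n. x \<notin> outside (t / R ^ n)" for x
    proof -
      obtain n where n: "R ^ n < t / (\<bar>x\<bar> + 1)"
        using real_arch_pow_inv[of "t / (\<bar>x\<bar> + 1)" R] assms R by auto
      then have "R ^ n * (\<bar>x\<bar> + 1) < t" by (simp add: pos_less_divide_eq add_nonneg_pos)
      then have "\<bar>x\<bar> + 1 < t / R ^ n" using R(1) by (simp add: pos_less_divide_eq mult.commute)
      then have "x \<notin> outside (t / R ^ n)" by (auto simp: outside_def)
      then show ?thesis ..
    qed
    then show ?thesis by blast
  qed
  ultimately have "(\<lambda>n. measure \<mu> (outside (t / R ^ n))) \<longlonglongrightarrow> 0" by simp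
  then have "measure \<mu> (outside t) \<le> 0" using iter by (intro LIMSEQ_le_const) auto
  then show ?thesis by (simp add: measure_le_0_iff)
qed

lemma measure_unit_interval: "measure \<mu> {0..1} = 1"
proof -
  let ?A = "\<lambda>n::nat. {- (1 / Suc n)..1 + 1 / Suc n} :: real set"
  have "measure \<mu> (?A n) = 1" for n
  proof -
    have "?A n = space \<mu> - outside (1 / Suc n)" by (auto simp: space_\<mu> outside_def)
    moreover have "outside (1 / Suc n) \<in> events" by (simp add: sets_\<mu> outside_def)
    ultimately have "measure \<mu> (?A n) = 1 - measure \<mu> (outside (1 / Suc n))" by (simp add: prob_compl)
    then show ?thesis using measure_outside[of "1 / Suc n"] by simp
  qed
  moreover have "decseq ?A"
  proof (rule decseq_SucI)
    fix n :: nat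
    have "1 / real (Suc (Suc n)) \<le> 1 / real (Suc n)" by (intro divide_left_mono) auto
    then show "?A (Suc n) \<subseteq> ?A n" by (intro atLeastatMost_subset_iff[THEN iffD2] disjI2) auto
  qed
  then have "(\<lambda>n. measure \<mu> (?A n)) \<longlonglongrightarrow> measure \<mu> (\<Inter>n. ?A n)"
    by (intro finite_Lim_measure_decseq) (auto simp: sets_\<mu>)
  moreover have "(\<Inter>n. ?A n) = {0..1}"
  proof (intro equalityI subsetI)
    fix x assume x: "x \<in> (\<Inter>n. ?A n)"
    have lim: "(\<lambda>n. 1 / real (Suc n)) \<longlonglongrightarrow> 0" by (rule LIMSEQ_Suc[OF lim_1_over_n])
    have "- x \<le> 1 / real (Suc n)" "x - 1 \<le> 1 / real (Suc n)" for n
    proof -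
      have "x \<in> ?A n" using x by blast
      then show "- x \<le> 1 / real (Suc n)" "x - 1 \<le> 1 / real (Suc n)" by auto
    qed
    then have "- x \<le> 0" "x - 1 \<le> 0" using LIMSEQ_le_const[OF lim] by blast+
    then show "x \<in> {0..1}" by simp
  next
    fix x :: real assume x: "x \<in> {0..1}"
    have "0 < 1 / real (Suc n)" for n by simp
    then have "- (1 / real (Suc n)) \<le> x" "x \<le> 1 + 1 / real (Suc n)" for n
      using x by (smt (verit) atLeastAtMost_iff)+
    then show "x \<in> (\<Inter>n. ?A n)" by simp
  qed
  ultimately show ?thesis by (simp add: LIMSEQ_const_iff)
qed

lemma measure_disjoint_unit:
  assumes "A \<in> sets borel" "A \<inter> {0..1} = {}"
  shows "measure \<mu> A = 0"
proof -
  have "measure \<mu> (A \<union> {0..1}) = measure \<mu> A + measure \<mu> {0..1}"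
    using assms by (intro finite_measure_Union) (auto simp: sets_\<mu>)
  then show ?thesis using measure_unit_interval prob_le_1[of "A \<union> {0..1}"] by (simp add: measure_le_0_iff)
qed

lemma measure_ge_p_word:
  assumes "A \<in> sets borel" "\<sigma> \<in> \<Lambda> n" "S_word \<sigma> ` {0..1} \<subseteq> A"
  shows "p_word \<sigma> \<le> measure \<mu> A"
proof -
  have "{0..1} \<subseteq> S_word \<sigma> -` A" using assms(3) by blast
  then have "measure \<mu> {0..1} \<le> measure \<mu> (S_word \<sigma> -` A)"
    using S_word_vimage_borel[OF assms(1)] by (intro finite_measure_mono) (simp_all add: sets_\<mu>)
  then have "p_word \<sigma> * 1 \<le> p_word \<sigma> * measure \<mu> (S_word \<sigma> -` A)"
    using p_word_\<Lambda>_pos[OF assms(2)] measure_unit_interval by (intro mult_left_mono) auto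
  also have "\<dots> \<le> (\<Sum>\<tau>\<in>\<Lambda> n. p_word \<tau> * measure \<mu> (S_word \<tau> -` A))"
    using p_word_\<Lambda>_pos by (intro member_le_sum assms finite_\<Lambda>) (auto intro!: mult_nonneg_nonneg intro: less_imp_le)
  also have "\<dots> = measure \<mu> A" unfolding \<Lambda>_eq_cut by (rule measure_cut[OF assms(1), symmetric]) simp
  finally show ?thesis by simp
qed

text \<open>Pulled back by a covering word, \<open>\<Delta>\<close> has length bounded below and so contains the image of one of the
finitely many words of a fixed generation.\<close>

lemma measure_net_interval_lower:
  obtains c where "0 < c" "\<And>n \<Delta>. \<Delta> \<in> net_intervals n \<Longrightarrow> c * P n \<Delta> \<le> measure \<mu> (cint \<Delta>)"
proof -
  obtain c0 where c0: "0 < c0" "\<And>n \<Delta>. \<Delta> \<in> net_intervals n \<Longrightarrow> c0 * r_min ^ n \<le> snd \<Delta> - fst \<Delta>"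
    by (rule net_interval_length_lower) (rule that)
  obtain s where s: "r_min ^ s < c0 / 2" using real_arch_pow_inv[of "c0 / 2" r_min] c0(1) r_min_bounds by auto
  define c where "c = Min (p_word ` \<Lambda> s)"
  have fin: "finite (p_word ` \<Lambda> s)" using finite_\<Lambda> by simp
  have "\<Lambda> s \<noteq> {}" using cut_covers[of "r_min ^ s" 0] unfolding \<Lambda>_eq_cut by auto
  then have "c \<in> p_word ` \<Lambda> s" unfolding c_def using fin by (intro Min_in) auto
  then obtain \<omega> where "c = p_word \<omega>" "\<omega> \<in> \<Lambda> s" by (rule imageE)
  then have cpos: "0 < c" using p_word_\<Lambda>_pos by simp
  have "c * P n \<Delta> \<le> measure \<mu> (cint \<Delta>)" if \<Delta>: "\<Delta> \<in> net_intervals n" for n \<Delta>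
  proof -
    note q = net_interval_props[OF \<Delta>]
    have low: "c \<le> measure \<mu> (S_word \<sigma> -` cint \<Delta>)" if \<sigma>: "\<sigma> \<in> covering_words n \<Delta>" for \<sigma>
    proof -
      have \<sigma>': "\<sigma> \<in> \<Lambda> n" "lo \<sigma> \<le> fst \<Delta>" "snd \<Delta> \<le> hi \<sigma>" using \<sigma> by (auto simp: covering_words_iff[OF \<Delta>])
      define x where "x = (fst \<Delta> + snd \<Delta>) / 2"
      have "x \<in> S_word \<sigma> ` {0..1}" using \<sigma>' q unfolding S_word_image by (simp add: x_def)
      then obtain y where y: "y \<in> {0..1}" "x = S_word \<sigma> y" by blast
      obtain \<omega> where \<omega>: "\<omega> \<in> \<Lambda> s" "y \<in> S_word \<omega> ` {0..1}"
        using cut_covers[of "r_min ^ s" y] y(1) by (auto simp: \<Lambda>_eq_cut)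
      have "x \<in> S_word (\<sigma> @ \<omega>) ` {0..1}" using y \<omega>(2) by auto
      then have x: "lo (\<sigma> @ \<omega>) \<le> x" "x \<le> hi (\<sigma> @ \<omega>)" unfolding S_word_image by auto
      have "hi (\<sigma> @ \<omega>) - lo (\<sigma> @ \<omega>) \<le> r_min ^ n * r_min ^ s"
        unfolding hi_minus_lo r_word_append abs_mult
        using r_word_\<Lambda>(1)[OF \<sigma>'(1)] r_word_\<Lambda>(1)[OF \<omega>(1)] by (intro mult_mono) auto
      also have "\<dots> \<le> r_min ^ n * (c0 / 2)" using s by (intro mult_left_mono) auto
      also have "\<dots> \<le> (snd \<Delta> - fst \<Delta>) / 2" using c0(2)[OF \<Delta>] by (simp add: mult.commute)
      finally have "S_word (\<sigma> @ \<omega>) ` {0..1} \<subseteq> cint \<Delta>"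
        using x unfolding S_word_image x_def by auto
      then have "S_word \<omega> ` {0..1} \<subseteq> S_word \<sigma> -` cint \<Delta>" by auto
      then have "p_word \<omega> \<le> measure \<mu> (S_word \<sigma> -` cint \<Delta>)"
        by (intro measure_ge_p_word[OF S_word_vimage_borel \<omega>(1)]) auto
      moreover have "c \<le> p_word \<omega>" unfolding c_def using fin \<omega>(1) by (intro Min_le) auto
      ultimately show ?thesis by linarith
    qed
    have "c * P n \<Delta> = (\<Sum>\<sigma>\<in>covering_words n \<Delta>. p_word \<sigma> * c)"
      by (simp add: P_def sum_distrib_left mult.commute)
    also have "\<dots> \<le> (\<Sum>\<sigma>\<in>covering_words n \<Delta>. p_word \<sigma> * measure \<mu> (S_word \<sigma> -` cint \<Delta>))"
    proof (rule sum_mono)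
      fix \<sigma> assume \<sigma>: "\<sigma> \<in> covering_words n \<Delta>"
      then have "0 \<le> p_word \<sigma>" using p_word_\<Lambda>_pos[OF subsetD[OF covering_words_\<Lambda>]] by (intro less_imp_le) blast
      with low[OF \<sigma>] show "p_word \<sigma> * c \<le> p_word \<sigma> * measure \<mu> (S_word \<sigma> -` cint \<Delta>)" by (rule mult_left_mono)
    qed
    also have "\<dots> \<le> (\<Sum>\<sigma>\<in>\<Lambda> n. p_word \<sigma> * measure \<mu> (S_word \<sigma> -` cint \<Delta>))"
      using p_word_\<Lambda>_pos by (intro sum_mono2 finite_\<Lambda> covering_words_\<Lambda>) (auto intro!: mult_nonneg_nonneg intro: less_imp_le)
    also have "\<dots> = measure \<mu> (cint \<Delta>)" unfolding \<Lambda>_eq_cut by (rule measure_cut[symmetric]) simp_all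
    finally show ?thesis .
  qed
  with cpos show ?thesis by (rule that)
qed

lemma sum_covering_words_le:
  assumes X: "X \<subseteq> covering_words n \<Delta>'" and le: "P n \<Delta>' \<le> B"
  shows "(\<Sum>\<sigma>\<in>X. p_word \<sigma>) \<le> B"
proof -
  have "(\<Sum>\<sigma>\<in>X. p_word \<sigma>) \<le> P n \<Delta>'"
    unfolding P_def
  proof (rule sum_mono2[OF finite_covering_words X])
    fix \<sigma> assume "\<sigma> \<in> covering_words n \<Delta>' - X"
    then show "0 \<le> p_word \<sigma>" using p_word_\<Lambda>_pos[OF subsetD[OF covering_words_\<Lambda>]] less_imp_le by blast
  qed
  with le show ?thesis by linarith
qed

text \<open>A word whose image meets the ball covers \<open>\<Delta>\<close>, or the net interval to its left, or the one to its right,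
because \<open>\<delta>\<close> is smaller than the length of each of these. Each of the three contributes at most \<open>B\<close>.\<close>

lemma measure_ball_upper:
  assumes len: "\<And>\<Delta>. \<Delta> \<in> net_intervals n \<Longrightarrow> \<delta> < snd \<Delta> - fst \<Delta>"
    and \<Delta>: "\<Delta> \<in> net_intervals n" "x \<in> cint \<Delta>"
    and B: "P n \<Delta> \<le> B" "\<And>\<Delta>'. \<Delta>' \<in> net_intervals n \<Longrightarrow> adjacent \<Delta>' \<Delta> \<Longrightarrow> P n \<Delta>' \<le> B"
  shows "measure \<mu> {x - \<delta>..x + \<delta>} \<le> 3 * B"
proof -
  note q = net_interval_props[OF \<Delta>(1)]
  have B0: "0 \<le> B" using P_pos[OF \<Delta>(1)] B(1) by linarith
  define L where "L = {\<sigma> \<in> \<Lambda> n. x - \<delta> \<le> hi \<sigma> \<and> hi \<sigma> \<le> fst \<Delta>}"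
  define R where "R = {\<sigma> \<in> \<Lambda> n. lo \<sigma> \<le> x + \<delta> \<and> snd \<Delta> \<le> lo \<sigma>}"
  have lh: "lo \<sigma> < hi \<sigma>" "0 \<le> lo \<sigma>" "hi \<sigma> \<le> 1" if "\<sigma> \<in> \<Lambda> n" for \<sigma>
    using that lo_less_hi lo_hi_unit \<Lambda>_words by blast+
  have sumL: "(\<Sum>\<sigma>\<in>L. p_word \<sigma>) \<le> B"
  proof (cases "L = {}")
    case False
    then obtain \<sigma>0 where "\<sigma>0 \<in> L" by blast
    then have "0 < fst \<Delta>" using lh by (force simp: L_def)
    then obtain a where a: "(a, fst \<Delta>) \<in> net_intervals n"
      using net_interval_left[OF zero_one_endpoints(1) q(1)] by blast
    have "\<sigma> \<in> covering_words n (a, fst \<Delta>)" if "\<sigma> \<in> L" for \<sigma>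
    proof (rule covering_words_overlap[OF a])
      show "\<sigma> \<in> \<Lambda> n" using that by (simp add: L_def)
      show "lo \<sigma> < snd (a, fst \<Delta>)" using lh(1)[of \<sigma>] that by (simp add: L_def)
      show "fst (a, fst \<Delta>) < hi \<sigma>" using len[OF a] that \<Delta>(2) by (simp add: L_def)
    qed
    then show ?thesis using B(2)[OF a] by (intro sum_covering_words_le[where \<Delta>' = "(a, fst \<Delta>)"]) (auto simp: adjacent_def)
  qed (use B0 in simp)
  have sumR: "(\<Sum>\<sigma>\<in>R. p_word \<sigma>) \<le> B"
  proof (cases "R = {}")
    case False
    then obtain \<sigma>0 where "\<sigma>0 \<in> R" by blast
    then have "snd \<Delta> < 1" using lh by (force simp: R_def)
    then obtain b where b: "(snd \<Delta>, b) \<in> net_intervals n"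
      using net_interval_right[OF q(2) zero_one_endpoints(2)] by blast
    have "\<sigma> \<in> covering_words n (snd \<Delta>, b)" if "\<sigma> \<in> R" for \<sigma>
    proof (rule covering_words_overlap[OF b])
      show "\<sigma> \<in> \<Lambda> n" using that by (simp add: R_def)
      show "fst (snd \<Delta>, b) < hi \<sigma>" using lh(1)[of \<sigma>] that by (simp add: R_def)
      show "lo \<sigma> < snd (snd \<Delta>, b)" using len[OF b] that \<Delta>(2) by (simp add: R_def)
    qed
    then show ?thesis using B(2)[OF b] by (intro sum_covering_words_le[where \<Delta>' = "(snd \<Delta>, b)"]) (auto simp: adjacent_def)
  qed (use B0 in simp)
  have sumC: "(\<Sum>\<sigma>\<in>covering_words n \<Delta>. p_word \<sigma>) \<le> B" using B(1) by (simp add: P_def)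
  let ?I = "\<lambda>A \<sigma>. if \<sigma> \<in> A then p_word \<sigma> else 0"
  have point: "p_word \<sigma> * measure \<mu> (S_word \<sigma> -` {x - \<delta>..x + \<delta>}) \<le> ?I (covering_words n \<Delta>) \<sigma> + ?I L \<sigma> + ?I R \<sigma>"
    if \<sigma>: "\<sigma> \<in> \<Lambda> n" for \<sigma>
  proof -
    have p0: "0 \<le> p_word \<sigma>" using p_word_\<Lambda>_pos[OF \<sigma>] by simp
    show ?thesis
    proof (cases "x - \<delta> \<le> hi \<sigma> \<and> lo \<sigma> \<le> x + \<delta>")
      case True
      have "\<sigma> \<in> covering_words n \<Delta> \<or> \<sigma> \<in> L \<or> \<sigma> \<in> R"
      proof (cases "lo \<sigma> < snd \<Delta> \<and> fst \<Delta> < hi \<sigma>")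
        case True
        then show ?thesis using covering_words_overlap[OF \<Delta>(1) \<sigma>] by simp
      qed (use True \<sigma> in \<open>auto simp: L_def R_def\<close>)
      moreover have "p_word \<sigma> * measure \<mu> (S_word \<sigma> -` {x - \<delta>..x + \<delta>}) \<le> p_word \<sigma>"
        using p0 prob_le_1 by (intro mult_left_le) auto
      ultimately show ?thesis using p0 by auto
    next
      case False
      have "{x - \<delta>..x + \<delta>} \<inter> S_word \<sigma> ` {0..1} = {}" using False unfolding S_word_image by auto
      then have "S_word \<sigma> -` {x - \<delta>..x + \<delta>} \<inter> {0..1} = {}" by blast
      then have "measure \<mu> (S_word \<sigma> -` {x - \<delta>..x + \<delta>}) = 0"
        by (intro measure_disjoint_unit S_word_vimage_borel) auto
      then show ?thesis using p0 by simp
    qed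
  qed
  have "measure \<mu> {x - \<delta>..x + \<delta>} = (\<Sum>\<sigma>\<in>\<Lambda> n. p_word \<sigma> * measure \<mu> (S_word \<sigma> -` {x - \<delta>..x + \<delta>}))"
    unfolding \<Lambda>_eq_cut by (rule measure_cut) simp_all
  also have "\<dots> \<le> (\<Sum>\<sigma>\<in>\<Lambda> n. ?I (covering_words n \<Delta>) \<sigma> + ?I L \<sigma> + ?I R \<sigma>)"
    using point by (rule sum_mono)
  also have "\<dots> = (\<Sum>\<sigma>\<in>covering_words n \<Delta>. p_word \<sigma>) + (\<Sum>\<sigma>\<in>L. p_word \<sigma>) + (\<Sum>\<sigma>\<in>R. p_word \<sigma>)"
  proof -
    have "(\<Sum>\<sigma>\<in>\<Lambda> n. ?I A \<sigma>) = (\<Sum>\<sigma>\<in>A. p_word \<sigma>)" if "A \<subseteq> \<Lambda> n" for A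
      using sum.inter_restrict[OF finite_\<Lambda>, of p_word n A] that by (simp add: inf.absorb2)
    moreover have "L \<subseteq> \<Lambda> n" "R \<subseteq> \<Lambda> n" by (auto simp: L_def R_def)
    ultimately show ?thesis using covering_words_\<Lambda> by (simp add: sum.distrib)
  qed
  also have "\<dots> \<le> 3 * B" using sumL sumR sumC by linarith
  finally show ?thesis .
qed

text \<open>Comparability enters here: for every \<open>\<epsilon> > 0\<close> it bounds \<open>P\<close> at the neighbours of \<open>\<Delta> n\<close> by \<open>exp \<epsilon> ^ n\<close> times
\<open>P n (\<Delta> n)\<close>, up to a constant, which is the error that \<open>rate_transfer\<close> tolerates.\<close>

lemma has_local_dim_iff:
  assumes comp: comparable and \<Delta>: "\<And>n. \<Delta> n \<in> net_intervals n" "\<And>n. x \<in> cint (\<Delta> n)"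
  shows "has_local_dim \<mu> x D \<longleftrightarrow> (\<lambda>n. ln (P n (\<Delta> n)) / real n) \<longlonglongrightarrow> D * ln r_min"
proof -
  let ?M = "\<lambda>t. measure \<mu> {x - t..x + t}"
  obtain c where c: "0 < c" "\<And>n \<Delta>. \<Delta> \<in> net_intervals n \<Longrightarrow> c * P n \<Delta> \<le> measure \<mu> (cint \<Delta>)"
    by (rule measure_net_interval_lower) (rule that)
  obtain c0 where c0: "0 < c0" "\<And>n \<Delta>. \<Delta> \<in> net_intervals n \<Longrightarrow> c0 * r_min ^ n \<le> snd \<Delta> - fst \<Delta>"
    by (rule net_interval_length_lower) (rule that)
  obtain s where s: "r_min ^ s < c0" using real_arch_pow_inv[of c0 r_min] c0(1) r_min_bounds by auto
  have mono: "?M t \<le> ?M t'" if "t \<le> t'" for t t'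
    using that by (intro finite_measure_mono) (auto simp: sets_\<mu>)
  have low: "c * P n (\<Delta> n) \<le> ?M (r_min ^ n)" for n
  proof -
    have "cint (\<Delta> n) \<subseteq> {x - r_min ^ n..x + r_min ^ n}"
      using net_interval_length[OF \<Delta>(1), of n] \<Delta>(2)[of n] by auto
    then have "measure \<mu> (cint (\<Delta> n)) \<le> ?M (r_min ^ n)"
      by (intro finite_measure_mono) (simp_all add: sets_\<mu>)
    with c(2)[OF \<Delta>(1), of n] show ?thesis by linarith
  qed
  have pos: "0 < ?M t" if t: "0 < t" for t
  proof -
    obtain n where "r_min ^ n < t" using real_arch_pow_inv[OF t] r_min_bounds by auto
    then have "?M (r_min ^ n) \<le> ?M t" by (intro mono) simp
    moreover have "0 < c * P n (\<Delta> n)" using c(1) P_pos[OF \<Delta>(1)] by simp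
    ultimately show ?thesis using low[of n] by linarith
  qed
  have "has_local_dim \<mu> x D \<longleftrightarrow> (\<lambda>n. ln (?M (r_min ^ n)) / real n) \<longlonglongrightarrow> D * ln r_min"
    unfolding has_local_dim_def
  proof (rule local_rate_iff[OF r_min_bounds])
    fix t t' :: real assume "0 < t" "t \<le> t'"
    then show "ln (?M t) \<le> ln (?M t')" using mono[of t t'] pos[of t] pos[of t'] by simp
  qed
  also have "\<dots> \<longleftrightarrow> (\<lambda>n. ln (P n (\<Delta> n)) / real n) \<longlonglongrightarrow> D * ln r_min"
  proof (rule rate_transfer[where s = s and A = "- ln c"])
    fix n
    have "ln (c * P n (\<Delta> n)) \<le> ln (?M (r_min ^ n))"
      using low[of n] c(1) P_pos[OF \<Delta>(1), of n] pos[of "r_min ^ n"] by simp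
    then show "ln (P n (\<Delta> n)) \<le> ln (?M (r_min ^ n)) + - ln c"
      using c(1) P_pos[OF \<Delta>(1), of n] by (simp add: ln_mult)
  next
    fix \<epsilon> :: real assume "0 < \<epsilon>"
    then have "1 < exp \<epsilon>" by simp
    then obtain C where C: "0 < C" "\<And>n \<Delta>1 \<Delta>2. 1 \<le> n \<Longrightarrow> \<Delta>1 \<in> net_intervals n \<Longrightarrow> \<Delta>2 \<in> net_intervals n \<Longrightarrow>
        adjacent \<Delta>1 \<Delta>2 \<Longrightarrow> P n \<Delta>1 \<le> C * exp \<epsilon> ^ n * P n \<Delta>2"
      using comp unfolding comparable_def by blast
    define C' where "C' = max 1 C"
    have "ln (?M (r_min ^ (n + s))) \<le> ln (P n (\<Delta> n)) + \<epsilon> * n + ln (3 * C')" if n: "1 \<le> n" for n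
    proof -
      let ?B = "C' * exp \<epsilon> ^ n * P n (\<Delta> n)"
      have Pp: "0 < P n (\<Delta> n)" by (rule P_pos[OF \<Delta>(1)])
      have "r_min ^ (n + s) < snd \<Delta>' - fst \<Delta>'" if "\<Delta>' \<in> net_intervals n" for \<Delta>'
      proof -
        have "r_min ^ (n + s) < c0 * r_min ^ n" using s by (simp add: power_add)
        with c0(2)[OF that] show ?thesis by linarith
      qed
      then have "?M (r_min ^ (n + s)) \<le> 3 * ?B"
      proof (rule measure_ball_upper[OF _ \<Delta>(1,2)])
        have "1 * 1 \<le> C' * exp \<epsilon> ^ n" using \<open>1 < exp \<epsilon>\<close>
          by (intro mult_mono one_le_power) (auto simp: C'_def)
        then show "P n (\<Delta> n) \<le> ?B" using Pp by simp
        fix \<Delta>' assume "\<Delta>' \<in> net_intervals n" "adjacent \<Delta>' (\<Delta> n)"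
        then have "P n \<Delta>' \<le> C * exp \<epsilon> ^ n * P n (\<Delta> n)" using C(2)[OF n _ \<Delta>(1)] by simp
        also have "\<dots> \<le> ?B" using Pp by (intro mult_right_mono) (auto simp: C'_def)
        finally show "P n \<Delta>' \<le> ?B" .
      qed
      then have "ln (?M (r_min ^ (n + s))) \<le> ln (3 * ?B)"
        using pos[of "r_min ^ (n + s)"] by (subst ln_le_cancel_iff) auto
      also have "3 * ?B = (3 * C') * exp \<epsilon> ^ n * P n (\<Delta> n)" by simp
      also have "ln \<dots> = ln (3 * C') + \<epsilon> * n + ln (P n (\<Delta> n))"
        using Pp by (simp add: ln_mult_pos ln_realpow C'_def mult.commute)
      finally show ?thesis by linarith
    qed
    then show "\<exists>C. \<forall>n\<ge>1. ln (?M (r_min ^ (n + s))) \<le> ln (P n (\<Delta> n)) + \<epsilon> * n + C" by blast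
  qed
  finally show ?thesis .
qed

end

section \<open>Growth rates in a gluing system\<close>

text \<open>A slowly growing stage: at length \<open>L\<close> the pieces of stage \<open>J L\<close> are shorter than \<open>L\<close> by the factor \<open>J L\<close>.\<close>

lemma stage_function:
  fixes M :: "nat \<Rightarrow> nat"
  obtains J :: "nat \<Rightarrow> nat" where "\<And>L. J L * M (J L) \<le> L" "\<And>j. \<exists>L0. \<forall>L\<ge>L0. j \<le> J L"
proof
  let ?A = "\<lambda>L. {j. j \<le> L \<and> j * M j \<le> L}"
  have fin: "finite (?A L)" for L by (rule finite_subset[of _ "{..L}"]) auto
  have "Max (?A L) \<in> ?A L" for L using fin by (intro Max_in) auto
  then show "Max (?A L) * M (Max (?A L)) \<le> L" for L by simp
  have "j \<le> Max (?A L)" if "max j (j * M j) \<le> L" for j L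
    using fin that by (intro Max_ge) auto
  then show "\<exists>L0. \<forall>L\<ge>L0. j \<le> Max (?A L)" for j by blast
qed

text \<open>Elements with a length and a weight, both additive up to a bounded error under an operation \<open>glue\<close>. In the
application the elements are exact words inside \<open>Ds\<close>, and the weight is the logarithm of a covering probability.\<close>

locale gluing_system =
  fixes W :: "'a set" and l :: "'a \<Rightarrow> nat" and h :: "'a \<Rightarrow> real" and glue :: "'a \<Rightarrow> 'a \<Rightarrow> 'a"
    and C B :: real
  assumes glue_closed: "u \<in> W \<Longrightarrow> v \<in> W \<Longrightarrow> glue u v \<in> W"
    and glue_length: "u \<in> W \<Longrightarrow> v \<in> W \<Longrightarrow> l u + l v \<le> l (glue u v)"
      "u \<in> W \<Longrightarrow> v \<in> W \<Longrightarrow> l (glue u v) \<le> l u + l v + C"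
    and glue_weight: "u \<in> W \<Longrightarrow> v \<in> W \<Longrightarrow> \<bar>h (glue u v) - h u - h v\<bar> \<le> C"
    and weight_bound: "u \<in> W \<Longrightarrow> \<bar>h u\<bar> \<le> B * (l u + 1)"
    and lengths_unbounded: "\<exists>u\<in>W. j \<le> l u"
begin

definition rate_below :: "real \<Rightarrow> bool"
  where "rate_below s \<longleftrightarrow> (\<forall>\<epsilon>>0. \<forall>j. \<exists>u\<in>W. j \<le> l u \<and> h u \<le> (s + \<epsilon>) * l u)"

definition rate_above :: "real \<Rightarrow> bool"
  where "rate_above s \<longleftrightarrow> (\<forall>\<epsilon>>0. \<forall>j. \<exists>u\<in>W. j \<le> l u \<and> (s - \<epsilon>) * l u \<le> h u)"

lemma C_nonneg: "0 \<le> C"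
  using glue_weight lengths_unbounded abs_ge_zero order_trans by metis

lemma B_nonneg: "0 \<le> B"
proof (rule ccontr)
  assume "\<not> 0 \<le> B"
  obtain u where u: "u \<in> W" using lengths_unbounded by blast
  have "B * (l u + 1) < 0" using \<open>\<not> 0 \<le> B\<close> by (intro mult_neg_pos) auto
  then show False using weight_bound[OF u] by linarith
qed

lemma weight_linear:
  assumes "u \<in> W" "1 \<le> l u"
  shows "\<bar>h u\<bar> \<le> 2 * B * l u"
proof -
  have "B * (real (l u) + 1) \<le> B * (2 * l u)" using assms(2) B_nonneg by (intro mult_left_mono) auto
  then show ?thesis using weight_bound[OF assms(1)] by (simp add: algebra_simps)
qed

text \<open>Glue an element of rate about at most \<open>s\<close> if the weight so far exceeds \<open>s\<close> times the length, and one of rate about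
at least \<open>s\<close> otherwise. The stage function keeps each added piece short compared with what is already there, so
an overshoot is negligible, and the bounded errors of gluing are negligible because the pieces get longer.\<close>

lemma greedy_gluing:
  fixes s :: real
  assumes below: "rate_below s" and above: "rate_above s"
  obtains \<theta> where "\<And>n. \<theta> n \<in> W" "\<And>n. \<exists>w\<in>W. \<theta> (Suc n) = glue (\<theta> n) w"
    "\<And>n. l (\<theta> n) < l (\<theta> (Suc n))"
    "\<And>\<epsilon>::real. 0 < \<epsilon> \<Longrightarrow> \<exists>A N. \<forall>n\<ge>N. \<bar>h (\<theta> n) - s * l (\<theta> n)\<bar> \<le> \<epsilon> * l (\<theta> n) + A \<and>
      l (\<theta> (Suc n)) \<le> (1 + \<epsilon>) * l (\<theta> n) + A"
proof -
  have "\<forall>j. \<exists>u. u \<in> W \<and> Suc j \<le> l u \<and> h u \<le> (s + 1 / Suc j) * l u"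
    using below unfolding rate_below_def by (metis of_nat_0_less_iff zero_less_Suc zero_less_divide_1_iff)
  then obtain \<alpha> where \<alpha>: "\<And>j. \<alpha> j \<in> W \<and> Suc j \<le> l (\<alpha> j) \<and> h (\<alpha> j) \<le> (s + 1 / Suc j) * l (\<alpha> j)"
    by metis
  have "\<forall>j. \<exists>u. u \<in> W \<and> Suc j \<le> l u \<and> (s - 1 / Suc j) * l u \<le> h u"
    using above unfolding rate_above_def by (metis of_nat_0_less_iff zero_less_Suc zero_less_divide_1_iff)
  then obtain \<beta> where \<beta>: "\<And>j. \<beta> j \<in> W \<and> Suc j \<le> l (\<beta> j) \<and> (s - 1 / Suc j) * l (\<beta> j) \<le> h (\<beta> j)"
    by metis
  obtain J where J: "\<And>L. J L * max (l (\<alpha> (J L))) (l (\<beta> (J L))) \<le> L" "\<And>j. \<exists>L0. \<forall>L\<ge>L0. j \<le> J L"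
    using stage_function[of "\<lambda>j. max (l (\<alpha> j)) (l (\<beta> j))"] by blast
  define step where "step u = (if s * l u < h u then \<alpha> (J (l u)) else \<beta> (J (l u)))" for u
  define \<theta> where "\<theta> = rec_nat (\<alpha> 0) (\<lambda>_ u. glue u (step u))"
  have \<theta>_Suc: "\<theta> (Suc n) = glue (\<theta> n) (step (\<theta> n))" and \<theta>_0: "\<theta> 0 = \<alpha> 0" for n by (simp_all add: \<theta>_def)
  have stepW: "step u \<in> W" for u using \<alpha> \<beta> by (simp add: step_def)
  have \<theta>W: "\<theta> n \<in> W" for n
    by (induction n) (use \<alpha> \<theta>_0 \<theta>_Suc glue_closed stepW in auto)
  define L where "L n = l (\<theta> n)" for n
  define w where "w n = l (step (\<theta> n))" for n
  define j where "j n = J (L n)" for n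
  define e where "e n = h (\<theta> n) - s * L n" for n
  have wj: "Suc (j n) \<le> w n" for n
    using \<alpha> \<beta> by (simp add: w_def step_def j_def L_def)
  have wL: "j n * w n \<le> L n" for n
  proof -
    have "w n \<le> max (l (\<alpha> (j n))) (l (\<beta> (j n)))" by (simp add: w_def step_def j_def L_def)
    then have "j n * w n \<le> j n * max (l (\<alpha> (j n))) (l (\<beta> (j n)))" by simp
    also have "\<dots> \<le> L n" unfolding j_def by (rule J(1))
    finally show ?thesis .
  qed
  have L_low: "L n + w n \<le> L (Suc n)" and L_up: "L (Suc n) \<le> L n + w n + C" for n
    using glue_length[OF \<theta>W stepW] by (simp_all add: L_def w_def \<theta>_Suc)
  have L_less: "L n < L (Suc n)" for n using L_low[of n] wj[of n] by simp
  have nL: "n \<le> L n" for n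
    by (induction n) (use L_less in \<open>auto intro: Suc_leI le_less_trans\<close>)
  have j_inf: "\<exists>N. \<forall>n\<ge>N. i \<le> j n" for i
  proof -
    obtain L0 where "\<forall>L\<ge>L0. i \<le> J L" using J(2) by blast
    then have "\<forall>n\<ge>L0. i \<le> j n" using nL order_trans unfolding j_def by blast
    then show ?thesis ..
  qed
  define C1 where "C1 = C + \<bar>s\<bar> * C"
  define A where "A = 1 + C1 + 2 * B + \<bar>s\<bar>"
  have C10: "0 \<le> C1" using C_nonneg by (simp add: C1_def)
  have A0: "1 \<le> A" using C10 B_nonneg by (simp add: A_def)
  \<comment> \<open>Either the error keeps its sign and grows by a small multiple of the length of the new piece, or it changes
    sign and is bounded by a multiple of that length.\<close>
  have e_step: "\<bar>e (Suc n)\<bar> \<le> max (\<bar>e n\<bar> + A * (w n / Suc (j n))) (A * w n)" for n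
  proof -
    define y where "y = h (step (\<theta> n)) - s * w n"
    have "\<bar>h (\<theta> (Suc n)) - h (\<theta> n) - h (step (\<theta> n))\<bar> \<le> C"
      unfolding \<theta>_Suc by (rule glue_weight[OF \<theta>W stepW])
    moreover have "\<bar>s * L (Suc n) - s * L n - s * w n\<bar> \<le> \<bar>s\<bar> * C"
    proof -
      have "s * L (Suc n) - s * L n - s * w n = s * (real (L (Suc n)) - L n - w n)" by (simp add: algebra_simps)
      moreover have "\<bar>real (L (Suc n)) - L n - w n\<bar> \<le> C" using L_low[of n] L_up[of n] by linarith
      ultimately show ?thesis by (simp add: abs_mult mult_left_mono)
    qed
    ultimately have d: "\<bar>e (Suc n) - e n - y\<bar> \<le> C1" unfolding e_def y_def C1_def by linarith
    have w1: "1 \<le> real (w n) / Suc (j n)" using wj[of n] by simp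
    have w2: "1 \<le> real (w n)" using wj[of n] by simp
    have yb: "\<bar>y\<bar> \<le> (2 * B + \<bar>s\<bar>) * w n"
    proof -
      have "1 \<le> l (step (\<theta> n))" using wj[of n] by (simp add: w_def)
      then have "\<bar>h (step (\<theta> n))\<bar> \<le> 2 * B * w n" unfolding w_def by (rule weight_linear[OF stepW])
      moreover have "\<bar>s * w n\<bar> = \<bar>s\<bar> * w n" by (simp add: abs_mult)
      moreover have "(2 * B + \<bar>s\<bar>) * w n = 2 * B * w n + \<bar>s\<bar> * w n" by (simp add: algebra_simps)
      ultimately show ?thesis unfolding y_def by linarith
    qed
    have c1: "C1 \<le> C1 * (w n / Suc (j n))" using mult_left_mono[OF w1 C10] by simp
    have c2: "C1 \<le> C1 * w n" using mult_left_mono[OF w2 C10] by simp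
    have A1: "C1 * (w n / Suc (j n)) + w n / Suc (j n) \<le> A * (w n / Suc (j n))"
    proof -
      have "(C1 + 1) * (w n / Suc (j n)) \<le> A * (w n / Suc (j n))"
        using B_nonneg by (intro mult_right_mono) (auto simp: A_def)
      then show ?thesis by (simp only: distrib_right mult_1)
    qed
    have A2: "C1 * w n + (2 * B + \<bar>s\<bar>) * w n \<le> A * w n"
    proof -
      have "(C1 + (2 * B + \<bar>s\<bar>)) * w n \<le> A * w n" by (intro mult_right_mono) (auto simp: A_def)
      then show ?thesis by (simp only: distrib_right)
    qed
    show ?thesis
    proof (cases "s * L n < h (\<theta> n)")
      case True
      then have "step (\<theta> n) = \<alpha> (j n)" by (simp add: step_def L_def j_def)
      then have "y \<le> w n / Suc (j n)"
        using \<alpha>[of "j n"] by (simp add: y_def w_def algebra_simps)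
      moreover have "0 < e n" using True by (simp add: e_def)
      ultimately show ?thesis using d yb c1 c2 A1 A2 by linarith
    next
      case False
      then have "step (\<theta> n) = \<beta> (j n)" by (simp add: step_def L_def j_def)
      then have "- (w n / Suc (j n)) \<le> y"
        using \<beta>[of "j n"] by (simp add: y_def w_def algebra_simps)
      moreover have "e n \<le> 0" using False by (simp add: e_def)
      ultimately show ?thesis using d yb c1 c2 A1 A2 by linarith
    qed
  qed
  have final: "\<exists>A N. \<forall>n\<ge>N. \<bar>e n\<bar> \<le> \<epsilon> * L n + A \<and> L (Suc n) \<le> (1 + \<epsilon>) * L n + A" if \<epsilon>: "0 < \<epsilon>" for \<epsilon> :: real
  proof -
    obtain i :: nat where i: "A / \<epsilon> < i" using reals_Archimedean2 by blast
    have "0 < A / \<epsilon>" using A0 \<epsilon> by simp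
    then have i0: "0 < real i" using i by linarith
    have Ai: "A / i \<le> \<epsilon>" using i i0 \<epsilon> by (simp add: pos_divide_less_eq pos_divide_le_eq mult.commute)
    obtain N where N: "\<And>n. n \<ge> N \<Longrightarrow> i \<le> j n" using j_inf by blast
    have small: "A * w n \<le> \<epsilon> * L n" "A * (w n / Suc (j n)) \<le> \<epsilon> * w n" if n: "n \<ge> N" for n
    proof -
      have jn: "real i \<le> j n" "0 < real (j n)" using N[OF n] i0 by auto
      have Aj: "A / j n \<le> \<epsilon>" using divide_left_mono[of i "real (j n)" A] jn i0 A0 Ai by simp
      have "A * w n = A / j n * (j n * w n)" using jn by simp
      also have "\<dots> \<le> A / j n * L n" using wL[of n] A0 jn by (intro mult_left_mono) (simp_all flip: of_nat_mult)
      also have "\<dots> \<le> \<epsilon> * L n" using Aj by (rule mult_right_mono) simp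
      finally show "A * w n \<le> \<epsilon> * L n" .
      have "A / Suc (j n) \<le> A / j n" using jn A0 by (intro divide_left_mono) auto
      then have "A / Suc (j n) * w n \<le> \<epsilon> * w n" using Aj by (intro mult_right_mono) auto
      then show "A * (w n / Suc (j n)) \<le> \<epsilon> * w n" by simp
    qed
    have "\<bar>e n\<bar> \<le> \<epsilon> * L n + \<bar>e N\<bar>" if "n \<ge> N" for n
      using that
    proof (induction n rule: dec_induct)
      case base
      then show ?case using \<epsilon> by simp
    next
      case (step n)
      have "\<epsilon> * L n + \<epsilon> * w n \<le> \<epsilon> * L (Suc n)"
        unfolding distrib_left[symmetric] using L_low[of n] \<epsilon> by (intro mult_left_mono) linarith+
      moreover have "0 \<le> \<epsilon> * w n" using \<epsilon> by simp
      ultimately show ?case using step.IH e_step[of n] small[OF step.hyps(1)] by linarith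
    qed
    moreover have "L (Suc n) \<le> (1 + \<epsilon>) * L n + C" if "n \<ge> N" for n
    proof -
      have "w n \<le> A * w n" using mult_right_mono[OF A0, of "real (w n)"] by simp
      then show ?thesis using small(1)[OF that] L_up[of n] by (simp add: algebra_simps)
    qed
    ultimately have "\<forall>n\<ge>N. \<bar>e n\<bar> \<le> \<epsilon> * L n + (\<bar>e N\<bar> + C) \<and> L (Suc n) \<le> (1 + \<epsilon>) * L n + (\<bar>e N\<bar> + C)"
      using C_nonneg by (smt (verit) abs_ge_zero)
    then show ?thesis by blast
  qed
  show ?thesis
  proof (rule that[OF \<theta>W])
    show "\<exists>w\<in>W. \<theta> (Suc n) = glue (\<theta> n) w" for n using \<theta>_Suc stepW by blast
    show "l (\<theta> n) < l (\<theta> (Suc n))" for n using L_less by (simp add: L_def)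
    show "\<exists>A N. \<forall>n\<ge>N. \<bar>h (\<theta> n) - s * l (\<theta> n)\<bar> \<le> \<epsilon> * l (\<theta> n) + A \<and>
      l (\<theta> (Suc n)) \<le> (1 + \<epsilon>) * l (\<theta> n) + A" if "0 < \<epsilon>" for \<epsilon> :: real
      using final[OF that] unfolding e_def L_def .
  qed
qed

lemma rate_below_half_line: "\<exists>a. \<forall>s. rate_below s \<longleftrightarrow> a \<le> s"
proof -
  let ?U = "Collect rate_below"
  have "rate_below (2 * B)"
    unfolding rate_below_def
  proof (intro allI impI)
    fix \<epsilon> :: real and j assume \<epsilon>: "0 < \<epsilon>"
    obtain u where u: "u \<in> W" "max 1 j \<le> l u" using lengths_unbounded by blast
    have "h u \<le> 2 * B * l u" using weight_linear[OF u(1)] u(2) by simp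
    moreover have "2 * B * l u \<le> (2 * B + \<epsilon>) * l u" using \<epsilon> by (intro mult_right_mono) auto
    ultimately have "h u \<le> (2 * B + \<epsilon>) * l u" by (rule order_trans)
    then show "\<exists>u\<in>W. j \<le> l u \<and> h u \<le> (2 * B + \<epsilon>) * l u" using u by (intro bexI[of _ u]) auto
  qed
  then have ne: "?U \<noteq> {}" by blast
  have low: "- (2 * B) \<le> s" if s: "rate_below s" for s
  proof (rule field_le_epsilon)
    fix \<epsilon> :: real assume "0 < \<epsilon>"
    then obtain u where u: "u \<in> W" "1 \<le> l u" "h u \<le> (s + \<epsilon>) * l u"
      using s unfolding rate_below_def by blast
    have "- (2 * B) * l u \<le> h u" using weight_linear[OF u(1,2)] by simp
    also note u(3)
    finally show "- (2 * B) \<le> s + \<epsilon>" by (rule mult_right_le_imp_le) (use u(2) in simp)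
  qed
  then have bdd: "bdd_below ?U" by (intro bdd_belowI[of ?U "- (2 * B)"]) simp
  define inf_rate where "inf_rate = Inf ?U"
  have "rate_below inf_rate"
    unfolding rate_below_def
  proof (intro allI impI)
    fix \<epsilon> :: real and j assume \<epsilon>: "0 < \<epsilon>"
    then have "inf_rate < inf_rate + \<epsilon> / 2" by simp
    then obtain s where s: "rate_below s" "s < inf_rate + \<epsilon> / 2"
      using cInf_lessD[OF ne] unfolding inf_rate_def by blast
    obtain u where u: "u \<in> W" "j \<le> l u" "h u \<le> (s + \<epsilon> / 2) * l u"
      using s(1) \<epsilon> unfolding rate_below_def by (meson half_gt_zero)
    have "(s + \<epsilon> / 2) * l u \<le> (inf_rate + \<epsilon>) * l u" using s(2) by (intro mult_right_mono) auto
    then show "\<exists>u\<in>W. j \<le> l u \<and> h u \<le> (inf_rate + \<epsilon>) * l u" using u by (intro bexI[of _ u]) auto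
  qed
  moreover have "rate_below s" if a: "rate_below a" "a \<le> s" for a s
    unfolding rate_below_def
  proof (intro allI impI)
    fix \<epsilon> :: real and j assume \<epsilon>: "0 < \<epsilon>"
    then obtain u where u: "u \<in> W" "j \<le> l u" "h u \<le> (a + \<epsilon>) * l u"
      using a(1) unfolding rate_below_def by blast
    have "(a + \<epsilon>) * l u \<le> (s + \<epsilon>) * l u" using a(2) by (intro mult_right_mono) auto
    then show "\<exists>u\<in>W. j \<le> l u \<and> h u \<le> (s + \<epsilon>) * l u" using u by (intro bexI[of _ u]) auto
  qed
  moreover have "inf_rate \<le> s" if "rate_below s" for s unfolding inf_rate_def using bdd that by (intro cInf_lower) auto
  ultimately show ?thesis by blast
qed

lemma negated: "gluing_system W l (\<lambda>u. - h u) glue C B"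
proof
  show "\<bar>- h (glue u v) - - h u - - h v\<bar> \<le> C" if "u \<in> W" "v \<in> W" for u v
    using glue_weight[OF that] by linarith
qed (use glue_closed glue_length weight_bound lengths_unbounded in auto)

lemma rate_above_half_line: "\<exists>b. \<forall>s. rate_above s \<longleftrightarrow> s \<le> b"
proof -
  interpret neg: gluing_system W l "\<lambda>u. - h u" glue C B by (rule negated)
  have eq: "rate_above s \<longleftrightarrow> neg.rate_below (- s)" for s
  proof -
    have "(s - \<epsilon>) * l u \<le> h u \<longleftrightarrow> - h u \<le> (- s + \<epsilon>) * l u" for \<epsilon> u by (simp add: algebra_simps)
    then show ?thesis unfolding rate_above_def neg.rate_below_def by simp
  qed
  obtain b where "\<And>s. neg.rate_below s \<longleftrightarrow> b \<le> s" using neg.rate_below_half_line by blast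
  then have "rate_above s \<longleftrightarrow> s \<le> - b" for s unfolding eq by (simp add: le_minus_iff)
  then show ?thesis by blast
qed

text \<open>The two conditions are closed half-lines. They overlap, as a rate that is not approached from below is exceeded
by all long elements.\<close>

lemma rates_interval: "\<exists>a b. a \<le> b \<and> {s. rate_below s \<and> rate_above s} = {a..b}"
proof -
  obtain a where a: "\<And>s. rate_below s \<longleftrightarrow> a \<le> s" using rate_below_half_line by blast
  obtain b where b: "\<And>s. rate_above s \<longleftrightarrow> s \<le> b" using rate_above_half_line by blast
  have "a \<le> b"
  proof (rule ccontr)
    assume "\<not> a \<le> b"
    define s where "s = (a + b) / 2"
    have s: "b < s" "s < a" using \<open>\<not> a \<le> b\<close> by (auto simp: s_def)
    then have "\<not> rate_below s" using a by simp
    then obtain \<epsilon> j where \<epsilon>0: "0 < \<epsilon>" "\<not> (\<exists>u\<in>W. j \<le> l u \<and> h u \<le> (s + \<epsilon>) * l u)"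
      unfolding rate_below_def by blast
    have \<epsilon>: "(s + \<epsilon>) * l u < h u" if "u \<in> W" "j \<le> l u" for u
      using \<epsilon>0 that by (meson not_le)
    have "rate_above s"
      unfolding rate_above_def
    proof (intro allI impI)
      fix \<delta> :: real and i assume \<delta>: "0 < \<delta>"
      obtain u where u: "u \<in> W" "max i j \<le> l u" using lengths_unbounded by blast
      have "(s - \<delta>) * l u \<le> (s + \<epsilon>) * l u" using \<delta> \<epsilon>0(1) by (intro mult_right_mono) auto
      also have "\<dots> \<le> h u" using \<epsilon>[OF u(1)] u(2) by simp
      finally show "\<exists>u\<in>W. i \<le> l u \<and> (s - \<delta>) * l u \<le> h u" using u by (intro bexI[of _ u]) auto
    qed
    then show False using b s by simp
  qed
  moreover have "{s. rate_below s \<and> rate_above s} = {a..b}" using a b by auto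
  ultimately show ?thesis by blast
qed

end

text \<open>In the application \<open>a n = ln (P n \<Delta>\<^sub>n)\<close> is controlled only in the generations \<open>L n + m\<close> of the glued copies.
Consecutive ones differ by an arbitrarily small proportion, so monotonicity controls the generations in between.\<close>

lemma antimono_interpolation:
  fixes a :: "nat \<Rightarrow> real" and L :: "nat \<Rightarrow> nat" and s :: real
  assumes anti: "\<And>n. a (Suc n) \<le> a n"
    and L: "\<And>n. L n < L (Suc n)"
    and rate: "\<And>\<epsilon>::real. 0 < \<epsilon> \<Longrightarrow> \<exists>A N. \<forall>n\<ge>N. \<bar>a (L n + m) - s * L n\<bar> \<le> \<epsilon> * L n + A \<and>
      L (Suc n) \<le> (1 + \<epsilon>) * L n + A"
  shows "(\<lambda>n. a n / n) \<longlonglongrightarrow> s"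
proof (rule linear_rateI)
  fix \<epsilon> :: real assume \<epsilon>: "0 < \<epsilon>"
  \<comment> \<open>The final error is \<open>(2 + \<bar>s\<bar>) * \<delta> * i\<close> up to a constant: \<open>\<bar>s\<bar>\<close> from the gap between generations and \<open>2\<close>
    from the rate at the next controlled generation, which is at most about \<open>2 * i\<close>.\<close>
  define \<delta> where "\<delta> = min 1 (\<epsilon> / (2 + \<bar>s\<bar>))"
  have \<delta>: "0 < \<delta>" "\<delta> \<le> 1" using \<epsilon> by (auto simp: \<delta>_def)
  have \<delta>\<epsilon>: "(2 + \<bar>s\<bar>) * \<delta> \<le> \<epsilon>"
  proof -
    have "(2 + \<bar>s\<bar>) * \<delta> \<le> (2 + \<bar>s\<bar>) * (\<epsilon> / (2 + \<bar>s\<bar>))" by (intro mult_left_mono) (auto simp: \<delta>_def)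
    then show ?thesis by simp
  qed
  obtain A N where A: "\<And>n. n \<ge> N \<Longrightarrow> \<bar>a (L n + m) - s * L n\<bar> \<le> \<delta> * L n + A"
      "\<And>n. n \<ge> N \<Longrightarrow> L (Suc n) \<le> (1 + \<delta>) * L n + A"
    using rate[OF \<delta>(1)] by blast
  have mono_a: "a y \<le> a x" if "x \<le> y" for x y
    using lift_Suc_antimono_le[of a, OF anti that] .
  have sm: "strict_mono L" using L by (rule strict_monoI_Suc)
  define E where "E = 2 * \<bar>A\<bar> + \<bar>s\<bar> * (\<bar>A\<bar> + m)"
  show "\<exists>C N. \<forall>n\<ge>N. \<bar>a n - s * n\<bar> \<le> \<epsilon> * n + C"
  proof (intro exI[of _ E] exI[of _ "L N + m"] allI impI)
    fix i assume i: "L N + m \<le> i"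
    define n where "n = Max {n. L n + m \<le> i}"
    have fin: "finite {n. L n + m \<le> i}"
    proof (rule finite_subset)
      show "{n. L n + m \<le> i} \<subseteq> {..i}" using strict_mono_imp_increasing[OF sm] by (auto intro: order_trans add_leD1)
    qed simp
    have "n \<in> {n. L n + m \<le> i}" unfolding n_def using fin i by (intro Max_in) auto
    then have ni: "L n + m \<le> i" by simp
    have Nn: "N \<le> n" unfolding n_def using fin i by (intro Max_ge) auto
    have iS: "i < L (Suc n) + m"
    proof (rule ccontr)
      assume "\<not> i < L (Suc n) + m"
      then have "Suc n \<le> n" unfolding n_def using fin by (intro Max_ge) (auto simp: n_def)
      then show False by simp
    qed
    have 1: "a (L (Suc n) + m) \<le> a i" "a i \<le> a (L n + m)" using mono_a iS ni by auto
    have Li: "real (L n) + m \<le> i" "real i \<le> L (Suc n) + m" using ni iS by linarith+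
    have L\<delta>: "\<delta> * L n \<le> \<delta> * i" using Li \<delta> by (intro mult_left_mono) auto
    have LS: "real (L (Suc n)) \<le> L n + \<delta> * L n + A" using A(2)[OF Nn] by (simp add: algebra_simps)
    have \<delta>i: "0 \<le> \<delta> * i" using \<delta> by simp
    have gap: "\<bar>real i - L n\<bar> \<le> \<delta> * i + \<bar>A\<bar> + m" "\<bar>real (L (Suc n)) - i\<bar> \<le> \<delta> * i + \<bar>A\<bar> + m"
      using Li LS L\<delta> \<delta>i by linarith+
    have sgap: "\<bar>s * i - s * y\<bar> \<le> \<bar>s\<bar> * (\<delta> * i) + \<bar>s\<bar> * (\<bar>A\<bar> + m)"
      if "\<bar>real i - y\<bar> \<le> \<delta> * i + \<bar>A\<bar> + m" for y :: real
    proof -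
      have "\<bar>s * i - s * y\<bar> = \<bar>s\<bar> * \<bar>real i - y\<bar>" by (simp add: abs_mult[symmetric] algebra_simps)
      also have "\<dots> \<le> \<bar>s\<bar> * (\<delta> * i + (\<bar>A\<bar> + m))" using that by (intro mult_left_mono) auto
      finally show ?thesis by (simp add: distrib_left)
    qed
    have up: "a i - s * i \<le> \<delta> * i + A + \<bar>s\<bar> * (\<delta> * i) + \<bar>s\<bar> * (\<bar>A\<bar> + m)"
      using A(1)[OF Nn] 1(2) sgap[OF gap(1)] L\<delta> by linarith
    have "\<delta> * L (Suc n) \<le> \<delta> * (2 * real i + \<bar>A\<bar>)"
    proof (rule mult_left_mono)
      have "\<delta> * L n \<le> 1 * real (L n)" using \<delta> by (intro mult_right_mono) auto
      then show "real (L (Suc n)) \<le> 2 * real i + \<bar>A\<bar>" using LS Li by linarith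
    qed (use \<delta> in simp)
    also have "\<dots> \<le> 2 * (\<delta> * i) + \<bar>A\<bar>" using \<delta> by (simp add: distrib_left mult_left_le_one_le)
    finally have "\<delta> * L (Suc n) \<le> 2 * (\<delta> * i) + \<bar>A\<bar>" .
    moreover have "\<bar>a (L (Suc n) + m) - s * L (Suc n)\<bar> \<le> \<delta> * L (Suc n) + A" using A(1) Nn by simp
    moreover have "\<bar>s * i - s * L (Suc n)\<bar> \<le> \<bar>s\<bar> * (\<delta> * i) + \<bar>s\<bar> * (\<bar>A\<bar> + m)"
      using gap(2) by (intro sgap) (simp add: abs_minus_commute)
    ultimately have down: "- (a i - s * i) \<le> 2 * (\<delta> * i) + 2 * \<bar>A\<bar> + \<bar>s\<bar> * (\<delta> * i) + \<bar>s\<bar> * (\<bar>A\<bar> + m)"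
      using 1(1) by linarith
    have "2 * (\<delta> * i) + \<bar>s\<bar> * (\<delta> * i) = (2 + \<bar>s\<bar>) * \<delta> * i" by (simp add: algebra_simps)
    also have "\<dots> \<le> \<epsilon> * i" using \<delta>\<epsilon> by (intro mult_right_mono) auto
    finally have "2 * (\<delta> * i) + \<bar>s\<bar> * (\<delta> * i) \<le> \<epsilon> * i" .
    moreover have "0 \<le> \<delta> * i" using \<delta> by simp
    ultimately show "\<bar>a i - s * i\<bar> \<le> \<epsilon> * i + E" using up down unfolding E_def by linarith
  qed
qed

section \<open>The interval of local dimensions\<close>

context net_interval_measure begin

text \<open>A word is stored with its exponent \<open>l\<close>, which serves as its length in the gluing system.\<close>

definition inner_words :: "(nat list \<times> nat) set"
  where "inner_words = {(\<tau>, l). exact \<tau> l \<and> S_word \<tau> ` {0..1} \<subseteq> cint Ds}"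

definition weight :: "nat list \<times> nat \<Rightarrow> real"
  where "weight u = ln (P (snd u + m) (copy (fst u)))"

lemma inner_wordsD:
  assumes "u \<in> inner_words"
  shows "exact (fst u) (snd u)" "S_word (fst u) ` {0..1} \<subseteq> cint Ds"
    "copy (fst u) \<in> net_intervals (snd u + m)" "cint (copy (fst u)) \<subseteq> cint Ds"
    "0 < P (snd u + m) (copy (fst u))"
proof -
  show 1: "exact (fst u) (snd u)" "S_word (fst u) ` {0..1} \<subseteq> cint Ds" using assms by (auto simp: inner_words_def)
  show 2: "copy (fst u) \<in> net_intervals (snd u + m)" by (rule copy_net_interval[OF 1(1)])
  show "cint (copy (fst u)) \<subseteq> cint Ds" using copy_subset_image[OF 1(1)] 1(2) by (rule subset_trans)
  show "0 < P (snd u + m) (copy (fst u))" by (rule P_pos[OF 2])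
qed

text \<open>Glue through the word that \<open>P_gluing\<close> places inside \<open>copy (fst u)\<close>. The image of the glued word then lies
inside \<open>copy (fst u)\<close>, which makes the copies of an iterated gluing nested.\<close>

lemma gluing_exists:
  obtains glue and C :: real where "\<And>u v. u \<in> inner_words \<Longrightarrow> v \<in> inner_words \<Longrightarrow> glue u v \<in> inner_words \<and>
    snd u + snd v \<le> snd (glue u v) \<and> real (snd (glue u v)) \<le> real (snd u) + real (snd v) + C \<and>
    \<bar>weight (glue u v) - weight u - weight v\<bar> \<le> C \<and>
    cint (copy (fst (glue u v))) \<subseteq> cint (copy (fst u))"
proof -
  obtain C0 c where c: "0 < c" and G: "\<And>n \<Delta>. \<Delta> \<in> net_intervals n \<Longrightarrow>
    \<exists>\<tau> l. gluing_word c n \<Delta> \<tau> l \<and> l \<le> n + C0"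
    by (rule P_gluing) (rule that)
  obtain C1 where C1: "0 < C1" and T: "\<And>m' \<Delta>' f i \<Delta>\<^sub>1. similar_net m Ds m' \<Delta>' f \<Longrightarrow>
      \<Delta>\<^sub>1 \<in> net_intervals (m + i) \<Longrightarrow> cint \<Delta>\<^sub>1 \<subseteq> cint Ds \<Longrightarrow>
      P (m' + i) (map_prod f f \<Delta>\<^sub>1) \<le> C1 * P m' \<Delta>' * P (m + i) \<Delta>\<^sub>1"
    by (rule P_transport[OF Ds_net]) (rule that)
  define C where "C = max (real (m + C0)) (\<bar>ln c\<bar> + \<bar>ln C1\<bar>)"
  have "\<exists>t. gluing_word c (snd u + m) (copy (fst u)) (fst t) (snd t) \<and> snd t \<le> snd u + m + C0"
    if u: "u \<in> inner_words" for u
  proof -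
    obtain \<tau> l where "gluing_word c (snd u + m) (copy (fst u)) \<tau> l" "l \<le> snd u + m + C0"
      using G[OF inner_wordsD(3)[OF u]] by blast
    then show ?thesis by (intro exI[of _ "(\<tau>, l)"]) simp
  qed
  then have "\<forall>u\<in>inner_words. \<exists>t. gluing_word c (snd u + m) (copy (fst u)) (fst t) (snd t) \<and>
      snd t \<le> snd u + m + C0" by (rule ballI)
  then obtain t where t: "\<forall>u\<in>inner_words. gluing_word c (snd u + m) (copy (fst u)) (fst (t u)) (snd (t u)) \<and>
      snd (t u) \<le> snd u + m + C0"
    by (rule bchoice[THEN exE])
  define glue where "glue u v = (fst (t u) @ fst v, snd (t u) + snd v)" for u v :: "nat list \<times> nat"
  show ?thesis
  proof (rule that[of glue C])
    fix u v assume u: "u \<in> inner_words" and v: "v \<in> inner_words"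
    have tu: "exact (fst (t u)) (snd (t u))" "S_word (fst (t u)) ` {0..1} \<subseteq> cint (copy (fst u))"
      "snd u + m \<le> snd (t u)" "snd (t u) \<le> snd u + m + C0" using t u by (simp_all add: gluing_word_def)
    note wu = inner_wordsD[OF u] and wv = inner_wordsD[OF v]
    have ex: "exact (fst (glue u v)) (snd (glue u v))"
      unfolding glue_def fst_conv snd_conv by (rule exact_append[OF tu(1) wv(1)])
    have sub: "S_word (fst (glue u v)) ` {0..1} \<subseteq> cint (copy (fst u))"
    proof -
      have "fst v \<in> words" using wv(1) by (simp add: exact_def)
      then have "S_word (fst (glue u v)) ` {0..1} \<subseteq> S_word (fst (t u)) ` {0..1}"
        unfolding glue_def fst_conv by (rule S_word_append_image)
      then show ?thesis using tu(2) by (rule subset_trans)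
    qed
    have inner: "glue u v \<in> inner_words"
      unfolding inner_words_def using ex subset_trans[OF sub wu(4)] by (simp add: case_prod_beta)
    let ?p = "P (snd u + m) (copy (fst u))" and ?q = "P (snd v + m) (copy (fst v))"
    let ?g = "P (snd (glue u v) + m) (copy (fst (glue u v)))"
    have low: "c * ?p * ?q \<le> ?g"
      using t u wv(1) by (simp add: gluing_word_def glue_def add.assoc)
    have "?g \<le> C1 * P (snd (t u) + m) (copy (fst (t u))) * ?q"
    proof -
      have "copy (fst v) \<in> net_intervals (m + snd v)" using wv(3) by (simp add: add.commute)
      from T[OF copy_similar[OF tu(1)] this wv(4)] show ?thesis
        by (simp add: glue_def copy_append add_ac)
    qed
    also have "\<dots> \<le> C1 * ?p * ?q"
    proof (intro mult_right_mono mult_left_mono)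
      show "P (snd (t u) + m) (copy (fst (t u))) \<le> ?p"
      proof (rule P_antimono[OF _ wu(3) copy_net_interval[OF tu(1)]])
        show "cint (copy (fst (t u))) \<subseteq> cint (copy (fst u))"
          using copy_subset_image[OF tu(1)] tu(2) by (rule subset_trans)
      qed (use tu(3) in simp)
    qed (use C1 wv(5) in simp_all)
    finally have up: "?g \<le> C1 * ?p * ?q" .
    have "ln (c * ?p * ?q) \<le> weight (glue u v)"
      unfolding weight_def using low c wu(5) wv(5) inner_wordsD(5)[OF inner] by (subst ln_le_cancel_iff) simp_all
    moreover have "ln (c * ?p * ?q) = ln c + weight u + weight v"
      using c wu(5) wv(5) by (simp add: weight_def ln_mult_pos)
    moreover have "weight (glue u v) \<le> ln (C1 * ?p * ?q)"
      unfolding weight_def using up C1 wu(5) wv(5) inner_wordsD(5)[OF inner] by (subst ln_le_cancel_iff) simp_all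
    moreover have "ln (C1 * ?p * ?q) = ln C1 + weight u + weight v"
      using C1 wu(5) wv(5) by (simp add: weight_def ln_mult_pos)
    moreover have "\<bar>ln c\<bar> + \<bar>ln C1\<bar> \<le> C" by (simp add: C_def)
    ultimately have w: "\<bar>weight (glue u v) - weight u - weight v\<bar> \<le> C" by linarith
    have "real (m + C0) \<le> C" by (simp add: C_def)
    moreover have "snd (glue u v) \<le> snd u + snd v + (m + C0)" using tu(4) by (simp add: glue_def)
    ultimately have len: "real (snd (glue u v)) \<le> real (snd u) + real (snd v) + C" by linarith
    have "cint (copy (fst (glue u v))) \<subseteq> cint (copy (fst u))"
      using copy_subset_image[OF ex] sub by (rule subset_trans)
    moreover have "snd u + snd v \<le> snd (glue u v)" using tu(3) by (simp add: glue_def)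
    ultimately show "glue u v \<in> inner_words \<and> snd u + snd v \<le> snd (glue u v) \<and>
      real (snd (glue u v)) \<le> real (snd u) + real (snd v) + C \<and>
      \<bar>weight (glue u v) - weight u - weight v\<bar> \<le> C \<and>
      cint (copy (fst (glue u v))) \<subseteq> cint (copy (fst u))"
      using inner w len by blast
  qed
qed

lemma weight_linear_bound:
  obtains B :: real where "\<And>u. u \<in> inner_words \<Longrightarrow> \<bar>weight u\<bar> \<le> B * (real (snd u) + 1)"
proof -
  obtain B where B: "\<And>n \<Delta>. \<Delta> \<in> net_intervals n \<Longrightarrow> r_min ^ (Suc n * B) \<le> P n \<Delta>"
    by (rule P_lower) (rule that)
  have ln\<rho>: "ln r_min < 0" using r_min_bounds by simp
  define D where "D = real B * - ln r_min"
  have D: "0 \<le> D" unfolding D_def using ln\<rho> by (intro mult_nonneg_nonneg) simp_all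
  have "\<bar>weight u\<bar> \<le> D * (real m + 1) * (real (snd u) + 1)" if u: "u \<in> inner_words" for u
  proof -
    note wu = inner_wordsD[OF u]
    have "ln (r_min ^ (Suc (snd u + m) * B)) \<le> weight u"
      unfolding weight_def using B[OF wu(3)] wu(5) r_min_power_bounds(1) by (subst ln_le_cancel_iff)
    moreover have "ln (r_min ^ (Suc (snd u + m) * B)) = - (D * (snd u + m + 1))"
      using r_min_bounds by (subst ln_realpow) (simp_all add: D_def algebra_simps)
    moreover have "weight u \<le> 0" unfolding weight_def using wu(5) P_le_1 by simp
    moreover have "D * (snd u + m + 1) \<le> D * ((m + 1) * (snd u + 1))"
      using D by (intro mult_left_mono) (simp_all add: algebra_simps)
    moreover have "D * real ((m + 1) * (snd u + 1)) = D * (real m + 1) * (real (snd u) + 1)"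
      by (simp only: of_nat_mult of_nat_add of_nat_1 mult.assoc)
    ultimately show ?thesis by linarith
  qed
  then show ?thesis by (rule that)
qed

lemma inner_words_unbounded: "\<exists>u\<in>inner_words. j \<le> snd u"
proof -
  have "fst Ds \<in> endpoints (m + j)" "snd Ds \<in> endpoints (m + j)"
    using net_interval_props(1,2)[OF Ds_net] endpoints_mono[of m "m + j"] by auto
  then obtain b where b: "(fst Ds, b) \<in> net_intervals (m + j)" "b \<le> snd Ds"
    using net_interval_right net_interval_props(3)[OF Ds_net] by metis
  obtain \<tau> l where \<tau>: "exact \<tau> l" "m + j \<le> l" "S_word \<tau> ` {0..1} \<subseteq> cint (fst Ds, b)"
    by (rule copy_inside[OF b(1)]) (rule that)
  have "cint (fst Ds, b) \<subseteq> cint Ds" using b(2) by simp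
  with \<tau>(3) have "S_word \<tau> ` {0..1} \<subseteq> cint Ds" by (rule subset_trans)
  then have "(\<tau>, l) \<in> inner_words" using \<tau>(1) by (simp add: inner_words_def)
  then show ?thesis using \<tau>(2) by (intro bexI[of _ "(\<tau>, l)"]) simp_all
qed

text \<open>Net intervals below a net interval similar to some part of \<open>Ds\<close> are matched, with bounded errors, by
inner words.\<close>

lemma transport_weight:
  assumes "similar_net N \<Delta> n0 D f" "cint D \<subseteq> cint Ds"
  obtains C where "\<And>i \<Delta>'. \<Delta>' \<in> net_intervals (N + i) \<Longrightarrow> cint \<Delta>' \<subseteq> cint \<Delta> \<Longrightarrow>
    \<exists>u\<in>inner_words. \<bar>weight u - ln (P (N + i) \<Delta>')\<bar> \<le> C \<and> i \<le> snd u \<and> real (snd u) \<le> i + C"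
proof -
  note d = similar_netD[OF assms(1)]
  obtain g where g: "similar_net n0 D N \<Delta> g" "\<And>x. g (f x) = x" "\<And>x. f (g x) = x"
    by (rule similar_net_sym[OF assms(1)]) (rule that)
  obtain C1 where C1: "0 < C1" "\<And>m' \<Delta>' f i \<Delta>\<^sub>1. similar_net N \<Delta> m' \<Delta>' f \<Longrightarrow>
      \<Delta>\<^sub>1 \<in> net_intervals (N + i) \<Longrightarrow> cint \<Delta>\<^sub>1 \<subseteq> cint \<Delta> \<Longrightarrow>
      P (m' + i) (map_prod f f \<Delta>\<^sub>1) \<le> C1 * P m' \<Delta>' * P (N + i) \<Delta>\<^sub>1"
    by (rule P_transport[OF d(1)]) (rule that)
  obtain C2 where C2: "0 < C2" "\<And>m' \<Delta>' f i \<Delta>\<^sub>1. similar_net n0 D m' \<Delta>' f \<Longrightarrow>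
      \<Delta>\<^sub>1 \<in> net_intervals (n0 + i) \<Longrightarrow> cint \<Delta>\<^sub>1 \<subseteq> cint D \<Longrightarrow>
      P (m' + i) (map_prod f f \<Delta>\<^sub>1) \<le> C2 * P m' \<Delta>' * P (n0 + i) \<Delta>\<^sub>1"
    by (rule P_transport[OF d(2)]) (rule that)
  obtain C0 c where c: "0 < c" and G: "\<And>n \<Delta>. \<Delta> \<in> net_intervals n \<Longrightarrow>
    \<exists>\<tau> l. gluing_word c n \<Delta> \<tau> l \<and> l \<le> n + C0"
    by (rule P_gluing) (rule that)
  have pD: "0 < P n0 D" and p\<Delta>: "0 < P N \<Delta>" and pDs: "0 < P m Ds"
    using P_pos d(1,2) Ds_net by blast+
  define K1 K2 where "K1 = C1 * P n0 D" and "K2 = C2 * P N \<Delta>"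
  have K: "0 < K1" "0 < K2" using C1(1) C2(1) pD p\<Delta> by (simp_all add: K1_def K2_def)
  define C where "C = max (real (n0 + C0)) (\<bar>ln K1\<bar> + \<bar>ln K2\<bar> + \<bar>ln c\<bar> + \<bar>ln (P m Ds)\<bar>)"
  show ?thesis
  proof (rule that)
    fix i \<Delta>' assume \<Delta>': "\<Delta>' \<in> net_intervals (N + i)" "cint \<Delta>' \<subseteq> cint \<Delta>"
    let ?E = "map_prod f f \<Delta>'"
    note e = similar_net_descendant[OF assms(1) \<Delta>']
    have En: "?E \<in> net_intervals (n0 + i)" by (rule similar_netD(2)[OF e(1)])
    have pos: "0 < P (N + i) \<Delta>'" "0 < P (n0 + i) ?E" using P_pos \<Delta>'(1) En by blast+
    have 1: "P (n0 + i) ?E \<le> K1 * P (N + i) \<Delta>'"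
      unfolding K1_def by (rule C1(2)[OF assms(1) \<Delta>'])
    have gf: "map_prod g g ?E = \<Delta>'" by (cases \<Delta>') (simp add: g(2))
    have 2: "P (N + i) \<Delta>' \<le> K2 * P (n0 + i) ?E"
      using C2(2)[OF g(1) En e(2)] unfolding gf K2_def .
    obtain \<tau> l where gw: "gluing_word c (n0 + i) ?E \<tau> l" "l \<le> n0 + i + C0"
      using G[OF En] by blast
    then have \<tau>: "exact \<tau> l" "S_word \<tau> ` {0..1} \<subseteq> cint ?E" "n0 + i \<le> l" "l \<le> n0 + i + C0"
      "\<forall>\<tau>' l'. exact \<tau>' l' \<longrightarrow> c * P (n0 + i) ?E * P (l' + m) (copy \<tau>') \<le> P (l + (l' + m)) (copy (\<tau> @ \<tau>'))"
      by (simp_all add: gluing_word_def)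
    have 3: "c * P (n0 + i) ?E * P m Ds \<le> P (l + m) (copy \<tau>)"
      using \<tau>(5)[rule_format, OF exact_Nil] by (simp add: copy_Nil)
    have "cint (copy \<tau>) \<subseteq> cint ?E" using copy_subset_image[OF \<tau>(1)] \<tau>(2) by (rule subset_trans)
    then have 4: "P (l + m) (copy \<tau>) \<le> P (n0 + i) ?E"
      using \<tau>(3) by (intro P_antimono[OF _ En copy_net_interval[OF \<tau>(1)]]) simp_all
    have mem: "(\<tau>, l) \<in> inner_words"
      unfolding inner_words_def using \<tau>(1) subset_trans[OF \<tau>(2) subset_trans[OF e(2) assms(2)]] by simp
    have p4: "0 < P (l + m) (copy \<tau>)" by (rule P_pos[OF copy_net_interval[OF \<tau>(1)]])
    have "ln (P (n0 + i) ?E) \<le> ln K1 + ln (P (N + i) \<Delta>')"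
      using 1 pos K by (simp add: ln_mult_pos[symmetric])
    moreover have "ln (P (N + i) \<Delta>') \<le> ln K2 + ln (P (n0 + i) ?E)"
      using 2 pos K by (simp add: ln_mult_pos[symmetric])
    moreover have "ln c + ln (P (n0 + i) ?E) + ln (P m Ds) \<le> weight (\<tau>, l)"
      unfolding weight_def using 3 p4 pos c pDs by (simp add: ln_mult_pos[symmetric])
    moreover have "weight (\<tau>, l) \<le> ln (P (n0 + i) ?E)" unfolding weight_def using 4 p4 pos by simp
    moreover have "\<bar>ln K1\<bar> + \<bar>ln K2\<bar> + \<bar>ln c\<bar> + \<bar>ln (P m Ds)\<bar> \<le> C" by (simp add: C_def)
    ultimately have "\<bar>weight (\<tau>, l) - ln (P (N + i) \<Delta>')\<bar> \<le> C" by linarith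
    moreover have "real (n0 + C0) \<le> C" by (simp add: C_def)
    then have "real l \<le> i + C" using \<tau>(4) by linarith
    moreover have "i \<le> l" using \<tau>(3) by simp
    ultimately show "\<exists>u\<in>inner_words. \<bar>weight u - ln (P (N + i) \<Delta>')\<bar> \<le> C \<and> i \<le> snd u \<and> real (snd u) \<le> i + C"
      using mem by (intro bexI[of _ "(\<tau>, l)"]) simp_all
  qed
qed

text \<open>The copies occur only in some generations; the generations in between are filled with their ancestors.\<close>

lemma point_of_nested_copies:
  assumes \<theta>: "\<And>n. \<theta> n \<in> inner_words" and nest: "\<And>n. cint (copy (fst (\<theta> (Suc n)))) \<subseteq> cint (copy (fst (\<theta> n)))"
    and len: "\<And>n. snd (\<theta> n) < snd (\<theta> (Suc n))"
  obtains x \<Delta> where "x \<in> essential_points" "\<And>n. \<Delta> n \<in> net_intervals n" "\<And>n. x \<in> cint (\<Delta> n)"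
    "\<And>n. cint (\<Delta> (Suc n)) \<subseteq> cint (\<Delta> n)" "\<And>n. \<Delta> (snd (\<theta> n) + m) = copy (fst (\<theta> n))"
proof -
  let ?I = "\<lambda>n. cint (copy (fst (\<theta> n)))"
  have net: "copy (fst (\<theta> n)) \<in> net_intervals (snd (\<theta> n) + m)" for n by (rule inner_wordsD(3)[OF \<theta>])
  have ne: "fst (copy (fst (\<theta> n))) < snd (copy (fst (\<theta> n)))" for n by (rule net_interval_props(3)[OF net])
  have anti: "?I b \<subseteq> ?I a" if "a \<le> b" for a b
    using lift_Suc_antimono_le[of ?I, OF nest that] .
  have "(\<Inter>n. ?I n) \<noteq> {}"
  proof (rule compact_nest)
    show "compact (?I n)" for n by simp
    show "?I n \<noteq> {}" for n using ne[of n] by simp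
    show "?I b \<subseteq> ?I a" if "a \<le> b" for a b by (rule anti[OF that])
  qed
  then obtain x where x: "\<And>n. x \<in> ?I n" by blast
  have big: "n \<le> snd (\<theta> n)" for n
    using strict_mono_imp_increasing[OF strict_monoI_Suc[of "\<lambda>n. snd (\<theta> n)", OF len]] .
  have "\<forall>n. \<exists>D. D \<in> net_intervals n \<and> (\<exists>i. n \<le> snd (\<theta> i) + m \<and> ?I i \<subseteq> cint D)"
  proof
    fix n
    have le: "n \<le> snd (\<theta> n) + m" using big[of n] by simp
    obtain D where "D \<in> net_intervals n" "?I n \<subseteq> cint D" by (rule ancestor_exists[OF le net]) (rule that)
    then show "\<exists>D. D \<in> net_intervals n \<and> (\<exists>i. n \<le> snd (\<theta> i) + m \<and> ?I i \<subseteq> cint D)"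
      using le by blast
  qed
  then obtain \<Delta> where \<Delta>: "\<And>n. \<Delta> n \<in> net_intervals n \<and> (\<exists>i. n \<le> snd (\<theta> i) + m \<and> ?I i \<subseteq> cint (\<Delta> n))"
    by metis
  have \<Delta>n: "\<Delta> n \<in> net_intervals n" for n using \<Delta> by blast
  have \<Delta>i: "\<exists>i0. \<forall>i\<ge>i0. ?I i \<subseteq> cint (\<Delta> n)" for n
  proof -
    obtain i0 where "?I i0 \<subseteq> cint (\<Delta> n)" using \<Delta> by blast
    then have "\<forall>i\<ge>i0. ?I i \<subseteq> cint (\<Delta> n)" using anti subset_trans by blast
    then show ?thesis ..
  qed
  have eq: "\<Delta> n = D" if D: "D \<in> net_intervals n" "?I i \<subseteq> cint D" for n D i
  proof -
    obtain i0 where i0: "\<forall>i\<ge>i0. ?I i \<subseteq> cint (\<Delta> n)" using \<Delta>i by blast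
    have "?I (max i i0) \<subseteq> cint (\<Delta> n)" using i0 by simp
    moreover have "?I (max i i0) \<subseteq> cint D" by (rule subset_trans[OF anti D(2)]) simp
    ultimately show ?thesis by (rule ancestor_unique[OF \<Delta>n D(1) _ _ ne])
  qed
  have x\<Delta>: "x \<in> cint (\<Delta> n)" for n using \<Delta>i[of n] x by blast
  have nested: "cint (\<Delta> (Suc n)) \<subseteq> cint (\<Delta> n)" for n
  proof -
    obtain i0 where i0: "\<forall>i\<ge>i0. ?I i \<subseteq> cint (\<Delta> n)" using \<Delta>i by blast
    obtain i1 where i1: "\<forall>i\<ge>i1. ?I i \<subseteq> cint (\<Delta> (Suc n))" using \<Delta>i by blast
    have "?I (max i0 i1) \<subseteq> cint (\<Delta> n)" "?I (max i0 i1) \<subseteq> cint (\<Delta> (Suc n))" using i0 i1 by simp_all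
    then show ?thesis by (rule descendant_through[OF \<Delta>n \<Delta>n le_SucI[OF order_refl] _ _ ne])
  qed
  have "\<Delta> m = Ds" using inner_wordsD(4)[OF \<theta>, of 0] by (intro eq[OF Ds_net, of 0])
  then have "x \<in> essential_points" by (intro essential_pointsI[of \<Delta>] \<Delta>n x\<Delta> nested)
  moreover have "\<Delta> (snd (\<theta> n) + m) = copy (fst (\<theta> n))" for n by (rule eq[OF net order_refl])
  ultimately show ?thesis using that \<Delta>n x\<Delta> nested by blast
qed

text \<open>The rates of the gluing system are exactly the numbers \<open>D * ln r_min\<close> with \<open>D\<close> a local dimension at an essential
point.\<close>

theorem local_dims_essential_interval:
  assumes comp: comparable
  shows "\<exists>a b. a \<le> b \<and> local_dims \<mu> essential_points = {a..b}"
proof -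
  obtain glue and C :: real where glue: "\<And>u v. u \<in> inner_words \<Longrightarrow> v \<in> inner_words \<Longrightarrow> glue u v \<in> inner_words \<and>
    snd u + snd v \<le> snd (glue u v) \<and> real (snd (glue u v)) \<le> real (snd u) + real (snd v) + C \<and>
    \<bar>weight (glue u v) - weight u - weight v\<bar> \<le> C \<and>
    cint (copy (fst (glue u v))) \<subseteq> cint (copy (fst u))"
    by (rule gluing_exists) (rule that)
  obtain B :: real where B: "\<And>u. u \<in> inner_words \<Longrightarrow> \<bar>weight u\<bar> \<le> B * (real (snd u) + 1)"
    by (rule weight_linear_bound) (rule that)
  interpret gluing_system inner_words snd weight glue C B
  proof
    show "\<exists>u\<in>inner_words. j \<le> snd u" for j by (rule inner_words_unbounded)
  qed (use glue B in \<open>simp_all add: add.commute\<close>)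
  let ?R = "{s. rate_below s \<and> rate_above s}"
  have realised: "\<exists>x\<in>essential_points. has_local_dim \<mu> x (s / ln r_min)" if s: "s \<in> ?R" for s
  proof -
    obtain \<theta> where \<theta>: "\<And>n. \<theta> n \<in> inner_words" "\<And>n. \<exists>w\<in>inner_words. \<theta> (Suc n) = glue (\<theta> n) w"
      "\<And>n. snd (\<theta> n) < snd (\<theta> (Suc n))"
      "\<And>\<epsilon>::real. 0 < \<epsilon> \<Longrightarrow> \<exists>A N. \<forall>n\<ge>N. \<bar>weight (\<theta> n) - s * real (snd (\<theta> n))\<bar> \<le> \<epsilon> * real (snd (\<theta> n)) + A \<and>
        real (snd (\<theta> (Suc n))) \<le> (1 + \<epsilon>) * real (snd (\<theta> n)) + A"
      by (rule greedy_gluing[of s]) (use s that in auto)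
    have nest: "cint (copy (fst (\<theta> (Suc n)))) \<subseteq> cint (copy (fst (\<theta> n)))" for n
      using glue[OF \<theta>(1)] \<theta>(2)[of n] by metis
    obtain x \<Delta> where x: "x \<in> essential_points" "\<And>n. \<Delta> n \<in> net_intervals n" "\<And>n. x \<in> cint (\<Delta> n)"
      "\<And>n. cint (\<Delta> (Suc n)) \<subseteq> cint (\<Delta> n)" "\<And>n. \<Delta> (snd (\<theta> n) + m) = copy (fst (\<theta> n))"
      by (rule point_of_nested_copies[of \<theta>, OF \<theta>(1) nest \<theta>(3)]) (rule that)
    have "(\<lambda>n. ln (P n (\<Delta> n)) / n) \<longlonglongrightarrow> s"
    proof (rule antimono_interpolation[where L = "\<lambda>n. snd (\<theta> n)" and m = m])
      show "ln (P (Suc n) (\<Delta> (Suc n))) \<le> ln (P n (\<Delta> n))" for n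
        using P_antimono[OF le_SucI[OF order_refl] x(2) x(2) x(4), of n] P_pos[OF x(2)] by simp
      show "\<exists>A N. \<forall>n\<ge>N. \<bar>ln (P (snd (\<theta> n) + m) (\<Delta> (snd (\<theta> n) + m))) - s * real (snd (\<theta> n))\<bar> \<le> \<epsilon> * real (snd (\<theta> n)) + A \<and>
        real (snd (\<theta> (Suc n))) \<le> (1 + \<epsilon>) * real (snd (\<theta> n)) + A" if "0 < \<epsilon>" for \<epsilon> :: real
        using \<theta>(4)[OF that] unfolding x(5) weight_def .
    qed (rule \<theta>(3))
    moreover have "s / ln r_min * ln r_min = s" using r_min_bounds by simp
    ultimately have "has_local_dim \<mu> x (s / ln r_min)"
      using has_local_dim_iff[OF comp x(2,3)] by simp
    then show ?thesis using x(1) by blast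
  qed
  have rate: "D * ln r_min \<in> ?R" if x: "x \<in> essential_points" and D: "has_local_dim \<mu> x D" for x D
  proof -
    define s where "s = D * ln r_min"
    obtain \<Delta> N n0 D0 f where \<Delta>: "\<And>n. \<Delta> n \<in> net_intervals n" "\<And>n. x \<in> cint (\<Delta> n)"
      "\<And>n. cint (\<Delta> (N + n)) \<subseteq> cint (\<Delta> N)" "similar_net N (\<Delta> N) n0 D0 f" "cint D0 \<subseteq> cint Ds"
      by (rule essential_pointsE[OF x]) (rule that)
    have lim: "(\<lambda>n. ln (P n (\<Delta> n)) / n) \<longlonglongrightarrow> s"
      using has_local_dim_iff[OF comp \<Delta>(1,2)] D unfolding s_def by simp
    obtain K where K: "\<And>i \<Delta>'. \<Delta>' \<in> net_intervals (N + i) \<Longrightarrow> cint \<Delta>' \<subseteq> cint (\<Delta> N) \<Longrightarrow>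
      \<exists>u\<in>inner_words. \<bar>weight u - ln (P (N + i) \<Delta>')\<bar> \<le> K \<and> i \<le> snd u \<and> real (snd u) \<le> i + K"
      by (rule transport_weight[OF \<Delta>(4,5)]) (rule that)
    have approx: "\<exists>u\<in>inner_words. j \<le> snd u \<and> \<bar>weight u - s * real (snd u)\<bar> \<le> \<epsilon> * real (snd u)" if \<epsilon>: "0 < \<epsilon>" for \<epsilon> :: real and j
    proof -
      obtain M where M: "\<And>n. n \<ge> M \<Longrightarrow> \<bar>ln (P n (\<Delta> n)) - s * n\<bar> \<le> \<epsilon> / 2 * n"
        by (rule linear_rateD[OF lim, of "\<epsilon> / 2"]) (use \<epsilon> in auto)
      define Q where "Q = \<bar>K\<bar> + \<epsilon> / 2 * N + \<bar>s\<bar> * (\<bar>K\<bar> + N)"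
      obtain M2 :: nat where M2: "2 * Q / \<epsilon> < M2" using reals_Archimedean2 by blast
      define i where "i = max j (max M M2)"
      obtain u where u: "u \<in> inner_words" "\<bar>weight u - ln (P (N + i) (\<Delta> (N + i)))\<bar> \<le> K" "i \<le> snd u" "real (snd u) \<le> i + K"
        using K[OF \<Delta>(1,3)] by blast
      have "\<bar>ln (P (N + i) (\<Delta> (N + i))) - s * (N + i)\<bar> \<le> \<epsilon> / 2 * (N + i)"
        by (rule M) (simp add: i_def)
      moreover have "\<epsilon> / 2 * real (N + i) = \<epsilon> / 2 * N + \<epsilon> / 2 * i" by (simp add: distrib_left)
      moreover have "\<bar>s * real (N + i) - s * real (snd u)\<bar> \<le> \<bar>s\<bar> * (\<bar>K\<bar> + N)"
      proof -
        have "\<bar>s * real (N + i) - s * real (snd u)\<bar> = \<bar>s\<bar> * \<bar>real (N + i) - real (snd u)\<bar>"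
          by (simp add: abs_mult[symmetric] right_diff_distrib)
        also have "\<dots> \<le> \<bar>s\<bar> * (\<bar>K\<bar> + N)" using u(3,4) by (intro mult_left_mono) auto
        finally show ?thesis .
      qed
      moreover have "\<epsilon> / 2 * i \<le> \<epsilon> / 2 * real (snd u)" using u(3) \<epsilon> by simp
      ultimately have "\<bar>weight u - s * real (snd u)\<bar> \<le> \<epsilon> / 2 * real (snd u) + Q"
        using u(2) unfolding Q_def by linarith
      moreover have "Q \<le> \<epsilon> / 2 * real (snd u)"
      proof -
        have "real M2 \<le> real (snd u)" using u(3) by (simp add: i_def)
        then have "2 * Q / \<epsilon> < real (snd u)" using M2 by linarith
        then show ?thesis using \<epsilon> by (simp add: pos_divide_less_eq mult.commute)
      qed
      moreover have "\<epsilon> * real (snd u) = \<epsilon> / 2 * real (snd u) + \<epsilon> / 2 * real (snd u)" by simp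
      ultimately have "\<bar>weight u - s * real (snd u)\<bar> \<le> \<epsilon> * real (snd u)" by linarith
      moreover have "j \<le> snd u" using u(3) by (simp add: i_def)
      ultimately show ?thesis using u(1) by blast
    qed
    have "rate_below s"
      unfolding rate_below_def
    proof (intro allI impI)
      fix \<epsilon> :: real and j assume "0 < \<epsilon>"
      then obtain u where u: "u \<in> inner_words" "j \<le> snd u" "\<bar>weight u - s * real (snd u)\<bar> \<le> \<epsilon> * real (snd u)" using approx by blast
      then show "\<exists>u\<in>inner_words. j \<le> snd u \<and> weight u \<le> (s + \<epsilon>) * real (snd u)"
        by (intro bexI[of _ u]) (simp_all add: distrib_right abs_le_iff)
    qed
    moreover have "rate_above s"
      unfolding rate_above_def
    proof (intro allI impI)
      fix \<epsilon> :: real and j assume "0 < \<epsilon>"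
      then obtain u where u: "u \<in> inner_words" "j \<le> snd u" "\<bar>weight u - s * real (snd u)\<bar> \<le> \<epsilon> * real (snd u)" using approx by blast
      then show "\<exists>u\<in>inner_words. j \<le> snd u \<and> (s - \<epsilon>) * real (snd u) \<le> weight u"
        by (intro bexI[of _ u]) (simp_all add: left_diff_distrib abs_le_iff)
    qed
    ultimately show ?thesis by (simp add: s_def)
  qed
  obtain a b where ab: "a \<le> b" "?R = {a..b}" using rates_interval by blast
  have ln\<rho>: "ln r_min < 0" using r_min_bounds by simp
  have "D \<in> local_dims \<mu> essential_points \<longleftrightarrow> D \<in> {b / ln r_min..a / ln r_min}" for D
  proof -
    have "D \<in> local_dims \<mu> essential_points \<longleftrightarrow> D * ln r_min \<in> ?R"
    proof
      assume "D \<in> local_dims \<mu> essential_points"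
      then show "D * ln r_min \<in> ?R" using rate unfolding local_dims_def by blast
    next
      assume "D * ln r_min \<in> ?R"
      from realised[OF this] show "D \<in> local_dims \<mu> essential_points"
        using ln\<rho> unfolding local_dims_def by simp
    qed
    also have "\<dots> \<longleftrightarrow> a \<le> D * ln r_min \<and> D * ln r_min \<le> b" unfolding ab(2) by simp
    also have "\<dots> \<longleftrightarrow> D \<in> {b / ln r_min..a / ln r_min}"
      using ln\<rho> by (auto simp: neg_divide_le_eq neg_le_divide_eq)
    finally show ?thesis .
  qed
  then have "local_dims \<mu> essential_points = {b / ln r_min..a / ln r_min}" by blast
  moreover have "b / ln r_min \<le> a / ln r_min" using ab(1) ln\<rho> by (simp add: divide_right_mono_neg)
  ultimately show ?thesis by blast
qed

end

theorem corollary4p15: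
  fixes k :: nat and r d p :: "nat \<Rightarrow> real" and K :: "real set" and \<mu> :: "real measure"
  assumes "self_similar_measure k r d K \<mu> p"
    and "ifs.finite_type k r d"
    and "K = {0..1}"
    and "self_similar_measure.comparable k r d K p"
  shows "\<exists>a b. a \<le> b \<and>
    local_dims \<mu> (self_similar_set.essential_points k r d K) = {a..b}"
proof -
  interpret self_similar_measure k r d K \<mu> p by (rule assms(1))
  interpret finite_type_interval_ifs k r d K
    by unfold_locales (use assms(2,3) in auto)
  obtain N where N: "\<And>n \<Delta>. \<Delta> \<in> net_intervals n \<Longrightarrow> card (S_word ` covering_words n \<Delta>) \<le> N"
    by (rule covering_maps_bounded) (rule that)
  let ?Q = "\<lambda>(n, \<Delta>). \<Delta> \<in> net_intervals n"
  let ?c = "\<lambda>(n, \<Delta>). card (S_word ` covering_words n \<Delta>)"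
  have "?Q (0, (0, 1))" by (simp add: net_intervals_def)
  moreover have "\<forall>y. ?Q y \<longrightarrow> ?c y < Suc N" using N by (auto simp: less_Suc_eq_le)
  ultimately obtain x where x: "?Q x" "\<forall>y. ?Q y \<longrightarrow> ?c y \<le> ?c x"
    using ex_has_greatest_nat[of ?Q _ ?c "Suc N"] by blast
  interpret net_interval_measure k r d K "fst x" "snd x" \<mu> p
  proof unfold_locales
    show "snd x \<in> net_intervals (fst x)" using x(1) by (simp add: case_prod_beta)
    show "card (S_word ` covering_words n \<Delta>) \<le> card (S_word ` covering_words (fst x) (snd x))"
      if "\<Delta> \<in> net_intervals n" for n \<Delta>
      using x(2)[rule_format, of "(n, \<Delta>)"] that by (simp add: case_prod_beta)
  qed
  show ?thesis by (rule local_dims_essential_interval[OF assms(4)])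
qed

end
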